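(* Let $\epsilon>0$. For every real $x>0$, every integer $q\ge1$ with $q\le x^{1/3}$, and every integer $l$ with $(l,q)=1$, \[ T_q(x;l) \ll_\epsilon \frac{x^{1/2+\epsilon}}{q}, \] where the implied constant depends at most on $\epsilon$.
   Context: A positive integer $n$ is squarefull if $n=1$ or, for every prime $p$ dividing $n$, $p^2$ also divides $n$. For real $x$, \[ T_q(x;l) := \#\{\, n\le x : n \text{ is a squarefull positive integer},\ n\equiv l \pmod q \,\}. \] $(l,q)$ is the greatest common divisor. $f\ll_\epsilon g$ means $|f|\le Cg$ for some constant $C>0$ that may depend on $\epsilon$. *)

theory Defs
  imports Complex_Main "HOL-Number_Theory.Number_Theory"
begin

(* 1 is squarefull, vacuously; 0 has to be excluded explicitly. *)
definition squarefull :: "nat \<Rightarrow> bool" where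
  "squarefull n \<longleftrightarrow> n > 0 \<and> (\<forall>p. prime p \<longrightarrow> p dvd n \<longrightarrow> p\<^sup>2 dvd n)"

definition squarefull_count :: "nat \<Rightarrow> real \<Rightarrow> int \<Rightarrow> nat" where
  "squarefull_count q x l =
     card {n :: nat. real n \<le> x \<and> squarefull n \<and> [int n = l] (mod int q)}"

end

theory Submission
  imports Defs "HOL-Computational_Algebra.Computational_Algebra"
    "HOL-Computational_Algebra.Fundamental_Theorem_Algebra" "HOL-Algebra.Algebraic_Closure_Type"
begin

text \<open>
  A squarefull number is \<open>a\<^sup>2 b\<^sup>3\<close>, so one counts solutions of \<open>a\<^sup>2 b\<^sup>3 = l\<close> modulo \<open>q\<close> with \<open>b\<close> in a
  dyadic range \<open>[M, 2M)\<close>. If \<open>M\<^sup>3 < q\<close>, for each \<open>b\<close> the number \<open>a\<close> lies in at most \<open>3 d(q)\<close> residue classes.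
  Otherwise the solutions are parametrised by \<open>t = a b\<close> as \<open>a = t\<^sup>3 / l\<close>, \<open>b = l / t\<^sup>2\<close>, and those in a short
  box are counted by a Fejer kernel majorant; this needs square-root cancellation in the sums of
  \<open>e ((u t\<^sup>3 + v t\<^sup>-\<^sup>2) / q)\<close> over units \<open>t\<close>. Prime powers are handled by stationary phase; for a prime the
  Weil bound is proved by Stepanov's method in Bombieri's form on the curve \<open>y\<^sup>p - y = u t\<^sup>3 + v t\<^sup>-\<^sup>2\<close>,
  combined with rationality of the L-function, a polynomial of degree 5.
\<close>

hide_const (open) up_ring.monom up_ring.coeff Divisibility.prime Divisibility.irreducible
  Polynomials.lead_coeff Polynomials.degree Coset.order module.smult

section \<open>Points on an Artin-Schreier curve\<close>

text \<open>Everything is compared with sqrt(x) / q. With \<open>a\<close> up to A = sqrt(x / M^3),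
  the main term A M / q always fits, and the error sqrt(q) from complete sums fits exactly when q^3
  \<le> x, which is the origin of the exponent 1/3. The error A / sqrt(q) fits when q \<le> M^3;
  below that threshold M itself is at most sqrt(x) / q, so each \<open>b\<close> can be treated
  separately. Stepanov's method gives only upper bounds for point counts, only over fields with p^(2
  \<mu>) elements, and with a loss depending on \<open>p\<close>. Both defects are repaired: upper
  bounds for all values of the trace, combined with the known number of all \<open>t\<close>, give
  lower bounds as well; and a loss independent of \<mu> disappears because the character sums are
  power sums of five fixed numbers, whose growth rate decides their size. Riemann-Roch and
  valuations are replaced by explicit monomials with distinct pole orders at infinity, and the zeros
  of a function are bounded by comparing cardinalities of coefficient spaces over a finite
  field.\<close>

locale artin_schreier =
  fixes p :: nat and u v \<gamma> :: "'k :: alg_closed_field"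
  assumes prime_p: "prime p" and p_gt_3: "p > 3" and CHAR_p: "CHAR('k) = p" and u_nz: "u \<noteq> 0"
begin

section \<open>Functions on the curve and their pole orders\<close>

definition points :: "('k \<times> 'k) set" where
  "points = {(t, y). t \<noteq> 0 \<and> y ^ p - y = u * t ^ 3 + v * t powi (-2) + \<gamma>}"

definition mon :: "int \<times> nat \<Rightarrow> 'k \<times> 'k \<Rightarrow> 'k" where
  "mon m P = fst P powi fst m * snd P ^ snd m"

text \<open>Pole order of t^i y^j at the point at infinity, where \<open>t\<close> has a pole of
  order \<open>p\<close> and \<open>y\<close> one of order 3.\<close>

definition ord_inf :: "int \<times> nat \<Rightarrow> int" where
  "ord_inf m = int p * fst m + 3 * int (snd m)"

text \<open>For nonzero \<open>v\<close>, the pole order of t^i y^j at the point above t = 0, where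
  \<open>t\<close> has a zero of order \<open>p\<close> and \<open>y\<close> a pole of order 2. For
  \<open>v = 0\<close> it is a formal weight that still respects the curve equation.\<close>

definition ord_zero :: "int \<times> nat \<Rightarrow> int" where
  "ord_zero m = 2 * int (snd m) - int p * fst m"

text \<open>The curve equation rewrites y^p, so these monomials span all functions;
  \<open>ev_eq_0_imp\<close> shows that they are independent.\<close>

definition reduced :: "(int \<times> nat) set" where
  "reduced = {m. snd m < p}"

definition ev :: "(int \<times> nat) set \<Rightarrow> (int \<times> nat \<Rightarrow> 'k) \<Rightarrow> 'k \<times> 'k \<Rightarrow> 'k" where
  "ev J c P = (\<Sum>m\<in>J. c m * mon m P)"

text \<open>Functions are identified with their values on \<open>points\<close>, which avoids
  building a coordinate ring. The coefficients are a parameter because leading terms are studied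
  over \<open>UNIV\<close>, whereas counting needs a finite field.\<close>

definition lin :: "'k set \<Rightarrow> (int \<times> nat) set \<Rightarrow> ('k \<times> 'k \<Rightarrow> 'k) set" where
  "lin K S = {\<phi>. \<exists>J c. finite J \<and> J \<subseteq> S \<and> (\<forall>m. c m \<in> K) \<and> (\<forall>P\<in>points. \<phi> P = ev J c P)}"

text \<open>The closure that sums and products of coefficients need; it covers \<open>UNIV\<close>
  and the finite fields \<open>gf n\<close> alike.\<close>

definition subsemiring :: "'k set \<Rightarrow> bool" where
  "subsemiring K \<longleftrightarrow> 0 \<in> K \<and> 1 \<in> K \<and> (\<forall>x\<in>K. \<forall>y\<in>K. x + y \<in> K \<and> x * y \<in> K)"

lemma subsemiring_UNIV [simp]: "subsemiring UNIV"
  by (simp add: subsemiring_def)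

lemma p_pos: "p > 0"
  using p_gt_3 by simp

text \<open>As \<open>p\<close> is prime to 3, equal orders force \<open>p\<close> to divide the
  difference of two exponents of \<open>y\<close>, both below \<open>p\<close>. Distinct orders are
  what allows a leading term to play the role of a valuation.\<close>

lemma ord_inf_inj:
  assumes "m \<in> reduced" "m' \<in> reduced" "ord_inf m = ord_inf m'"
  shows "m = m'"
proof -
  have e: "int p * (fst m - fst m') = 3 * (int (snd m') - int (snd m))"
    using assms(3) by (simp add: ord_inf_def algebra_simps)
  have "int p dvd 3 * (int (snd m') - int (snd m))"
    unfolding e[symmetric] by simp
  moreover have cop: "coprime (int p) 3"
  proof -
    have "\<not> p dvd 3"
      using p_gt_3 dvd_imp_le[of p 3] by linarith
    hence "coprime p 3"
      using prime_imp_coprime[OF prime_p] by blast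
    thus ?thesis
      using coprime_int_iff[of p 3] by simp
  qed
  ultimately have d: "int p dvd int (snd m') - int (snd m)"
    using coprime_dvd_mult_right_iff[OF cop] by (simp only:)
  have "int (snd m') - int (snd m) = 0"
  proof (rule ccontr)
    assume ne: "int (snd m') - int (snd m) \<noteq> 0"
    have "\<bar>int p\<bar> \<le> \<bar>int (snd m') - int (snd m)\<bar>"
      by (rule dvd_imp_le_int[OF ne d])
    thus False
      using assms(1,2) by (auto simp: reduced_def)
  qed
  moreover from this have "fst m = fst m'"
    using e p_pos by simp
  ultimately show ?thesis
    by (simp add: prod_eq_iff)
qed

lemma lin_mono: "S \<subseteq> S' \<Longrightarrow> lin K S \<subseteq> lin K S'"
  unfolding lin_def by blast

lemma lin_cong:
  assumes "\<phi> \<in> lin K S" "\<And>P. P \<in> points \<Longrightarrow> \<psi> P = \<phi> P"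
  shows "\<psi> \<in> lin K S"
proof -
  obtain J c where "finite J" "J \<subseteq> S" "\<forall>m. c m \<in> K" "\<forall>P\<in>points. \<phi> P = ev J c P"
    using assms(1) unfolding lin_def by blast
  thus ?thesis
    unfolding lin_def using assms(2) by (intro CollectI exI[of _ J] exI[of _ c]) simp
qed

lemma ev_extend:
  assumes "finite J'" "J \<subseteq> J'"
  shows "ev J' (\<lambda>m. if m \<in> J then c m else 0) P = ev J c P"
  unfolding ev_def using assms
  by (intro sum.mono_neutral_cong_right) auto

lemma lin_add:
  assumes "subsemiring K" "\<phi> \<in> lin K S" "\<psi> \<in> lin K S"
  shows "(\<lambda>P. \<phi> P + \<psi> P) \<in> lin K S"
proof -
  obtain J c where J: "finite J" "J \<subseteq> S" "\<And>m. c m \<in> K" "\<And>P. P \<in> points \<Longrightarrow> \<phi> P = ev J c P"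
    using assms(2) unfolding lin_def by blast
  obtain J' c' where J': "finite J'" "J' \<subseteq> S" "\<And>m. c' m \<in> K" "\<And>P. P \<in> points \<Longrightarrow> \<psi> P = ev J' c' P"
    using assms(3) unfolding lin_def by blast
  define d where "d = (\<lambda>m. (if m \<in> J then c m else 0) + (if m \<in> J' then c' m else 0))"
  have "\<phi> P + \<psi> P = ev (J \<union> J') d P" if "P \<in> points" for P
  proof -
    have "ev (J \<union> J') d P = ev (J \<union> J') (\<lambda>m. if m \<in> J then c m else 0) P +
      ev (J \<union> J') (\<lambda>m. if m \<in> J' then c' m else 0) P"
      by (simp add: ev_def d_def sum.distrib ring_distribs)
    also have "\<dots> = ev J c P + ev J' c' P"
      using J(1) J'(1) by (simp add: ev_extend)
    finally show ?thesis
      using J(4) J'(4) that by simp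
  qed
  moreover have "\<And>m. d m \<in> K"
    using assms(1) J(3) J'(3) unfolding d_def subsemiring_def by auto
  moreover have "finite (J \<union> J')" "J \<union> J' \<subseteq> S"
    using J J' by auto
  ultimately show ?thesis
    unfolding lin_def by blast
qed

lemma lin_scale:
  assumes "subsemiring K" "\<phi> \<in> lin K S" "a \<in> K"
  shows "(\<lambda>P. a * \<phi> P) \<in> lin K S"
proof -
  obtain J c where J: "finite J" "J \<subseteq> S" "\<And>m. c m \<in> K" "\<And>P. P \<in> points \<Longrightarrow> \<phi> P = ev J c P"
    using assms(2) unfolding lin_def by blast
  have "a * \<phi> P = ev J (\<lambda>m. a * c m) P" if "P \<in> points" for P
    using J(4)[OF that] by (simp add: ev_def sum_distrib_left mult.assoc)
  moreover have "\<And>m. a * c m \<in> K"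
    using assms J(3) by (simp add: subsemiring_def)
  ultimately show ?thesis
    unfolding lin_def using J(1,2) by (intro CollectI exI[of _ J] exI[of _ "\<lambda>m. a * c m"]) simp
qed

lemma lin_zero: "subsemiring K \<Longrightarrow> (\<lambda>P. 0) \<in> lin K S"
  unfolding lin_def by (auto simp: ev_def subsemiring_def intro!: exI[of _ "{}"])

lemma lin_sum:
  assumes "subsemiring K" "\<And>i. i \<in> A \<Longrightarrow> \<phi> i \<in> lin K S"
  shows "(\<lambda>P. \<Sum>i\<in>A. \<phi> i P) \<in> lin K S"
  using assms(2)
proof (induction A rule: infinite_finite_induct)
  case (insert x F)
  thus ?case
    using lin_add[OF assms(1), of "\<phi> x" S "\<lambda>P. \<Sum>i\<in>F. \<phi> i P"] by simp
qed (simp_all add: lin_zero assms(1))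

lemma lin_mon:
  assumes "subsemiring K" "m \<in> S"
  shows "mon m \<in> lin K S"
  unfolding lin_def using assms
  by (intro CollectI exI[of _ "{m}"] exI[of _ "\<lambda>_. 1"]) (auto simp: ev_def subsemiring_def)

lemma lin_mult:
  assumes K: "subsemiring K" and "\<phi> \<in> lin K S" "\<psi> \<in> lin K S'"
    and *: "\<And>m m'. m \<in> S \<Longrightarrow> m' \<in> S' \<Longrightarrow> (\<lambda>P. mon m P * mon m' P) \<in> lin K S''"
  shows "(\<lambda>P. \<phi> P * \<psi> P) \<in> lin K S''"
proof -
  obtain J c where J: "finite J" "J \<subseteq> S" "\<And>m. c m \<in> K" "\<And>P. P \<in> points \<Longrightarrow> \<phi> P = ev J c P"
    using assms(2) unfolding lin_def by blast
  obtain J' c' where J': "finite J'" "J' \<subseteq> S'" "\<And>m. c' m \<in> K" "\<And>P. P \<in> points \<Longrightarrow> \<psi> P = ev J' c' P"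
    using assms(3) unfolding lin_def by blast
  have cc: "c m * c' m' \<in> K" for m m'
    using J(3) J'(3) K unfolding subsemiring_def by blast
  have "(\<lambda>P. (c m * c' m') * (mon m P * mon m' P)) \<in> lin K S''" if "m \<in> J" "m' \<in> J'" for m m'
    using that J(2) J'(2) by (intro lin_scale[OF K _ cc] *) auto
  hence "(\<lambda>P. \<Sum>m\<in>J. \<Sum>m'\<in>J'. (c m * c' m') * (mon m P * mon m' P)) \<in> lin K S''"
    by (intro lin_sum[OF K]) blast
  moreover have "(\<Sum>m\<in>J. \<Sum>m'\<in>J'. (c m * c' m') * (mon m P * mon m' P)) = \<phi> P * \<psi> P"
    if "P \<in> points" for P
    unfolding J(4)[OF that] J'(4)[OF that] ev_def sum_product
    by (intro sum.cong refl) (simp add: mult_ac)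
  ultimately show ?thesis
    by (elim lin_cong) simp
qed

lemma mon_mult_small:
  assumes "P \<in> points"
  shows "mon m P * mon m' P = mon (fst m + fst m', snd m + snd m') P"
  using assms by (auto simp: mon_def points_def power_int_add power_add)

lemma mon_reduce:
  assumes "P \<in> points" "j \<ge> p"
  shows "mon (i, j) P = u * mon (i + 3, j - p) P + mon (i, j - p + 1) P +
     v * mon (i - 2, j - p) P + \<gamma> * mon (i, j - p) P"
proof -
  obtain t y where P: "P = (t, y)" by force
  have t: "t \<noteq> 0" and y: "y ^ p = y + (u * t ^ 3 + v * t powi (-2) + \<gamma>)"
    using assms(1) by (auto simp: points_def P algebra_simps)
  have "y ^ j = y ^ p * y ^ (j - p)"
    using assms(2) by (simp flip: power_add)
  also have "\<dots> = y ^ (j - p + 1) + (u * t ^ 3 + v * t powi (-2) + \<gamma>) * y ^ (j - p)"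
    unfolding y by (simp add: algebra_simps)
  finally have 1: "y ^ j = y ^ (j - p + 1) + (u * t ^ 3 + v * t powi (-2) + \<gamma>) * y ^ (j - p)" .
  have 2: "t powi (i + 3) = t powi i * t ^ 3" "t powi (i - 2) = t powi i * t powi (-2)"
    using t power_int_add[of t i 3] power_int_add[of t i "-2"] by simp_all
  show ?thesis
    unfolding mon_def P fst_conv snd_conv 1 2 by (simp add: algebra_simps)
qed

section \<open>Leading terms at infinity\<close>

definition below :: "int \<Rightarrow> (int \<times> nat) set" where
  "below n = {m \<in> reduced. ord_inf m < n}"

text \<open>Expresses that \<phi> has a pole of order exactly \<open>n\<close> at infinity, through
  an expansion in reduced monomials.\<close>

definition lead :: "('k \<times> 'k \<Rightarrow> 'k) \<Rightarrow> int \<Rightarrow> bool" where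
  "lead \<phi> n \<longleftrightarrow> (\<exists>m c \<psi>. m \<in> reduced \<and> ord_inf m = n \<and> c \<noteq> 0 \<and> \<psi> \<in> lin UNIV (below n) \<and>
     (\<forall>P\<in>points. \<phi> P = c * mon m P + \<psi> P))"

text \<open>If the exponent of \<open>y\<close> reaches \<open>p\<close>, the curve equation is
  substituted for y^p. Its term u t^3 has the same order 3 p as y^p and all other terms have smaller
  order, so the nonzero \<open>u\<close> becomes the leading coefficient.\<close>

lemma lead_mon_mult:
  assumes "m \<in> reduced" "m' \<in> reduced"
  shows "lead (\<lambda>P. mon m P * mon m' P) (ord_inf m + ord_inf m')"
proof (cases "snd m + snd m' < p")
  case True
  have "\<forall>P\<in>points. mon m P * mon m' P = 1 * mon (fst m + fst m', snd m + snd m') P + 0"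
    by (simp add: mon_mult_small)
  moreover have "(fst m + fst m', snd m + snd m') \<in> reduced"
    "ord_inf (fst m + fst m', snd m + snd m') = ord_inf m + ord_inf m'"
    using True by (auto simp: reduced_def ord_inf_def algebra_simps)
  ultimately show ?thesis
    unfolding lead_def using lin_zero[of UNIV] subsemiring_UNIV
    by (intro exI[of _ "(fst m + fst m', snd m + snd m')"] exI[of _ 1] exI[of _ "\<lambda>P. 0"]) auto
next
  case False
  define i where "i = fst m + fst m'"
  define j where "j = snd m + snd m'"
  define n where "n = ord_inf m + ord_inf m'"
  have j: "j \<ge> p" "j - p + 1 < p"
    using False assms by (auto simp: j_def reduced_def)
  have n: "n = int p * i + 3 * int j"
    by (simp add: n_def i_def j_def ord_inf_def algebra_simps)
  let ?\<psi> = "\<lambda>P. mon (i, j - p + 1) P + v * mon (i - 2, j - p) P + \<gamma> * mon (i, j - p) P"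
  have "\<forall>P\<in>points. mon m P * mon m' P = u * mon (i + 3, j - p) P + ?\<psi> P"
    using mon_reduce[OF _ j(1)] by (simp add: mon_mult_small i_def j_def)
  moreover have "?\<psi> \<in> lin UNIV (below n)"
    using j p_gt_3
    by (intro lin_add lin_scale lin_mon subsemiring_UNIV UNIV_I)
       (auto simp: below_def reduced_def ord_inf_def n algebra_simps of_nat_diff)
  moreover have "(i + 3, j - p) \<in> reduced" "ord_inf (i + 3, j - p) = n"
    using j by (auto simp: reduced_def ord_inf_def n algebra_simps of_nat_diff)
  ultimately show ?thesis
    unfolding lead_def n_def[symmetric] using u_nz
    by (intro exI[of _ "(i + 3, j - p)"] exI[of _ u] exI[of _ ?\<psi>]) auto
qed

lemma below_mono: "n \<le> n' \<Longrightarrow> lin K (below n) \<subseteq> lin K (below n')"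
  by (intro lin_mono) (auto simp: below_def)

lemma lead_imp_lin:
  assumes "lead \<phi> n" "n < n'"
  shows "\<phi> \<in> lin UNIV (below n')"
proof -
  obtain m c \<psi> where *: "m \<in> reduced" "ord_inf m = n" "c \<noteq> 0" "\<psi> \<in> lin UNIV (below n)"
     "\<forall>P\<in>points. \<phi> P = c * mon m P + \<psi> P"
    using assms(1) unfolding lead_def by blast
  have "(\<lambda>P. c * mon m P + \<psi> P) \<in> lin UNIV (below n')"
    using * assms(2) below_mono[of n n' UNIV]
    by (intro lin_add lin_scale lin_mon subsemiring_UNIV UNIV_I) (auto simp: below_def)
  thus ?thesis
    using *(5) by (elim lin_cong) auto
qed

text \<open>The orders are at most a - 1 and b - 1, so a product has order at most a + b - 2; this
  explains the bound \<open>n + 1\<close>.\<close>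

lemma below_mult:
  assumes "\<phi> \<in> lin UNIV (below a)" "\<psi> \<in> lin UNIV (below b)" "a + b \<le> n + 1"
  shows "(\<lambda>P. \<phi> P * \<psi> P) \<in> lin UNIV (below n)"
  using subsemiring_UNIV assms(1,2)
proof (rule lin_mult)
  fix m m' assume "m \<in> below a" "m' \<in> below b"
  thus "(\<lambda>P. mon m P * mon m' P) \<in> lin UNIV (below n)"
    using assms(3) by (intro lead_imp_lin[OF lead_mon_mult]) (auto simp: below_def)
qed

lemma lead_add:
  assumes "lead \<phi> n" "\<psi> \<in> lin UNIV (below n)" "\<And>P. P \<in> points \<Longrightarrow> \<chi> P = \<phi> P + \<psi> P"
  shows "lead \<chi> n"
proof -
  obtain m c \<psi>' where *: "m \<in> reduced" "ord_inf m = n" "c \<noteq> 0" "\<psi>' \<in> lin UNIV (below n)"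
     "\<forall>P\<in>points. \<phi> P = c * mon m P + \<psi>' P"
    using assms(1) unfolding lead_def by blast
  show ?thesis
    unfolding lead_def using * assms(2,3) lin_add[OF subsemiring_UNIV *(4) assms(2)]
    by (intro exI[of _ m] exI[of _ c] exI[of _ "\<lambda>P. \<psi>' P + \<psi> P"]) auto
qed

lemma lead_mult:
  assumes "lead \<phi> n" "lead \<phi>' n'"
  shows "lead (\<lambda>P. \<phi> P * \<phi>' P) (n + n')"
proof -
  obtain m c \<psi> where 1: "m \<in> reduced" "ord_inf m = n" "c \<noteq> 0" "\<psi> \<in> lin UNIV (below n)"
     "\<forall>P\<in>points. \<phi> P = c * mon m P + \<psi> P"
    using assms(1) unfolding lead_def by blast
  obtain m' c' \<psi>' where 2: "m' \<in> reduced" "ord_inf m' = n'" "c' \<noteq> 0" "\<psi>' \<in> lin UNIV (below n')"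
     "\<forall>P\<in>points. \<phi>' P = c' * mon m' P + \<psi>' P"
    using assms(2) unfolding lead_def by blast
  obtain m'' c'' \<psi>'' where 3: "m'' \<in> reduced" "ord_inf m'' = n + n'" "c'' \<noteq> 0"
     "\<psi>'' \<in> lin UNIV (below (n + n'))" "\<forall>P\<in>points. mon m P * mon m' P = c'' * mon m'' P + \<psi>'' P"
    using lead_mon_mult[OF 1(1) 2(1)] unfolding 1(2) 2(2) lead_def by blast
  have m1: "(\<lambda>P. mon m P) \<in> lin UNIV (below (n + 1))" "(\<lambda>P. mon m' P) \<in> lin UNIV (below (n' + 1))"
    using 1 2 by (auto intro!: lin_mon simp: below_def)
  let ?\<psi> = "\<lambda>P. c * c' * \<psi>'' P + (c * (mon m P * \<psi>' P) + (c' * (\<psi> P * mon m' P) + \<psi> P * \<psi>' P))"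
  have l: "?\<psi> \<in> lin UNIV (below (n + n'))"
    by (intro lin_add lin_scale subsemiring_UNIV UNIV_I 3 below_mult[OF m1(1) 2(4)]
         below_mult[OF 1(4) m1(2)] below_mult[OF 1(4) 2(4)]) auto
  have e: "\<phi> P * \<phi>' P = (c * c' * c'') * mon m'' P + ?\<psi> P" if "P \<in> points" for P
  proof -
    have "\<phi> P * \<phi>' P = c * c' * (mon m P * mon m' P) +
       (c * (mon m P * \<psi>' P) + (c' * (\<psi> P * mon m' P) + \<psi> P * \<psi>' P))"
      using 1(5) 2(5) that by (simp add: algebra_simps)
    also have "mon m P * mon m' P = c'' * mon m'' P + \<psi>'' P"
      using 3(5) that by simp
    finally show ?thesis
      by (simp add: algebra_simps)
  qed
  have "c * c' * c'' \<noteq> 0"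
    using 1 2 3 by simp
  with l e 3(1,2) show ?thesis
    unfolding lead_def
    by (intro exI[of _ m''] exI[of _ "c * c' * c''"] exI[of _ ?\<psi>]) blast
qed

lemma lead_mon: "m \<in> reduced \<Longrightarrow> lead (mon m) (ord_inf m)"
  unfolding lead_def using lin_zero[of UNIV]
  by (intro exI[of _ m] exI[of _ 1] exI[of _ "\<lambda>P. 0"]) auto

lemma lead_one: "lead (\<lambda>P. 1) 0"
  unfolding lead_def using lin_zero[of UNIV] p_pos
  by (intro exI[of _ "(0,0)"] exI[of _ 1] exI[of _ "\<lambda>P. 0"])
     (auto simp: reduced_def ord_inf_def mon_def)

lemma lead_power:
  assumes "lead \<phi> n"
  shows "lead (\<lambda>P. \<phi> P ^ k) (int k * n)"
proof (induction k)
  case (Suc k)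
  show ?case
    using lead_mult[OF assms Suc] by (simp add: algebra_simps)
qed (simp add: lead_one)

lemma exists_point: "\<exists>y. y ^ p - y = (s :: 'k)"
proof -
  let ?f = "monom 1 p + (- monom 1 1 - [:s:]) :: 'k poly"
  have "degree (- monom 1 1 - [:s:] :: 'k poly) \<le> 1"
    by (intro degree_diff_le) (auto simp: degree_monom_eq)
  hence "degree ?f = p"
    using p_gt_3 by (subst degree_add_eq_left) (auto simp: degree_monom_eq)
  then obtain y where "poly ?f y = 0"
    using alg_closed_imp_poly_has_root[of ?f] p_pos by auto
  thus ?thesis
    by (intro exI[of _ y]) (simp add: poly_monom algebra_simps)
qed

lemma freshman: "(x + y :: 'k) ^ p ^ n = x ^ p ^ n + y ^ p ^ n"
  using freshmans_dream'[of "p ^ n" n x y] prime_p by (simp add: CHAR_p)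

lemma freshman_diff: "(x - y :: 'k) ^ p ^ n = x ^ p ^ n - y ^ p ^ n"
  using freshman[of "x - y" y n] by (simp add: algebra_simps)

lemma freshman_sum: "(\<Sum>i\<in>A. f i :: 'k) ^ p ^ n = (\<Sum>i\<in>A. f i ^ p ^ n)"
  using freshmans_dream_sum'[of "p ^ n" n f A] prime_p by (simp add: CHAR_p)

lemma of_nat_pow_p: "(of_nat k :: 'k) ^ p = of_nat k"
proof (induction k)
  case (Suc k)
  show ?case
    using freshman[of 1 "of_nat k" 1] Suc by simp
qed (use p_pos in auto)

lemma inj_of_nat_p: "inj_on (of_nat :: nat \<Rightarrow> 'k) {..<p}"
proof (rule linorder_inj_onI)
  fix x y :: nat assume xy: "x < y" "y \<in> {..<p}"
  show "of_nat x \<noteq> (of_nat y :: 'k)"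
  proof
    assume "of_nat x = (of_nat y :: 'k)"
    hence "of_nat (y - x) = (0 :: 'k)"
      using xy by (simp add: of_nat_diff)
    hence "p dvd y - x"
      by (simp add: of_nat_eq_0_iff_char_dvd CHAR_p)
    thus False
      using xy by (auto dest: dvd_imp_le)
  qed
qed auto

lemma infinite_UNIV_k: "infinite (UNIV :: 'k set)"
proof
  assume fin: "finite (UNIV :: 'k set)"
  let ?f = "(\<Prod>a\<in>UNIV. [:-a, 1:]) + 1 :: 'k poly"
  have "degree (\<Prod>a\<in>(UNIV::'k set). [:-a, 1:]) = card (UNIV :: 'k set)"
    by (subst degree_prod_eq_sum_degree) auto
  moreover have "card (UNIV :: 'k set) > 0"
    using fin by (simp add: card_gt_0_iff)
  ultimately have "degree ?f > 0"
    by (subst degree_add_eq_left) auto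
  then obtain x where "poly ?f x = 0"
    using alg_closed_imp_poly_has_root by blast
  moreover have "poly ?f x = 1"
    using fin by (simp add: poly_prod prod_zero_iff)
  ultimately show False
    by simp
qed

text \<open>Above each nonzero \<open>t\<close> lie the \<open>p\<close> points with ordinates y +
  k, \<open>k\<close> in the prime field, so a polynomial in \<open>y\<close> of degree below
  \<open>p\<close> that vanishes there is zero. Its coefficients are then Laurent polynomials in
  \<open>t\<close> with infinitely many zeros.\<close>

lemma ev_eq_0_imp:
  assumes "finite J" "J \<subseteq> reduced" and z: "\<And>P. P \<in> points \<Longrightarrow> ev J c P = 0" and "m \<in> J"
  shows "c m = 0"
proof -
  have 1: "(\<Sum>m\<in>{m\<in>J. snd m = j}. c m * t powi fst m) = 0" if t: "t \<noteq> 0" for t j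
  proof -
    obtain y where y: "y ^ p - y = u * t ^ 3 + v * t powi (-2) + \<gamma>"
      using exists_point by blast
    define f where "f = (\<Sum>m\<in>J. monom (c m * t powi fst m) (snd m))"
    have deg: "degree f \<le> p - 1"
      unfolding f_def using assms(2) p_pos
      by (intro degree_sum_le assms(1)) (auto simp: reduced_def intro!: order.trans[OF degree_monom_le])
    have "poly f (y + of_nat k) = 0" for k
    proof -
      have "(t, y + of_nat k) \<in> points"
        using t y freshman[of y "of_nat k" 1] by (simp add: points_def of_nat_pow_p)
      hence "ev J c (t, y + of_nat k) = 0"
        by (rule z)
      thus ?thesis
        by (simp add: f_def poly_sum poly_monom ev_def mon_def mult.assoc)
    qed
    hence sub: "(\<lambda>k. y + of_nat k) ` {..<p} \<subseteq> {x. poly f x = 0}"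
      by auto
    have "f = 0"
    proof (rule ccontr)
      assume f: "f \<noteq> 0"
      have "card ((\<lambda>k. y + of_nat k) ` {..<p}) = p"
        using inj_of_nat_p by (subst card_image) (auto simp: inj_on_def)
      moreover have "card ((\<lambda>k. y + of_nat k) ` {..<p}) \<le> card {x. poly f x = 0}"
        by (intro card_mono sub poly_roots_finite f)
      moreover have "card {x. poly f x = 0} \<le> degree f"
        by (rule card_poly_roots_bound[OF f])
      ultimately show False
        using deg p_pos by linarith
    qed
    hence "coeff f j = 0"
      by simp
    moreover have "coeff f j = (\<Sum>m\<in>J. if snd m = j then c m * t powi fst m else 0)"
      by (simp add: f_def coeff_sum)
    ultimately show ?thesis
      using assms(1) by (simp add: sum.inter_filter)
  qed
  define S where "S = {m'\<in>J. snd m' = snd m}"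
  have finS: "finite S"
    using assms(1) by (simp add: S_def)
  \<comment> \<open>Multiplying by t^N turns the Laurent polynomial into the ordinary polynomial
    \<open>g\<close>.\<close>
  have "\<exists>N. \<forall>m\<in>S. -N \<le> fst m"
    using finite_imageI[OF finS, of "\<lambda>m. - fst m"]
    by (intro exI[of _ "Max ((\<lambda>m. - fst m) ` S)"]) (auto simp: minus_le_iff)
  then obtain N where N: "\<And>m. m \<in> S \<Longrightarrow> -N \<le> fst m"
    by blast
  define g where "g = (\<Sum>m\<in>S. monom (c m) (nat (fst m + N)))"
  have "poly g t = 0" if t: "t \<noteq> 0" for t
  proof -
    have "poly g t = (\<Sum>m\<in>S. c m * t powi (fst m + N))"
      unfolding g_def poly_sum poly_monom
      using N by (intro sum.cong refl) (force simp: power_int_def)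
    also have "\<dots> = (\<Sum>m\<in>S. c m * t powi fst m) * t powi N"
      using t by (simp add: power_int_add sum_distrib_right mult.assoc)
    finally show ?thesis
      using 1[OF t] by (simp add: S_def)
  qed
  hence "-{0} \<subseteq> {t. poly g t = 0}"
    by auto
  moreover have "infinite (-{0} :: 'k set)"
    using infinite_UNIV_k by (simp add: Compl_eq_Diff_UNIV)
  ultimately have "g = 0"
    using poly_roots_finite[of g] finite_subset by blast
  hence "coeff g (nat (fst m + N)) = 0"
    by simp
  moreover have "coeff g (nat (fst m + N)) = (\<Sum>m'\<in>S. if m' = m then c m' else 0)"
    unfolding g_def coeff_sum coeff_monom
  proof (intro sum.cong refl)
    fix m' assume m': "m' \<in> S"
    have "m \<in> S"
      using assms(4) by (simp add: S_def)
    hence "nat (fst m' + N) = nat (fst m + N) \<longleftrightarrow> fst m' = fst m"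
      using N[OF m'] N[of m] by linarith
    moreover have "snd m' = snd m"
      using m' by (simp add: S_def)
    ultimately show "(if nat (fst m' + N) = nat (fst m + N) then c m' else 0) = (if m' = m then c m' else 0)"
      by (simp add: prod_eq_iff)
  qed
  moreover have "m \<in> S"
    using assms(4) by (simp add: S_def)
  ultimately show ?thesis
    using finS by simp
qed

text \<open>The bridge from formal leading terms to actual values: a leading term cannot cancel, by
  the independence of the reduced monomials.\<close>

lemma lead_nonzero:
  assumes "lead \<phi> n"
  shows "\<exists>P\<in>points. \<phi> P \<noteq> 0"
proof (rule ccontr)
  assume neg: "\<not> ?thesis"
  obtain m c \<psi> where *: "m \<in> reduced" "ord_inf m = n" "c \<noteq> 0" "\<psi> \<in> lin UNIV (below n)"
     "\<forall>P\<in>points. \<phi> P = c * mon m P + \<psi> P"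
    using assms(1) unfolding lead_def by blast
  obtain J d where J: "finite J" "J \<subseteq> below n" "\<And>P. P \<in> points \<Longrightarrow> \<psi> P = ev J d P"
    using *(4) unfolding lin_def by blast
  have m: "m \<notin> J"
    using J(2) *(2) by (auto simp: below_def)
  have "ev (insert m J) (d(m := c)) P = 0" if "P \<in> points" for P
  proof -
    have "ev (insert m J) (d(m := c)) P = c * mon m P + ev J (d(m := c)) P"
      using m J(1) by (simp add: ev_def)
    also have "ev J (d(m := c)) P = ev J d P"
      unfolding ev_def using m by (intro sum.cong) auto
    also have "\<dots> = \<psi> P"
      using J(3) that by simp
    finally have "ev (insert m J) (d(m := c)) P = c * mon m P + \<psi> P" .
    also have "c * mon m P + \<psi> P = \<phi> P"
      by (rule sym) (use *(5) that in blast)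
    also have "\<phi> P = 0"
      using neg that by blast
    finally show ?thesis .
  qed
  moreover have "finite (insert m J)" "insert m J \<subseteq> reduced" "m \<in> insert m J"
    using J(1,2) *(1) by (auto simp: below_def)
  ultimately have "(d(m := c)) m = 0"
    using ev_eq_0_imp[of "insert m J" "d(m := c)" m] by blast
  with *(3) show False
    by simp
qed

lemma lead_sum:
  assumes "finite A" "A \<noteq> {}" "\<And>i. i \<in> A \<Longrightarrow> lead (\<phi> i) (n i)" "inj_on n A"
  shows "\<exists>i\<in>A. lead (\<lambda>P. \<Sum>i\<in>A. \<phi> i P) (n i)"
proof -
  obtain i where i: "i \<in> A" "n i = Max (n ` A)"
    using Max_in[of "n ` A"] assms(1,2) by fastforce
  have "n k < n i" if "k \<in> A - {i}" for k
  proof -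
    have "n k \<le> n i"
      using that assms(1) i(2) by simp
    moreover have "n k \<noteq> n i"
      using that assms(4) i(1) by (auto simp: inj_on_def)
    ultimately show ?thesis
      by simp
  qed
  hence "(\<lambda>P. \<Sum>k\<in>A - {i}. \<phi> k P) \<in> lin UNIV (below (n i))"
    using assms(3) by (intro lin_sum subsemiring_UNIV lead_imp_lin[of "\<phi> k" "n k" for k]) auto
  moreover have "(\<Sum>k\<in>A. \<phi> k P) = \<phi> i P + (\<Sum>k\<in>A - {i}. \<phi> k P)" for P
    using assms(1) i(1) by (simp add: sum.remove)
  ultimately have "lead (\<lambda>P. \<Sum>i\<in>A. \<phi> i P) (n i)"
    by (intro lead_add[OF assms(3)[OF i(1)], of "\<lambda>P. \<Sum>k\<in>A - {i}. \<phi> k P"])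
  with i(1) show ?thesis
    by blast
qed

lemma lead_ev:
  assumes "finite J" "J \<subseteq> reduced" "m \<in> J" "c m \<noteq> 0"
  shows "\<exists>m\<in>J. lead (ev J c) (ord_inf m)"
proof -
  let ?A = "{m \<in> J. c m \<noteq> 0}"
  have "\<exists>m\<in>?A. lead (\<lambda>P. \<Sum>m\<in>?A. c m * mon m P) (ord_inf m)"
  proof (rule lead_sum[of ?A "\<lambda>m P. c m * mon m P" ord_inf])
    show "?A \<noteq> {}"
      using assms by blast
    show "inj_on ord_inf ?A"
      using ord_inf_inj assms(2) unfolding inj_on_def by blast
    fix i assume "i \<in> ?A"
    thus "lead (\<lambda>P. c i * mon i P) (ord_inf i)"
      unfolding lead_def using assms(2) lin_zero[OF subsemiring_UNIV]
      by (intro exI[of _ i] exI[of _ "c i"] exI[of _ "\<lambda>_. 0"]) auto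
  qed (use assms in auto)
  moreover have "(\<Sum>m\<in>?A. c m * mon m P) = ev J c P" for P
    unfolding ev_def using assms(1) by (intro sum.mono_neutral_left) auto
  ultimately show ?thesis
    by auto
qed

section \<open>Finite subfields and functions with bounded poles\<close>

definition gf :: "nat \<Rightarrow> 'k set" where
  "gf n = {x. x ^ p ^ n = x}"

lemma gf_closed:
  "0 \<in> gf n" "1 \<in> gf n"
  "x \<in> gf n \<Longrightarrow> y \<in> gf n \<Longrightarrow> x + y \<in> gf n"
  "x \<in> gf n \<Longrightarrow> y \<in> gf n \<Longrightarrow> x - y \<in> gf n"
  "x \<in> gf n \<Longrightarrow> y \<in> gf n \<Longrightarrow> x * y \<in> gf n"
  "x \<in> gf n \<Longrightarrow> inverse x \<in> gf n"
  "x \<in> gf n \<Longrightarrow> - x \<in> gf n"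
  using p_pos freshman_diff[of 0 x n]
  by (auto simp: gf_def freshman freshman_diff power_mult_distrib power_inverse)

lemma gf_power: "x \<in> gf n \<Longrightarrow> x ^ k \<in> gf n"
  by (induction k) (auto intro: gf_closed)

lemma gf_power_int: "x \<in> gf n \<Longrightarrow> x powi k \<in> gf n"
  by (auto simp: power_int_def intro: gf_closed gf_power)

lemma subsemiring_gf: "subsemiring (gf n)"
  unfolding subsemiring_def by (auto intro: gf_closed)

lemma finite_gf: "n > 0 \<Longrightarrow> finite (gf n)" and card_gf_le: "n > 0 \<Longrightarrow> card (gf n) \<le> p ^ n"
proof -
  assume n: "n > 0"
  let ?f = "monom 1 (p ^ n) - monom 1 1 :: 'k poly"
  have "p ^ 1 \<le> p ^ n"
    using n p_pos by (intro power_increasing) auto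
  hence gt: "p ^ n > 1"
    using p_gt_3 by simp
  have "degree (monom 1 (p ^ n) + (- monom 1 1) :: 'k poly) = p ^ n"
    using gt by (subst degree_add_eq_left) (auto simp: degree_monom_eq)
  hence deg: "degree ?f = p ^ n"
    by simp
  have nz: "?f \<noteq> 0"
  proof
    assume "?f = 0"
    thus False
      using deg gt by (simp only: degree_0)
  qed
  have eq: "gf n = {x. poly ?f x = 0}"
    by (simp add: gf_def poly_monom)
  show "finite (gf n)"
    unfolding eq by (rule poly_roots_finite[OF nz])
  show "card (gf n) \<le> p ^ n"
    unfolding eq using card_poly_roots_bound[OF nz] deg by simp
qed

text \<open>A basis for the functions whose poles at infinity and above zero have order at most
  \<open>a\<close>. Its size is 2 a up to O(p), and these cardinality bounds take the place of
  Riemann-Roch.\<close>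

definition box :: "int \<Rightarrow> (int \<times> nat) set" where
  "box a = {m \<in> reduced. ord_inf m \<le> a \<and> ord_zero m \<le> a}"

lemma div_bounds: "int p * (x div int p) \<le> x" "int p * (x div int p) \<ge> x - int p + 1"
proof -
  have "int p * (x div int p) = x - x mod int p"
    by (simp add: minus_mod_eq_mult_div)
  moreover have "0 \<le> x mod int p" "x mod int p < int p"
    using p_pos by simp_all
  ultimately show "int p * (x div int p) \<le> x" "int p * (x div int p) \<ge> x - int p + 1"
    by linarith+
qed

lemma le_div_p_iff: "k \<le> x div int p \<longleftrightarrow> int p * k \<le> x"
proof
  assume "k \<le> x div int p"
  hence "int p * k \<le> int p * (x div int p)"
    by (intro mult_left_mono) auto
  thus "int p * k \<le> x"
    using div_bounds(1)[of x] by linarith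
next
  assume "int p * k \<le> x"
  hence "(int p * k) div int p \<le> x div int p"
    using p_pos by (intro zdiv_mono1) auto
  thus "k \<le> x div int p"
    using p_pos by simp
qed

lemma box_eq:
  "box a = (\<lambda>(j, i). (i, j)) ` (SIGMA j:{..<p}. {- ((a - 2 * int j) div int p)..(a - 3 * int j) div int p})"
proof -
  have 1: "int p * i + 3 * int j \<le> a \<longleftrightarrow> i \<le> (a - 3 * int j) div int p" for i :: int and j
    unfolding le_div_p_iff by linarith
  have 2: "2 * int j - int p * i \<le> a \<longleftrightarrow> - ((a - 2 * int j) div int p) \<le> i" for i :: int and j
    unfolding minus_le_iff[of _ i] le_div_p_iff by (simp only: mult_minus_right) linarith
  have 3: "m \<in> box a \<longleftrightarrow> snd m < p \<and> - ((a - 2 * int (snd m)) div int p) \<le> fst m \<and>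
      fst m \<le> (a - 3 * int (snd m)) div int p" for m
    using 1[of "fst m" "snd m"] 2[of "snd m" "fst m"]
    by (auto simp: box_def reduced_def ord_inf_def ord_zero_def)
  show ?thesis
    by (auto simp: 3 image_iff)
qed

lemma finite_box: "finite (box a)"
  unfolding box_eq by (intro finite_imageI finite_SigmaI) auto

lemma card_box:
  "card (box a) = (\<Sum>j<p. nat ((a - 3 * int j) div int p + (a - 2 * int j) div int p + 1))"
proof -
  have "card (box a) = card (SIGMA j:{..<p}. {- ((a - 2 * int j) div int p)..(a - 3 * int j) div int p})"
    unfolding box_eq by (intro card_image) (auto simp: inj_on_def)
  thus ?thesis
    by (simp add: card_SigmaI)
qed

text \<open>For each exponent \<open>j\<close> of \<open>y\<close> the exponents of \<open>t\<close>
  fill an interval of length about (2 a - 5 j) / p. The bound 5 j < 5 p and the two roundings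
  together cost 6 p.\<close>

lemma card_box_lower: "int (card (box a)) \<ge> 2 * a - 6 * int p"
proof -
  have "int p * int (nat ((a - 3 * int j) div int p + (a - 2 * int j) div int p + 1)) \<ge> 2 * a - 6 * int p"
    if "j < p" for j
  proof -
    have "int p * ((a - 3 * int j) div int p + (a - 2 * int j) div int p + 1) \<le>
      int p * int (nat ((a - 3 * int j) div int p + (a - 2 * int j) div int p + 1))"
      by (intro mult_left_mono) auto
    moreover have "int p * ((a - 3 * int j) div int p + (a - 2 * int j) div int p + 1) =
      int p * ((a - 3 * int j) div int p) + int p * ((a - 2 * int j) div int p) + int p"
      by (simp add: algebra_simps)
    ultimately show ?thesis
      using div_bounds(2)[of "a - 3 * int j"] div_bounds(2)[of "a - 2 * int j"] that by linarith
  qed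
  hence "(\<Sum>j<p. 2 * a - 6 * int p) \<le>
     (\<Sum>j<p. int p * int (nat ((a - 3 * int j) div int p + (a - 2 * int j) div int p + 1)))"
    by (intro sum_mono) auto
  hence "int p * (2 * a - 6 * int p) \<le> int p * int (card (box a))"
    by (simp add: card_box sum_distrib_left)
  thus ?thesis
    using p_pos by simp
qed

lemma card_box_upper:
  assumes "a \<ge> 3 * int p"
  shows "int (card (box a)) \<le> 2 * a + int p"
proof -
  have "int p * int (nat ((a - 3 * int j) div int p + (a - 2 * int j) div int p + 1)) \<le> 2 * a + int p"
    if "j < p" for j
  proof -
    have "(a - 3 * int j) div int p \<ge> 0" "(a - 2 * int j) div int p \<ge> 0"
      using that assms p_pos by (auto simp: pos_imp_zdiv_nonneg_iff)
    hence "int (nat ((a - 3 * int j) div int p + (a - 2 * int j) div int p + 1)) =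
       (a - 3 * int j) div int p + (a - 2 * int j) div int p + 1"
      by simp
    thus ?thesis
      using div_bounds(1)[of "a - 3 * int j"] div_bounds(1)[of "a - 2 * int j"]
      by (simp add: algebra_simps)
  qed
  hence "(\<Sum>j<p. int p * int (nat ((a - 3 * int j) div int p + (a - 2 * int j) div int p + 1))) \<le>
    (\<Sum>j<p. 2 * a + int p)"
    by (intro sum_mono) auto
  hence "int p * int (card (box a)) \<le> int p * (2 * a + int p)"
    by (simp add: card_box sum_distrib_left)
  thus ?thesis
    using p_pos by simp
qed

lemma card_box_diff:
  assumes "a \<ge> 3 * int p" "d \<ge> 0"
  shows "int (card (box (a + d))) \<le> int (card (box a)) + 2 * d + 2 * int p"
proof -
  have "int p * int (nat ((a + d - 3 * int j) div int p + (a + d - 2 * int j) div int p + 1)) \<le>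
     int p * int (nat ((a - 3 * int j) div int p + (a - 2 * int j) div int p + 1)) + 2 * d + 2 * int p"
    if "j < p" for j
  proof -
    have nn: "(a - 3 * int j) div int p \<ge> 0" "(a - 2 * int j) div int p \<ge> 0"
         "(a + d - 3 * int j) div int p \<ge> 0" "(a + d - 2 * int j) div int p \<ge> 0"
      using that assms p_pos by (auto simp: pos_imp_zdiv_nonneg_iff)
    have "int p * ((a + d - 3 * int j) div int p) \<le> int p * ((a - 3 * int j) div int p) + d + int p"
      using div_bounds(1)[of "a + d - 3 * int j"] div_bounds(2)[of "a - 3 * int j"] by linarith
    moreover have "int p * ((a + d - 2 * int j) div int p) \<le> int p * ((a - 2 * int j) div int p) + d + int p"
      using div_bounds(1)[of "a + d - 2 * int j"] div_bounds(2)[of "a - 2 * int j"] by linarith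
    ultimately show ?thesis
      using nn by (simp add: algebra_simps)
  qed
  hence "(\<Sum>j<p. int p * int (nat ((a + d - 3 * int j) div int p + (a + d - 2 * int j) div int p + 1))) \<le>
    (\<Sum>j<p. int p * int (nat ((a - 3 * int j) div int p + (a - 2 * int j) div int p + 1)) + 2 * d + 2 * int p)"
    by (intro sum_mono) auto
  hence "int p * int (card (box (a + d))) \<le> int p * (int (card (box a)) + 2 * d + 2 * int p)"
    by (simp add: card_box sum_distrib_left sum.distrib algebra_simps)
  thus ?thesis
    using p_pos by simp
qed

lemma box_mono: "a \<le> b \<Longrightarrow> box a \<subseteq> box b"
  by (auto simp: box_def)

lemma box_subset_reduced: "box a \<subseteq> reduced"
  by (auto simp: box_def)

lemma ord_inf_box:
  assumes "m \<in> box a"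
  shows "\<bar>ord_inf m\<bar> \<le> a"
  using assms by (auto simp: box_def ord_inf_def ord_zero_def)

text \<open>Both weights survive the substitution for y^p: the term u t^3 keeps the order at
  infinity and lowers the one at zero, while v t^(-2) does the reverse.\<close>

lemma box_mult:
  assumes "subsemiring K" "u \<in> K" "v \<in> K" "\<gamma> \<in> K" "m \<in> box a" "m' \<in> box b"
  shows "(\<lambda>P. mon m P * mon m' P) \<in> lin K (box (a + b))"
proof (cases "snd m + snd m' < p")
  case True
  have "(fst m + fst m', snd m + snd m') \<in> box (a + b)"
    using True assms by (auto simp: box_def reduced_def ord_inf_def ord_zero_def algebra_simps)
  from lin_mon[OF assms(1) this] show ?thesis
    by (rule lin_cong) (simp add: mon_mult_small)
next
  case False
  define i where "i = fst m + fst m'"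
  define j where "j = snd m + snd m'"
  have j: "j \<ge> p" "j - p + 1 < p"
    using False assms by (auto simp: j_def reduced_def box_def)
  have n: "int p * i + 3 * int j \<le> a + b" "2 * int j - int p * i \<le> a + b"
    using assms(5,6) by (auto simp: i_def j_def ord_inf_def ord_zero_def box_def algebra_simps)
  have "(\<lambda>P. u * mon (i + 3, j - p) P + mon (i, j - p + 1) P +
     v * mon (i - 2, j - p) P + \<gamma> * mon (i, j - p) P) \<in> lin K (box (a + b))"
    using j p_gt_3 n
    by (intro lin_add lin_scale lin_mon assms(1-4))
       (auto simp: box_def reduced_def ord_inf_def ord_zero_def algebra_simps of_nat_diff)
  thus ?thesis
    by (rule lin_cong) (simp add: mon_mult_small i_def[symmetric] j_def[symmetric] mon_reduce[OF _ j(1)])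
qed

lemma lin_box_mult:
  assumes "subsemiring K" "u \<in> K" "v \<in> K" "\<gamma> \<in> K" "\<phi> \<in> lin K (box a)" "\<psi> \<in> lin K (box b)"
  shows "(\<lambda>P. \<phi> P * \<psi> P) \<in> lin K (box (a + b))"
  using assms(1,5,6) by (rule lin_mult) (rule box_mult[OF assms(1-4)])

lemma lin_one: "subsemiring K \<Longrightarrow> (\<lambda>P. 1) \<in> lin K (box 0)"
  by (rule lin_cong[OF lin_mon[of K "(0, 0)"]])
     (use p_pos in \<open>auto simp: box_def reduced_def ord_inf_def ord_zero_def mon_def\<close>)

lemma lin_prod:
  assumes "subsemiring K" "u \<in> K" "v \<in> K" "\<gamma> \<in> K" "finite A" "\<And>i. i \<in> A \<Longrightarrow> \<phi> i \<in> lin K (box a)"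
  shows "(\<lambda>P. \<Prod>i\<in>A. \<phi> i P) \<in> lin K (box (int (card A) * a))"
  using assms(5,6)
proof (induction A rule: finite_induct)
  case (insert x A)
  have "(\<lambda>P. \<phi> x P * (\<Prod>i\<in>A. \<phi> i P)) \<in> lin K (box (a + int (card A) * a))"
    using insert by (intro lin_box_mult assms(1-4)) auto
  thus ?case
    using insert(1,2) by (simp add: algebra_simps)
qed (simp add: lin_one assms(1))

lemma lin_power:
  assumes "subsemiring K" "u \<in> K" "v \<in> K" "\<gamma> \<in> K" "\<phi> \<in> lin K (box a)"
  shows "(\<lambda>P. \<phi> P ^ n) \<in> lin K (box (int n * a))"
  using lin_prod[OF assms(1-4), of "{..<n}" "\<lambda>_. \<phi>" a] assms(5) by simp

text \<open>Coefficient vectors are taken extensional on the finite set \<open>box a\<close>, so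
  that their number is exactly a power of \<open>card K\<close>.\<close>

lemma lin_coeffs:
  assumes "\<phi> \<in> lin K (box a)" "0 \<in> K"
  shows "\<exists>c\<in>box a \<rightarrow>\<^sub>E K. \<forall>P\<in>points. \<phi> P = ev (box a) c P"
proof -
  obtain J c where J: "finite J" "J \<subseteq> box a" "\<forall>m. c m \<in> K" "\<forall>P\<in>points. \<phi> P = ev J c P"
    using assms(1) unfolding lin_def by blast
  let ?c = "\<lambda>m\<in>box a. if m \<in> J then c m else 0"
  have "ev (box a) ?c P = ev (box a) (\<lambda>m. if m \<in> J then c m else 0) P" for P
    unfolding ev_def by (intro sum.cong) auto
  hence "\<forall>P\<in>points. \<phi> P = ev (box a) ?c P"
    using J(2,4) by (simp add: ev_extend finite_box)
  moreover have "?c \<in> box a \<rightarrow>\<^sub>E K"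
    using J(3) assms(2) by auto
  ultimately show ?thesis
    by blast
qed

lemma lin_evI: "c \<in> box a \<rightarrow>\<^sub>E K \<Longrightarrow> 0 \<in> K \<Longrightarrow> ev (box a) c \<in> lin K (box a)"
  unfolding lin_def
  by (intro CollectI exI[of _ "box a"] exI[of _ "\<lambda>m. if m \<in> box a then c m else 0"])
     (auto simp: ev_def finite_box intro!: sum.cong)

lemma lead_ev_diff:
  assumes "c \<in> box a \<rightarrow>\<^sub>E K" "c' \<in> box a \<rightarrow>\<^sub>E K'" "c \<noteq> c'"
  shows "\<exists>m\<in>box a. lead (\<lambda>P. ev (box a) c P - ev (box a) c' P) (ord_inf m)"
proof -
  obtain m where "c m \<noteq> c' m"
    using assms(3) by blast
  moreover from this have "m \<in> box a"
    using PiE_arb[OF assms(1)] PiE_arb[OF assms(2)] by metis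
  ultimately have m: "m \<in> box a" "c m \<noteq> c' m"
    by auto
  have "\<exists>m\<in>box a. lead (ev (box a) (\<lambda>m. c m - c' m)) (ord_inf m)"
    using m by (intro lead_ev[of _ m] finite_box box_subset_reduced) auto
  moreover have "ev (box a) (\<lambda>m. c m - c' m) = (\<lambda>P. ev (box a) c P - ev (box a) c' P)"
    by (auto simp: ev_def sum_subtractf algebra_simps)
  ultimately show ?thesis
    by simp
qed

text \<open>Multiples of \<open>G\<close> vanish on \<open>Z\<close>, while interpolating functions
  take arbitrary values there. Hence the map (c, z) \<mapsto> G c + (interpolation of z) is
  injective into functions with poles of order at most E + D, and comparing cardinalities leaves
  room for at most 2 D + 2 p points. This replaces the equality of the degrees of zeros and
  poles.\<close>

lemma zeros_bound:
  assumes K: "subsemiring K" "finite K" "\<And>x. x \<in> K \<Longrightarrow> - x \<in> K" "\<And>x. x \<in> K \<Longrightarrow> inverse x \<in> K"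
    and uv: "u \<in> K" "v \<in> K" "\<gamma> \<in> K"
    and G: "G \<in> lin K (box D)" "lead G n" "D \<ge> 0"
    and Z: "Z \<subseteq> points" "Z \<subseteq> K \<times> K" "\<And>P. P \<in> Z \<Longrightarrow> G P = 0"
  shows "int (card Z) \<le> 2 * D + 2 * int p"
proof -
  have K01: "0 \<in> K" "1 \<in> K" and Kadd: "\<And>x y. x \<in> K \<Longrightarrow> y \<in> K \<Longrightarrow> x + y \<in> K"
    using K(1) by (auto simp: subsemiring_def)
  have finZ: "finite Z"
    using Z(2) K(2) by (meson finite_SigmaI finite_subset)
  \<comment> \<open>\<open>s P R\<close> separates two points: it is 1 at \<open>P\<close> and 0 at
    \<open>R\<close>, built from whichever coordinate differs.\<close>
  define s where "s = (\<lambda>P R S. if fst P \<noteq> fst R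
     then inverse (fst P + - fst R) * (mon (1, 0) S + (- fst R) * mon (0, 0) S)
     else inverse (snd P + - snd R) * (mon (0, 1) S + (- snd R) * mon (0, 0) S))"
  have b: "(1, 0) \<in> box (int p + 3)" "(0, 1) \<in> box (int p + 3)" "(0, 0) \<in> box (int p + 3)"
    using p_gt_3 by (auto simp: box_def reduced_def ord_inf_def ord_zero_def)
  have s_lin: "s P R \<in> lin K (box (int p + 3))" if "P \<in> Z" "R \<in> Z" for P R
  proof -
    have PR: "fst P \<in> K" "fst R \<in> K" "snd P \<in> K" "snd R \<in> K"
      using that Z(2) by auto
    have "(\<lambda>S. inverse (fst P + - fst R) * (mon (1, 0) S + (- fst R) * mon (0, 0) S)) \<in> lin K (box (int p + 3))"
      by (intro lin_scale lin_add lin_mon b K Kadd PR)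
    moreover have "(\<lambda>S. inverse (snd P + - snd R) * (mon (0, 1) S + (- snd R) * mon (0, 0) S)) \<in> lin K (box (int p + 3))"
      by (intro lin_scale lin_add lin_mon b K Kadd PR)
    ultimately show ?thesis
      unfolding s_def by (cases "fst P \<noteq> fst R") simp_all
  qed
  have s_val: "s P R R = 0" "P \<noteq> R \<Longrightarrow> s P R P = 1" for P R
    by (auto simp: s_def mon_def prod_eq_iff)
  define \<delta> where "\<delta> = (\<lambda>P S. \<Prod>R\<in>Z - {P}. s P R S)"
  have \<delta>_val: "\<delta> P R = (if P = R then 1 else 0)" if "P \<in> Z" "R \<in> Z" for P R
  proof (cases "P = R")
    case True
    have "(\<Prod>S\<in>Z - {P}. s P S P) = 1"
      by (intro prod.neutral ballI s_val(2)) auto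
    thus ?thesis
      using True by (simp add: \<delta>_def)
  next
    case False
    have "(\<Prod>S\<in>Z - {P}. s P S R) = 0"
      using finZ that False s_val(1)[of P R] by (intro prod_zero) auto
    thus ?thesis
      using False by (simp add: \<delta>_def)
  qed
  \<comment> \<open>Large enough for every interpolating function, a product of at most
    \<open>card Z\<close> separators of order \<open>p + 3\<close>; the summand 3 p meets the
    hypothesis of \<open>card_box_diff\<close>.\<close>
  define E where "E = 3 * int p + int (card Z) * (int p + 3)"
  have \<delta>_lin: "\<delta> P \<in> lin K (box (E + D))" if "P \<in> Z" for P
  proof -
    have "\<delta> P \<in> lin K (box (int (card (Z - {P})) * (int p + 3)))"
      unfolding \<delta>_def using that finZ by (intro lin_prod K(1) uv s_lin) auto
    moreover have "card (Z - {P}) \<le> card Z"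
      using finZ by (simp add: card_mono)
    hence "int (card (Z - {P})) * (int p + 3) \<le> int (card Z) * (int p + 3)"
      by (intro mult_right_mono) auto
    hence "box (int (card (Z - {P})) * (int p + 3)) \<subseteq> box (E + D)"
      unfolding E_def using G(3) by (intro box_mono) linarith
    ultimately show ?thesis
      using lin_mono by blast
  qed
  define \<Phi> where "\<Phi> = (\<lambda>(c, z) P. G P * ev (box E) c P + (\<Sum>R\<in>Z. z R * \<delta> R P))"
  let ?A = "(box E \<rightarrow>\<^sub>E K) \<times> (Z \<rightarrow>\<^sub>E K)"
  have \<Phi>_lin: "\<Phi> x \<in> lin K (box (E + D))" if "x \<in> ?A" for x
  proof -
    obtain c z where x: "x = (c, z)" "c \<in> box E \<rightarrow>\<^sub>E K" "z \<in> Z \<rightarrow>\<^sub>E K"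
      using \<open>x \<in> ?A\<close> by auto
    have "(\<lambda>P. G P * ev (box E) c P) \<in> lin K (box (D + E))"
      by (intro lin_box_mult K(1) uv G(1) lin_evI x(2) K01)
    moreover have "(\<lambda>P. \<Sum>R\<in>Z. z R * \<delta> R P) \<in> lin K (box (E + D))"
      using x(3) by (intro lin_sum K(1) lin_scale \<delta>_lin) auto
    ultimately show ?thesis
      unfolding \<Phi>_def x(1) by (simp add: lin_add K(1) add.commute)
  qed
  define F where "F = (\<lambda>x. SOME d. d \<in> box (E + D) \<rightarrow>\<^sub>E K \<and> (\<forall>P\<in>points. \<Phi> x P = ev (box (E + D)) d P))"
  have F: "F x \<in> box (E + D) \<rightarrow>\<^sub>E K \<and> (\<forall>P\<in>points. \<Phi> x P = ev (box (E + D)) (F x) P)" if "x \<in> ?A" for x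
  proof -
    have "\<exists>d. d \<in> box (E + D) \<rightarrow>\<^sub>E K \<and> (\<forall>P\<in>points. \<Phi> x P = ev (box (E + D)) d P)"
      using lin_coeffs[OF \<Phi>_lin[OF that] K01(1)] by blast
    thus ?thesis
      unfolding F_def by (rule someI_ex)
  qed
  \<comment> \<open>Values on \<open>Z\<close> recover \<open>z\<close>, since \<open>G\<close>
    vanishes there. What remains is \<open>G\<close> times a function; if the latter were nonzero,
    the product would have a leading term and could not vanish on the whole curve.\<close>
  have "inj_on F ?A"
  proof (rule inj_onI)
    fix x x' assume xx: "x \<in> ?A" "x' \<in> ?A" "F x = F x'"
    obtain c z where x: "x = (c, z)" "c \<in> box E \<rightarrow>\<^sub>E K" "z \<in> Z \<rightarrow>\<^sub>E K"
      using xx(1) by auto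
    obtain c' z' where x': "x' = (c', z')" "c' \<in> box E \<rightarrow>\<^sub>E K" "z' \<in> Z \<rightarrow>\<^sub>E K"
      using xx(2) by auto
    have eq: "\<Phi> x P = \<Phi> x' P" if "P \<in> points" for P
      using F[OF xx(1)] F[OF xx(2)] xx(3) that by simp
    have val: "\<Phi> (c0, z0) R = z0 R" if "R \<in> Z" for c0 z0 R
    proof -
      have "(\<Sum>S\<in>Z. z0 S * \<delta> S R) = (\<Sum>S\<in>Z. if S = R then z0 S else 0)"
        using that by (intro sum.cong) (auto simp: \<delta>_val)
      thus ?thesis
        using that finZ Z(3) by (simp add: \<Phi>_def)
    qed
    have zz: "z = z'"
    proof (rule PiE_ext[OF x(3) x'(3)])
      fix R assume "R \<in> Z"
      thus "z R = z' R"
        using eq[of R] Z(1) val[of R c z] val[of R c' z'] unfolding x(1) x'(1) by auto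
    qed
    have "c = c'"
    proof (rule ccontr)
      assume "c \<noteq> c'"
      then obtain m where "lead (\<lambda>P. ev (box E) c P - ev (box E) c' P) (ord_inf m)"
        using lead_ev_diff[OF x(2) x'(2)] by blast
      from lead_nonzero[OF lead_mult[OF G(2) this]] obtain P where
        P: "P \<in> points" "G P * (ev (box E) c P - ev (box E) c' P) \<noteq> 0"
        by blast
      have "G P * ev (box E) c P = G P * ev (box E) c' P"
        using eq[OF P(1)] unfolding x(1) x'(1) zz by (simp add: \<Phi>_def)
      with P(2) show False
        by (simp add: right_diff_distrib)
    qed
    with zz show "x = x'"
      using x(1) x'(1) by simp
  qed
  moreover have "F ` ?A \<subseteq> box (E + D) \<rightarrow>\<^sub>E K"
    using F by blast
  moreover have "finite (box (E + D) \<rightarrow>\<^sub>E K)"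
    using K(2) finite_box by (intro finite_PiE) auto
  ultimately have "card ?A \<le> card (box (E + D) \<rightarrow>\<^sub>E K)"
    by (intro card_inj_on_le)
  hence "card K ^ (card (box E) + card Z) \<le> card K ^ card (box (E + D))"
    using finZ finite_box by (simp add: card_cartesian_product card_funcsetE power_add)
  moreover have "card K > 1"
  proof -
    have "card {0, 1 :: 'k} \<le> card K"
      using K01 K(2) by (intro card_mono) auto
    thus ?thesis
      by simp
  qed
  ultimately have "card (box E) + card Z \<le> card (box (E + D))"
    by (rule power_le_imp_le_exp[rotated])
  moreover have "int (card (box (E + D))) \<le> int (card (box E)) + 2 * D + 2 * int p"
    using G(3) by (intro card_box_diff) (auto simp: E_def)
  ultimately show ?thesis
    by linarith
qed

text \<open>Bombieri's construction over the field with q^2 elements, q = p^\<mu>. More families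
  (g_m) than coefficient vectors force a relation \<Sum> g_m^q mon m = 0; then G = \<Sum> g_m (mon
  m)^q vanishes at the rational points, because there G^q is the relation itself. The bound 2 a < q
  keeps \<open>G\<close> from vanishing identically.\<close>

lemma exists_auxiliary:
  fixes \<mu> :: nat and a b :: int
  defines "K \<equiv> gf (2 * \<mu>)" and "q \<equiv> p ^ \<mu>"
  assumes uv: "u \<in> K" "v \<in> K" "\<gamma> \<in> K" and \<mu>: "\<mu> > 0" and a: "a \<ge> 0" "b \<ge> 0" "2 * a < int q"
    and dim: "card (box (int q * a + b)) < card (box b) * card (box a)"
  obtains G n where "G \<in> lin K (box (a + int q * b))" "lead G n" "\<And>P. P \<in> points \<inter> K \<times> K \<Longrightarrow> G P = 0"
proof -
  have K: "subsemiring K" "finite K" "0 \<in> K" "1 \<in> K"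
    using \<mu> by (auto simp: K_def subsemiring_gf finite_gf gf_closed)
  have K1: "card K > 1"
  proof -
    have "card {0, 1 :: 'k} \<le> card K"
      using K by (intro card_mono) auto
    thus ?thesis
      by simp
  qed
  let ?T = "box b \<rightarrow>\<^sub>E (box a \<rightarrow>\<^sub>E K)"
  let ?S = "box (int q * a + b) \<rightarrow>\<^sub>E K"
  define \<Phi> where "\<Phi> = (\<lambda>d P. \<Sum>m\<in>box b. ev (box a) (d m) P ^ q * mon m P)"
  have \<Phi>_lin: "\<Phi> d \<in> lin K (box (int q * a + b))" if "d \<in> ?T" for d
    unfolding \<Phi>_def using that
    by (intro lin_sum K(1) lin_box_mult uv lin_power lin_evI K(3) lin_mon) auto
  define F where "F = (\<lambda>x. SOME d. d \<in> ?S \<and> (\<forall>P\<in>points. \<Phi> x P = ev (box (int q * a + b)) d P))"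
  have F: "F x \<in> ?S \<and> (\<forall>P\<in>points. \<Phi> x P = ev (box (int q * a + b)) (F x) P)" if "x \<in> ?T" for x
  proof -
    have "\<exists>d. d \<in> ?S \<and> (\<forall>P\<in>points. \<Phi> x P = ev (box (int q * a + b)) d P)"
      using lin_coeffs[OF \<Phi>_lin[OF that] K(3)] by blast
    thus ?thesis
      unfolding F_def by (rule someI_ex)
  qed
  have finS: "finite ?S"
    using K(2) finite_box by (intro finite_PiE) auto
  have "card (F ` ?T) \<le> card ?S"
    using F finS by (intro card_mono) auto
  also have "\<dots> = card K ^ card (box (int q * a + b))"
    using finite_box by (simp add: card_funcsetE)
  also have "\<dots> < card K ^ (card (box b) * card (box a))"
    using K1 dim by (intro power_strict_increasing) auto
  also have "\<dots> = card ?T"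
    using finite_box by (simp add: card_funcsetE mult.commute flip: power_mult)
  \<comment> \<open>Taking \<open>q\<close>-th powers is additive, so the difference of two
    colliding families satisfies the relation.\<close>
  finally have "\<not> inj_on F ?T"
    by (rule pigeonhole)
  then obtain d d' where dd: "d \<in> ?T" "d' \<in> ?T" "d \<noteq> d'" "F d = F d'"
    unfolding inj_on_def by blast
  define g where "g = (\<lambda>m P. ev (box a) (d m) P - ev (box a) (d' m) P)"
  define G where "G = (\<lambda>P. \<Sum>m\<in>box b. g m P * mon m P ^ q)"
  have 0: "(\<Sum>m\<in>box b. g m P ^ q * mon m P) = 0" if "P \<in> points" for P
  proof -
    have "\<Phi> d P = \<Phi> d' P"
      using F[OF dd(1)] F[OF dd(2)] dd(4) that by simp
    thus ?thesis
      by (simp add: \<Phi>_def g_def q_def freshman_diff left_diff_distrib sum_subtractf)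
  qed
  have g_lin: "g m \<in> lin K (box a)" if "m \<in> box b" for m
  proof -
    have "-1 \<in> K"
      unfolding K_def by (intro gf_closed)
    hence "(\<lambda>P. ev (box a) (d m) P + (-1) * ev (box a) (d' m) P) \<in> lin K (box a)"
      using dd that by (intro lin_add lin_scale K(1) lin_evI K(3)) auto
    thus ?thesis
      by (simp add: g_def)
  qed
  have "G \<in> lin K (box (a + int q * b))"
    unfolding G_def by (intro lin_sum K(1) lin_box_mult uv g_lin lin_power lin_mon)
  moreover have "\<exists>n. lead G n"
  proof -
    define A where "A = {m\<in>box b. d m \<noteq> d' m}"
    have "\<exists>m'\<in>box a. lead (g m) (ord_inf m')" if "m \<in> A" for m
      unfolding g_def using that dd(1,2) by (intro lead_ev_diff) (auto simp: A_def)
    then obtain w where w: "\<And>m. m \<in> A \<Longrightarrow> w m \<in> box a" "\<And>m. m \<in> A \<Longrightarrow> lead (g m) (ord_inf (w m))"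
      by metis
    have "\<exists>m\<in>A. lead (\<lambda>P. \<Sum>m\<in>A. g m P * mon m P ^ q) (ord_inf (w m) + int q * ord_inf m)"
    proof (rule lead_sum[of A "\<lambda>m P. g m P * mon m P ^ q" "\<lambda>m. ord_inf (w m) + int q * ord_inf m"])
      show "finite A"
        using finite_box by (simp add: A_def)
      obtain m where "d m \<noteq> d' m"
        using dd(3) by blast
      moreover from this have "m \<in> box b"
        using PiE_arb[OF dd(1)] PiE_arb[OF dd(2)] by metis
      ultimately show "A \<noteq> {}"
        unfolding A_def by blast
      show "lead (\<lambda>P. g m P * mon m P ^ q) (ord_inf (w m) + int q * ord_inf m)" if "m \<in> A" for m
        using that box_subset_reduced by (intro lead_mult w lead_power lead_mon) (auto simp: A_def)
      \<comment> \<open>The orders \<open>ord_inf (w m)\<close> differ by at most 2 a < q, which is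
        less than the spacing of the multiples of \<open>q\<close>.\<close>
      show "inj_on (\<lambda>m. ord_inf (w m) + int q * ord_inf m) A"
      proof (rule inj_onI)
        fix m m' assume m: "m \<in> A" "m' \<in> A"
          and eq: "ord_inf (w m) + int q * ord_inf m = ord_inf (w m') + int q * ord_inf m'"
        have "\<bar>ord_inf (w m)\<bar> \<le> a" "\<bar>ord_inf (w m')\<bar> \<le> a"
          using w(1) m ord_inf_box by blast+
        hence "\<bar>int q * (ord_inf m - ord_inf m')\<bar> < int q"
          using eq a(3) by (simp add: right_diff_distrib)
        hence "int q * \<bar>ord_inf m - ord_inf m'\<bar> < int q * 1"
          by (simp add: abs_mult)
        hence "\<bar>ord_inf m - ord_inf m'\<bar> < 1"
          by (rule mult_left_less_imp_less) simp
        thus "m = m'"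
          using m box_subset_reduced by (intro ord_inf_inj) (auto simp: A_def)
      qed
    qed
    moreover have "(\<Sum>m\<in>A. g m P * mon m P ^ q) = G P" for P
      unfolding G_def A_def using finite_box
      by (intro sum.mono_neutral_left) (auto simp: g_def)
    ultimately show ?thesis
      by auto
  qed
  moreover have "G P = 0" if "P \<in> points \<inter> K \<times> K" for P
  proof -
    \<comment> \<open>The coordinates of a rational point are fixed by the power q^2, hence so is
      every monomial.\<close>
    have q2: "mon m P ^ (q * q) = mon m P" for m
    proof -
      have "mon m P \<in> K"
        unfolding mon_def K_def using that
        by (intro gf_closed gf_power gf_power_int) (auto simp: K_def)
      thus ?thesis
        by (simp add: K_def gf_def q_def mult_2 power_add)
    qed
    have "G P ^ q = (\<Sum>m\<in>box b. (g m P * mon m P ^ q) ^ q)"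
      unfolding G_def q_def by (rule freshman_sum)
    also have "\<dots> = (\<Sum>m\<in>box b. g m P ^ q * mon m P)"
      by (simp add: power_mult_distrib q2 flip: power_mult)
    also have "\<dots> = 0"
      using 0 that by blast
    finally show ?thesis
      by simp
  qed
  ultimately show ?thesis
    using that by blast
qed

text \<open>The auxiliary function has poles of order at most a + q b, which bounds the points by 2
  (a + q b) + 2 p. The parameters make this q^2 + O(p q).\<close>

theorem card_points_le:
  assumes uv: "u \<in> gf (2 * \<mu>)" "v \<in> gf (2 * \<mu>)" "\<gamma> \<in> gf (2 * \<mu>)" and large: "p ^ \<mu> \<ge> 50 * p ^ 2"
  shows "card (points \<inter> gf (2 * \<mu>) \<times> gf (2 * \<mu>)) \<le> p ^ (2 * \<mu>) + 20 * p * p ^ \<mu>"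
proof -
  define q where "q = p ^ \<mu>"
  have \<mu>: "\<mu> > 0"
  proof (rule ccontr)
    assume "\<not> \<mu> > 0"
    hence "50 * p ^ 2 \<le> 1"
      using large by simp
    moreover have "p ^ 2 \<ge> 1"
      using p_pos by simp
    ultimately show False
      by linarith
  qed
  have "odd p"
    using prime_p p_gt_3 prime_odd_nat by auto
  hence "odd q"
    by (simp add: q_def)
  \<comment> \<open>2 a = q - 1 is the largest value allowed below \<open>q\<close>. The choice of
    \<open>b\<close> makes the product (q + 6 p + 3)(q - 1 - 6 p) of lower bounds exceed the upper
    bound q^2 + 13 p + 3: this says 2 q > 36 p^2 + 37 p + 6, which the hypothesis q \<ge> 50 p^2
    secures.\<close>
  define a where "a = (int q - 1) div 2"
  define b where "b = (int q + 12 * int p + 3) div 2"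
  have a: "2 * a = int q - 1"
    using \<open>odd q\<close> by (simp add: a_def)
  have b: "2 * b = int q + 12 * int p + 3"
    using \<open>odd q\<close> by (simp add: b_def)
  have pq: "int q \<ge> 50 * (int p)\<^sup>2"
    using large unfolding q_def by (metis of_nat_le_iff of_nat_mult of_nat_numeral of_nat_power)
  have p4: "int p \<ge> 4"
    using p_gt_3 by simp
  have "(int p)\<^sup>2 \<ge> 4 * int p"
    using p4 by (simp add: power2_eq_square)
  hence q_big: "int q \<ge> 200 * int p"
    using pq by linarith
  have "2 * (int q * a + b) = int q * (2 * a) + 2 * b"
    by (simp add: algebra_simps)
  also have "\<dots> = int q * int q + 12 * int p + 3"
    unfolding a b by (simp add: algebra_simps)
  finally have ab: "2 * (int q * a + b) = int q * int q + 12 * int p + 3" .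
  have "int q * int q \<ge> 200 * int p * 1"
    using q_big p4 by (intro mult_mono) auto
  hence "6 * int p \<le> 2 * (int q * a + b)"
    unfolding ab using p4 by linarith
  hence "int (card (box (int q * a + b))) \<le> 2 * (int q * a + b) + int p"
    by (intro card_box_upper) simp
  also have "\<dots> = int q * int q + 13 * int p + 3"
    using ab by simp
  also have "\<dots> < (int q + 6 * int p + 3) * (int q - 1 - 6 * int p)"
  proof -
    have "(int q + 6 * int p + 3) * (int q - 1 - 6 * int p) =
       int q * int q + 2 * int q - (36 * (int p)\<^sup>2 + 24 * int p + 3)"
      by (simp add: algebra_simps power2_eq_square)
    thus ?thesis
      using pq \<open>(int p)\<^sup>2 \<ge> 4 * int p\<close> p4 by linarith
  qed
  also have "\<dots> \<le> int (card (box b)) * int (card (box a))"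
    using card_box_lower[of a] card_box_lower[of b] a b q_big p4 by (intro mult_mono) auto
  finally have dim: "card (box (int q * a + b)) < card (box b) * card (box a)"
    by (simp flip: of_nat_mult)
  have nn: "a \<ge> 0" "b \<ge> 0"
    using a b q_big p4 by linarith+
  obtain G n where G: "G \<in> lin (gf (2 * \<mu>)) (box (a + int q * b))" "lead G n"
    "\<And>P. P \<in> points \<inter> gf (2 * \<mu>) \<times> gf (2 * \<mu>) \<Longrightarrow> G P = 0"
    using exists_auxiliary[OF uv \<mu> nn] a dim unfolding q_def[symmetric] by auto
  have "int (card (points \<inter> gf (2 * \<mu>) \<times> gf (2 * \<mu>))) \<le> 2 * (a + int q * b) + 2 * int p"
    using G nn \<mu>
    by (intro zeros_bound[OF subsemiring_gf finite_gf _ _ uv G(1,2)])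
       (auto intro: gf_closed)
  also have "\<dots> = int q * (2 * b) + 2 * a + 2 * int p"
    by (simp add: algebra_simps)
  also have "\<dots> = int q * int q + (12 * int p + 4) * int q - 1 + 2 * int p"
    unfolding a b by (simp add: algebra_simps)
  also have "\<dots> \<le> int q * int q + 20 * int p * int q"
  proof -
    have "4 * int q \<le> int p * int q"
      using p4 by (intro mult_right_mono) auto
    moreover have "int p * 1 \<le> int p * int q"
      using q_big p4 by (intro mult_left_mono) auto
    ultimately show ?thesis
      by (simp add: algebra_simps)
  qed
  also have "\<dots> = int (p ^ (2 * \<mu>) + 20 * p * p ^ \<mu>)"
    by (simp add: q_def mult_2 power_add)
  finally show ?thesis
    by linarith
qed

end

section \<open>The Weil bound\<close>

lemma order_prod_linear:
  "order x (\<Prod>y\<in>#A. [:-y, 1:] :: 'a :: idom poly) = count A x"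
proof (induction A)
  case (add y A)
  have nz: "(\<Prod>y\<in>#A. [:-y, 1:] :: 'a poly) \<noteq> 0"
    by (auto simp: prod_mset_zero_iff)
  have "order x [:-y, 1:] = (if x = y then 1 else 0)"
    using order_power_n_n[of y 1] by (auto simp: order_0I)
  moreover have "[:-y, 1:] * (\<Prod>y\<in>#A. [:-y, 1:]) \<noteq> 0"
    using nz by (simp del: mult_pCons_left)
  ultimately show ?case
    using add by (simp add: order_mult del: mult_pCons_left)
qed simp

lemma sum_order_eq_degree:
  fixes h :: "'a :: alg_closed_field poly"
  assumes "h \<noteq> 0"
  shows "(\<Sum>x | poly h x = 0. order x h) = degree h"
proof -
  obtain A where A: "size A = degree h" "h = smult (lead_coeff h) (\<Prod>x\<in>#A. [:-x, 1:])"
    using alg_closed_imp_factorization[OF assms] by blast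
  have ord: "order x h = count A x" for x
    using assms by (subst A(2), subst order_smult) (auto simp: order_prod_linear)
  have "{x. poly h x = 0} = set_mset A"
    using ord assms by (metis (mono_tags, lifting) Collect_cong count_greater_zero_iff order_root neq0_conv Collect_mem_eq)
  thus ?thesis
    using A(1) by (simp add: ord size_multiset_overloaded_eq)
qed

lemma prod_linear_power_dvd:
  fixes h :: "'a :: idom poly"
  assumes "finite A" "\<And>a. a \<in> A \<Longrightarrow> k \<le> order a h" "h \<noteq> 0"
  shows "(\<Prod>a\<in>A. [:-a, 1:]) ^ k dvd h"
proof -
  have "(\<Prod>a\<in>A. [:-a, 1:] ^ k) dvd h"
    using assms(1,2)
  proof (induction A)
    case (insert a A)
    then obtain g where g: "h = (\<Prod>a\<in>A. [:-a, 1:] ^ k) * g"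
      by (auto elim: dvdE)
    have nz: "(\<Prod>a\<in>A. [:-a, 1:] ^ k) \<noteq> 0" "g \<noteq> 0"
      using assms(3) g by auto
    have "poly (\<Prod>a\<in>A. [:-a, 1:] ^ k) a \<noteq> 0"
      using insert(1,2) by (simp add: poly_prod prod_zero_iff)
    hence "order a (\<Prod>a\<in>A. [:-a, 1:] ^ k) = 0"
      by (rule order_0I)
    hence "order a h = order a g"
      using assms(3) unfolding g by (simp add: order_mult)
    hence "[:-a, 1:] ^ k dvd g"
      using insert.prems[of a] nz by (simp add: order_divides)
    thus ?case
      using insert(1,2) unfolding g by (simp add: mult_dvd_mono mult.commute)
  qed simp
  thus ?thesis
    by (simp add: prod_power_distrib)
qed

text \<open>The character \<psi> is constrained on the solutions of x^p = x only, that is, on the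
  prime field inside \<open>'k\<close>.\<close>

locale weil = fixes p :: nat and u v :: "'k :: alg_closed_field" and \<psi> :: "'k \<Rightarrow> complex"
  assumes prime_p': "prime p" and p_gt_3': "p > 3" and CHAR_p': "CHAR('k) = p" and u_nz': "u \<noteq> 0"
    and u_rat: "u ^ p = u" and v_rat: "v ^ p = v"
    and psi_add: "\<And>x y. x ^ p = x \<Longrightarrow> y ^ p = y \<Longrightarrow> \<psi> (x + y) = \<psi> x * \<psi> y"
    and psi_norm: "\<And>x. x ^ p = x \<Longrightarrow> norm (\<psi> x) = 1"
    and psi_nontrivial: "\<exists>x. x ^ p = x \<and> \<psi> x \<noteq> 1"
begin

sublocale artin_schreier p u v 0
  by unfold_locales (use prime_p' p_gt_3' CHAR_p' u_nz' in auto)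

lemma mem_gf1: "x \<in> gf (Suc 0) \<longleftrightarrow> x ^ p = x"
  by (simp add: gf_def)

lemma frob_iter_inj: "x ^ p ^ n = y ^ p ^ n \<Longrightarrow> x = (y :: 'k)"
  using freshman_diff[of x y n] by simp

lemma gf1_frob: "x \<in> gf 1 \<Longrightarrow> x ^ p ^ i = x"
  by (induction i) (auto simp: mem_gf1 power_mult)

lemma gf1_subset: "gf 1 \<subseteq> gf n"
  using gf1_frob by (auto simp: gf_def)

text \<open>The derivative of X^(p^n) - X is -1, so all its roots are simple.\<close>

lemma card_gf: "n > 0 \<Longrightarrow> card (gf n) = p ^ n"
proof -
  assume n: "n > 0"
  define F where "F = monom 1 (p ^ n) + (- monom 1 1 :: 'k poly)"
  let ?f = F
  have "p ^ 1 \<le> p ^ n"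
    using n p_pos by (intro power_increasing) auto
  hence gt: "p ^ n > 1"
    using p_gt_3 by simp
  have deg: "degree ?f = p ^ n"
    using gt unfolding F_def by (subst degree_add_eq_left) (auto simp: degree_monom_eq)
  have nz: "?f \<noteq> 0"
  proof
    assume "?f = 0"
    thus False
      using deg gt by (simp only: degree_0)
  qed
  have pd: "pderiv ?f = -1"
  proof -
    have "of_nat (p ^ n) = (0 :: 'k)"
      using n by (simp add: of_nat_eq_0_iff_char_dvd CHAR_p)
    thus ?thesis
      unfolding F_def pderiv_add pderiv_minus pderiv_monom
      by (simp add: one_pCons monom_0)
  qed
  have "order x ?f = 1" if x: "poly ?f x = 0" for x
  proof -
    have "order x ?f \<noteq> 0"
      using x nz order_root by blast
    moreover have "\<not> [:-x, 1:] ^ 2 dvd ?f"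
    proof
      assume "[:-x, 1:] ^ 2 dvd ?f"
      then obtain g where "?f = [:-x, 1:] ^ 2 * g"
        by (elim dvdE)
      moreover define l where "l = [:-x, 1:]"
      ultimately have "?f = l * l * g"
        by (simp add: power2_eq_square)
      moreover have "poly l x = 0"
        by (simp add: l_def)
      ultimately have "poly (pderiv ?f) x = 0"
        by (simp add: pderiv_mult)
      thus False
        by (simp add: pd)
    qed
    hence "\<not> 2 \<le> order x ?f"
      using order_divides[of x 2 ?f] nz by blast
    ultimately show ?thesis
      by linarith
  qed
  hence "degree ?f = (\<Sum>x | poly ?f x = 0. 1)"
    using sum_order_eq_degree[OF nz] by simp
  also have "{x. poly ?f x = 0} = gf n"
    by (simp add: gf_def F_def poly_monom)
  finally show ?thesis
    using deg by simp
qed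

lemma psi_0: "\<psi> 0 = 1"
  using psi_add[of 0 0] psi_norm[of 0] p_pos by auto

lemma psi_sum_gf: "(\<Sum>x\<in>gf 1. \<psi> x) = 0"
proof -
  obtain c where c: "c \<in> gf 1" "\<psi> c \<noteq> 1"
    using psi_nontrivial by (auto simp: mem_gf1)
  have "(\<Sum>x\<in>gf 1. \<psi> x) = (\<Sum>x\<in>gf 1. \<psi> (c + x))"
    by (rule sum.reindex_bij_witness[of _ "\<lambda>x. c + x" "\<lambda>x. x - c"]) (use c in \<open>auto intro: gf_closed\<close>)
  also have "\<dots> = \<psi> c * (\<Sum>x\<in>gf 1. \<psi> x)"
    unfolding sum_distrib_left using c by (intro sum.cong refl psi_add) (auto simp: mem_gf1)
  finally show ?thesis
    using c(2) by (simp add: algebra_simps)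
qed

section \<open>Traces and character sums over extension fields\<close>

definition f :: "'k \<Rightarrow> 'k" where
  "f t = u * t ^ 3 + v * t powi (-2)"

definition tr :: "nat \<Rightarrow> 'k \<Rightarrow> 'k" where
  "tr n x = (\<Sum>i<n. x ^ p ^ i)"

definition S :: "nat \<Rightarrow> complex" where
  "S n = (\<Sum>t\<in>gf n - {0}. \<psi> (tr n (f t)))"

lemma f_gf: "t \<in> gf n \<Longrightarrow> f t \<in> gf n"
  unfolding f_def using u_rat v_rat gf1_subset[of n]
  by (intro gf_closed gf_power gf_power_int) (auto simp: mem_gf1)

lemma tr_diff: "tr n (x - y) = tr n x - tr n y"
  by (simp add: tr_def freshman_diff sum_subtractf)

lemma tr_frob_diff: "tr n (y ^ p - y) = y ^ p ^ n - y"
proof -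
  have "tr n (y ^ p - y) = (\<Sum>i<n. y ^ p ^ Suc i - y ^ p ^ i)"
    by (simp add: tr_def freshman_diff power_mult[symmetric] mult.commute)
  also have "\<dots> = y ^ p ^ n - y"
    by (subst sum_lessThan_telescope) simp
  finally show ?thesis .
qed

lemma tr_gf: "x \<in> gf n \<Longrightarrow> tr n x \<in> gf 1"
proof -
  assume x: "x \<in> gf n"
  have "tr n (x ^ p) = tr n x ^ p"
    using freshman_sum[of "\<lambda>i. x ^ p ^ i" "{..<n}" 1]
    by (simp add: tr_def power_mult[symmetric] mult.commute)
  moreover have "tr n (x ^ p - x) = 0"
    using x by (simp add: tr_frob_diff gf_def)
  ultimately show ?thesis
    by (simp add: tr_diff mem_gf1)
qed

text \<open>Fix \<open>t0\<close> with trace value \<open>c\<close> and shift the curve by -f(t0).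
  For any other \<open>t\<close> in the fibre, f(t) - f(t0) has trace 0, so by telescoping each
  solution of y^p - y = f(t) - f(t0) is rational. Thus \<open>t\<close> carries \<open>p\<close>
  rational points y + k.\<close>

lemma card_fibre_le:
  assumes large: "p ^ \<mu> \<ge> 50 * p ^ 2"
  shows "p * card {t \<in> gf (2 * \<mu>) - {0}. tr (2 * \<mu>) (f t) = c} \<le> p ^ (2 * \<mu>) + 20 * p * p ^ \<mu>"
proof (cases "{t \<in> gf (2 * \<mu>) - {0}. tr (2 * \<mu>) (f t) = c} = {}")
  case False
  define n where "n = 2 * \<mu>"
  define A where "A = {t \<in> gf n - {0}. tr n (f t) = c}"
  obtain t0 where t0: "t0 \<in> A"
    using False unfolding A_def n_def by blast
  define \<gamma> where "\<gamma> = - f t0"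
  have \<mu>: "\<mu> > 0"
  proof (rule ccontr)
    assume "\<not> \<mu> > 0"
    hence "50 * p ^ 2 \<le> 1"
      using large by simp
    moreover have "p ^ 2 \<ge> 1"
      using p_pos by simp
    ultimately show False
      by linarith
  qed
  interpret AS: artin_schreier p u v \<gamma>
    by unfold_locales (use prime_p' p_gt_3' CHAR_p' u_nz' in auto)
  have \<gamma>: "\<gamma> \<in> gf n"
    unfolding \<gamma>_def using t0 by (intro gf_closed f_gf) (auto simp: A_def)
  have "\<exists>y. y ^ p - y = f t + \<gamma>" for t
    by (rule exists_point)
  then obtain y where y: "\<And>t. y t ^ p - y t = f t + \<gamma>"
    by metis
  have y_gf: "y t \<in> gf n" if "t \<in> A" for t
  proof -
    have "y t ^ p ^ n - y t = tr n (f t - f t0)"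
      using tr_frob_diff[of n "y t"] y[of t] by (simp add: \<gamma>_def)
    also have "\<dots> = 0"
      using that t0 by (simp add: tr_diff A_def)
    finally show ?thesis
      by (simp add: gf_def)
  qed
  have of_nat_gf: "of_nat k \<in> gf n" for k
    using of_nat_pow_p[of k] gf1_subset[of n] by (auto simp: mem_gf1)
  have "(\<lambda>(t, k). (t, y t + of_nat k)) ` (A \<times> {..<p}) \<subseteq> AS.points \<inter> gf n \<times> gf n"
  proof safe
    fix t k assume t: "t \<in> A"
    show "(t, y t + of_nat k) \<in> AS.points"
      using y[of t] t freshman[of "y t" "of_nat k" 1]
      by (auto simp: AS.points_def A_def f_def of_nat_pow_p)
    show "t \<in> gf n"
      using t by (simp add: A_def)
    show "y t + of_nat k \<in> gf n"
      using t by (intro gf_closed y_gf of_nat_gf)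
  qed
  moreover have "inj_on (\<lambda>(t, k). (t, y t + of_nat k)) (A \<times> {..<p})"
    using inj_of_nat_p by (auto simp: inj_on_def)
  moreover have "finite (AS.points \<inter> gf n \<times> gf n)"
    using \<mu> finite_gf[of n] by (auto simp: n_def)
  ultimately have "card (A \<times> {..<p}) \<le> card (AS.points \<inter> gf n \<times> gf n)"
    by (intro card_inj_on_le)
  also have "\<dots> \<le> p ^ (2 * \<mu>) + 20 * p * p ^ \<mu>"
  proof -
    have "u \<in> gf n" "v \<in> gf n"
      using gf1_subset[of n] u_rat v_rat by (auto simp: mem_gf1)
    thus ?thesis
      using AS.card_points_le[of \<mu>] \<gamma> large unfolding n_def[symmetric] by blast
  qed
  finally show ?thesis
    by (simp add: A_def n_def card_cartesian_product mult.commute)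
next
  case True
  show ?thesis
    unfolding True by simp
qed

text \<open>All fibres of the trace are nearly of the same size p^n / p, and a constant fibre size
  contributes nothing because \<psi> sums to 0 over the prime field. The loss p^2 does not depend on
  \<mu>, which is all that matters later.\<close>

lemma S_bound:
  assumes large: "p ^ \<mu> \<ge> 50 * p ^ 2"
  shows "norm (S (2 * \<mu>)) \<le> 21 * real p ^ 2 * real p ^ \<mu>"
proof -
  define n where "n = 2 * \<mu>"
  define N where "N = (\<lambda>c. card {t \<in> gf n - {0}. tr n (f t) = c})"
  have \<mu>: "\<mu> > 0"
  proof (rule ccontr)
    assume "\<not> \<mu> > 0"
    hence "50 * p ^ 2 \<le> 1"
      using large by simp
    moreover have "p ^ 2 \<ge> 1"
      using p_pos by simp
    ultimately show False
      by linarith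
  qed
  hence n: "n > 0"
    by (simp add: n_def)
  note fin = finite_gf[OF n]
  have tr_in: "tr n (f t) \<in> gf 1" if "t \<in> gf n - {0}" for t
    using that by (intro tr_gf f_gf) auto
  have fin1: "finite (gf 1)"
    by (rule finite_gf) simp
  have total: "(\<Sum>c\<in>gf 1. N c) = p ^ n - 1"
  proof -
    have "(\<Sum>c\<in>gf 1. \<Sum>t\<in>{t \<in> gf n - {0}. tr n (f t) = c}. 1 :: nat) = (\<Sum>t\<in>gf n - {0}. 1)"
    proof (rule sum.group)
      show "finite (gf n - {0})"
        using fin by (rule finite_Diff)
      show "(\<lambda>t. tr n (f t)) ` (gf n - {0}) \<subseteq> gf 1"
        using tr_in by blast
    qed (rule fin1)
    hence "(\<Sum>c\<in>gf 1. N c) = card (gf n - {0})"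
      by (simp only: N_def card_eq_sum)
    also have "\<dots> = p ^ n - 1"
      using fin card_gf[OF n] gf_closed(1) by (simp add: card_Diff_singleton)
    finally show ?thesis .
  qed
  define q where "q = real p ^ n / real p"
  have up: "real (N c) \<le> q + 20 * real p ^ \<mu>" for c
  proof -
    have "real (p * N c) \<le> real (p ^ n + 20 * p * p ^ \<mu>)"
      unfolding of_nat_le_iff N_def n_def by (rule card_fibre_le[OF large])
    also have "\<dots> = q * real p + 20 * real p ^ \<mu> * real p"
      using p_pos by (simp add: q_def mult_ac)
    also have "\<dots> = (q + 20 * real p ^ \<mu>) * real p"
      by (rule distrib_right[symmetric])
    finally have "real (N c) * real p \<le> (q + 20 * real p ^ \<mu>) * real p"
      by (simp only: of_nat_mult mult.commute)
    thus ?thesis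
      by (rule mult_right_le_imp_le) (use p_pos in simp)
  qed
  \<comment> \<open>The lower bound follows from the upper bounds for the other p - 1 fibres and the
    total p^n - 1; it costs 20 (p - 1) p^\<mu> + 1.\<close>
  have "\<bar>real (N c) - q\<bar> \<le> 21 * real p * real p ^ \<mu>" if c: "c \<in> gf 1" for c
  proof -
    have "real (\<Sum>c\<in>gf 1. N c) = real (N c) + (\<Sum>c\<in>gf 1 - {c}. real (N c))"
      using c fin1 by (simp add: sum.remove)
    also have "\<dots> \<le> real (N c) + (\<Sum>c\<in>gf 1 - {c}. q + 20 * real p ^ \<mu>)"
      by (intro add_left_mono sum_mono up)
    also have "\<dots> = real (N c) + (real p - 1) * (q + 20 * real p ^ \<mu>)"
      using c fin1 card_gf[of 1] p_pos by (simp add: card_Diff_singleton of_nat_diff)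
    finally have "real p ^ n - 1 \<le> real (N c) + (real p - 1) * (q + 20 * real p ^ \<mu>)"
      unfolding total using p_pos by (simp add: of_nat_diff)
    moreover have "real p ^ n = real p * q"
      using p_pos by (simp add: q_def)
    moreover have "real p ^ \<mu> \<ge> 1"
      using p_pos by simp
    moreover have "1 \<le> real p * real p ^ \<mu>" "20 * real p ^ \<mu> \<le> 20 * (real p * real p ^ \<mu>)"
      using p_pos \<open>real p ^ \<mu> \<ge> 1\<close> mult_mono[of 1 "real p" 1 "real p ^ \<mu>"]
        mult_right_mono[of 1 "real p" "real p ^ \<mu>"] by auto
    ultimately show ?thesis
      using up[of c] by (simp add: abs_le_iff algebra_simps)
  qed note dev = this
  have "S n = (\<Sum>t\<in>gf n - {0}. \<psi> (tr n (f t)))"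
    by (simp add: S_def)
  also have "\<dots> = (\<Sum>c\<in>gf 1. \<Sum>t\<in>{t \<in> gf n - {0}. tr n (f t) = c}. \<psi> (tr n (f t)))"
  proof (rule sum.group[symmetric])
    show "finite (gf n - {0})"
      using fin by (rule finite_Diff)
    show "(\<lambda>t. tr n (f t)) ` (gf n - {0}) \<subseteq> gf 1"
      using tr_in by blast
  qed (rule fin1)
  also have "\<dots> = (\<Sum>c\<in>gf 1. \<Sum>t\<in>{t \<in> gf n - {0}. tr n (f t) = c}. \<psi> c)"
    by (rule sum.cong[OF refl], rule sum.cong[OF refl]) simp
  also have "\<dots> = (\<Sum>c\<in>gf 1. of_nat (N c) * \<psi> c)"
    by (simp only: N_def sum_constant)
  also have "\<dots> = (\<Sum>c\<in>gf 1. of_real (real (N c) - q) * \<psi> c)"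
    using psi_sum_gf by (simp add: left_diff_distrib sum_subtractf sum_distrib_left[symmetric])
  finally have "norm (S n) \<le> (\<Sum>c\<in>gf 1. norm (of_real (real (N c) - q) * \<psi> c))"
    by (simp add: norm_sum)
  also have "\<dots> \<le> (\<Sum>c\<in>gf 1. 21 * real p * real p ^ \<mu>)"
  proof (intro sum_mono)
    fix c assume c: "c \<in> gf 1"
    have "norm (of_real (real (N c) - q) * \<psi> c) = \<bar>real (N c) - q\<bar>"
      using c psi_norm by (simp add: norm_mult mem_gf1 del: of_real_diff)
    thus "norm (of_real (real (N c) - q) * \<psi> c) \<le> 21 * real p * real p ^ \<mu>"
      using dev[OF c] by simp
  qed
  also have "\<dots> = 21 * real p ^ 2 * real p ^ \<mu>"
    using card_gf[of 1] by (simp add: power2_eq_square)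
  finally show ?thesis
    by (simp add: n_def)
qed

section \<open>The L-function of the character\<close>

definition rat_poly :: "'k poly set" where
  "rat_poly = {h. \<forall>i. coeff h i \<in> gf 1}"

definition frob :: "'k poly \<Rightarrow> 'k poly" where
  "frob h = map_poly (\<lambda>x. x ^ p) h"

lemma coeff_frob: "coeff (frob h) i = coeff h i ^ p"
  using p_pos by (simp add: frob_def coeff_map_poly)

lemma frob_mult: "frob (g * h) = frob g * frob h"
proof (rule poly_eqI)
  fix n
  show "coeff (frob (g * h)) n = coeff (frob g * frob h) n"
    using freshman_sum[of "\<lambda>i. coeff g i * coeff h (n - i)" "{..n}" 1]
    by (simp add: coeff_frob coeff_mult power_mult_distrib)
qed

lemma frob_1: "frob 1 = 1"
  by (rule poly_eqI) (use p_pos in \<open>simp add: coeff_frob coeff_1\<close>)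

lemma frob_prod: "frob (\<Prod>i\<in>A. g i) = (\<Prod>i\<in>A. frob (g i))"
  by (induction A rule: infinite_finite_induct) (auto simp: frob_1 frob_mult)

lemma frob_power: "frob (g ^ n) = frob g ^ n"
  by (induction n) (auto simp: frob_1 frob_mult)

lemma frob_linear: "frob [:-x, 1:] = [:-(x ^ p), 1:]"
proof (rule poly_eqI)
  fix i
  show "coeff (frob [:-x, 1:]) i = coeff [:-(x ^ p), 1:] i"
    using p_pos freshman_diff[of 0 x 1]
    by (auto simp: coeff_frob coeff_pCons split: nat.splits)
qed

lemma rat_poly_frob: "h \<in> rat_poly \<longleftrightarrow> frob h = h"
  by (auto simp: rat_poly_def poly_eq_iff coeff_frob mem_gf1)

text \<open>Raising coefficients to the power \<open>p\<close> fixes a rational \<open>h\<close> and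
  moves a factor X - x to X - x^p.\<close>

lemma order_frob_le:
  assumes "h \<in> rat_poly" "h \<noteq> 0"
  shows "order x h \<le> order (x ^ p) h"
proof -
  obtain g where g: "h = [:-x, 1:] ^ order x h * g"
    using order_1[of x h] by (elim dvdE)
  have "frob h = [:-(x ^ p), 1:] ^ order x h * frob g"
    by (subst g) (simp only: frob_mult frob_power frob_linear)
  hence "[:-(x ^ p), 1:] ^ order x h dvd h"
    using assms(1) unfolding rat_poly_frob by (metis dvd_triv_left)
  thus ?thesis
    using assms(2) by (simp add: order_divides)
qed

lemma order_frob_iter_le:
  assumes "h \<in> rat_poly" "h \<noteq> 0"
  shows "order x h \<le> order (x ^ p ^ i) h"
proof (induction i)
  case (Suc i)
  show ?case
    using Suc order_frob_le[OF assms, of "x ^ p ^ i"] by (simp add: power_mult[symmetric] mult.commute)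
qed simp

text \<open>The nonzero constant coefficient excludes the root 0, just as \<open>S\<close> sums over
  nonzero \<open>t\<close>.\<close>

definition M :: "nat \<Rightarrow> 'k poly set" where
  "M d = {h \<in> rat_poly. degree h = d \<and> lead_coeff h = 1 \<and> coeff h 0 \<noteq> 0}"

text \<open>For monic \<open>h\<close>, Newton's identities identify the first bracket with the sum
  of the cubes of the roots and the second with the sum of their inverse squares, so the value is
  the sum of \<open>f\<close> over the roots. The coefficient form makes its rationality evident.
  \<open>reflect_poly\<close> numbers coefficients from the top and reads 0 beyond the
  degree.\<close>

definition lam :: "'k poly \<Rightarrow> 'k" where
  "lam h = (let r = coeff (reflect_poly h); l = (\<lambda>i. coeff h i / coeff h 0) in
     u * (3 * r 1 * r 2 - r 1 ^ 3 - 3 * r 3) + v * (l 1 ^ 2 - 2 * l 2))"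

lemma lam_mult:
  assumes "lead_coeff g = 1" "lead_coeff h = 1" "coeff g 0 \<noteq> 0" "coeff h 0 \<noteq> 0"
  shows "lam (g * h) = lam g + lam h"
proof -
  define r where "r = coeff (reflect_poly g)"
  define s where "s = coeff (reflect_poly h)"
  define g0 g1 g2 h0 h1 h2 where gh: "g0 = coeff g 0" "g1 = coeff g 1" "g2 = coeff g 2"
    "h0 = coeff h 0" "h1 = coeff h 1" "h2 = coeff h 2"
  have r0: "r 0 = 1" "s 0 = 1"
    using assms by (simp_all add: r_def s_def)
  have rs: "coeff (reflect_poly (g * h)) 1 = r 1 + s 1"
     "coeff (reflect_poly (g * h)) 2 = r 2 + r 1 * s 1 + s 2"
     "coeff (reflect_poly (g * h)) 3 = r 3 + r 2 * s 1 + r 1 * s 2 + s 3"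
    using r0 unfolding reflect_poly_mult coeff_mult r_def s_def
    by (simp_all add: numeral_eq_Suc)
  have gh': "coeff (g * h) 0 = g0 * h0" "coeff (g * h) 1 = g0 * h1 + g1 * h0"
     "coeff (g * h) 2 = g0 * h2 + g1 * h1 + g2 * h0"
    unfolding coeff_mult gh by (simp_all add: numeral_eq_Suc)
  have nz: "g0 \<noteq> 0" "h0 \<noteq> 0"
    using assms gh by auto
  have 1: "(3 * (r 1 + s 1) * (r 2 + r 1 * s 1 + s 2) - (r 1 + s 1) ^ 3 - 3 * (r 3 + r 2 * s 1 + r 1 * s 2 + s 3)) =
     (3 * r 1 * r 2 - r 1 ^ 3 - 3 * r 3) + (3 * s 1 * s 2 - s 1 ^ 3 - 3 * s 3)"
    by (simp add: algebra_simps power3_eq_cube)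
  have 2: "((g0 * h1 + g1 * h0) / (g0 * h0)) ^ 2 - 2 * ((g0 * h2 + g1 * h1 + g2 * h0) / (g0 * h0)) =
     ((g1 / g0) ^ 2 - 2 * (g2 / g0)) + ((h1 / h0) ^ 2 - 2 * (h2 / h0))"
    using nz by (simp add: field_simps power2_eq_square)
  show ?thesis
    unfolding lam_def Let_def rs gh' r_def[symmetric] s_def[symmetric] gh[symmetric] 1 2
    by (simp add: algebra_simps)
qed

lemma lam_1: "lam 1 = 0"
  by (simp add: lam_def)

lemma lam_prod:
  assumes "\<And>i. i \<in> A \<Longrightarrow> lead_coeff (g i) = 1 \<and> coeff (g i) 0 \<noteq> 0"
  shows "lam (\<Prod>i\<in>A. g i) = (\<Sum>i\<in>A. lam (g i))"
  using assms
proof (induction A rule: infinite_finite_induct)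
  case (insert x A)
  have "lead_coeff (\<Prod>i\<in>A. g i) = 1"
    using insert.prems by (simp add: lead_coeff_prod)
  moreover have "coeff (\<Prod>i\<in>A. g i) 0 \<noteq> 0"
    using insert.prems insert.hyps by (simp add: poly_0_coeff_0[symmetric] poly_prod prod_zero_iff)
  ultimately have "lam (g x * (\<Prod>i\<in>A. g i)) = lam (g x) + lam (\<Prod>i\<in>A. g i)"
    using insert.prems by (intro lam_mult) auto
  thus ?case
    using insert by simp
qed (simp_all add: lam_1)

lemma lam_linear:
  assumes "x \<noteq> 0"
  shows "lam [:-x, 1:] = f x"
proof -
  have "reflect_poly [:-x, 1:] = [:1, -x:]"
    using assms by (simp add: reflect_poly_def)
  thus ?thesis
    using assms by (simp add: lam_def f_def Let_def numeral_eq_Suc power_int_minus field_simps)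
qed

lemma lam_rat: "h \<in> rat_poly \<Longrightarrow> lam h \<in> gf 1"
proof -
  assume h: "h \<in> rat_poly"
  have c: "coeff h i \<in> gf 1" for i
    using h by (simp add: rat_poly_def)
  have r: "coeff (reflect_poly h) i \<in> gf 1" for i
    using c by (simp add: coeff_reflect_poly gf_closed del: One_nat_def)
  have d: "x / y \<in> gf 1" if "x \<in> gf 1" "y \<in> gf 1" for x y
    using that unfolding divide_inverse by (intro gf_closed)
  have n: "2 \<in> gf 1" "3 \<in> gf 1"
    using of_nat_pow_p[of 2] of_nat_pow_p[of 3] by (simp_all add: mem_gf1)
  have uv: "u \<in> gf 1" "v \<in> gf 1"
    using u_rat v_rat by (simp_all add: mem_gf1)
  show ?thesis
    unfolding lam_def Let_def by (intro gf_closed gf_power d n c r uv)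
qed

definition chi :: "'k poly \<Rightarrow> complex" where
  "chi h = \<psi> (lam h)"

lemma chi_mult: "g \<in> M m \<Longrightarrow> h \<in> M n \<Longrightarrow> chi (g * h) = chi g * chi h"
  using lam_rat[of g] lam_rat[of h]
  by (auto simp: chi_def M_def lam_mult psi_add mem_gf1)

text \<open>The coefficients of the L-function \<Sum> a_d X^d.\<close>

definition a :: "nat \<Rightarrow> complex" where
  "a d = (\<Sum>h\<in>M d. chi h)"

lemma M_0: "M 0 = {1}"
proof -
  have "h = 1" if "h \<in> M 0" for h
    using that by (auto simp: M_def elim!: degree_eq_zeroE)
  moreover have "1 \<in> M 0"
    using gf_closed(1,2)[of 1] by (auto simp: M_def rat_poly_def coeff_1)
  ultimately show ?thesis
    by blast
qed

lemma a_0: "a 0 = 1"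
  by (simp add: a_def M_0 chi_def lam_1 psi_0)

lemma finite_M: "finite (M d)"
proof -
  have "M d \<subseteq> Poly ` {xs. set xs \<subseteq> gf 1 \<and> length xs = Suc d}"
  proof
    fix h assume h: "h \<in> M d"
    have nz: "h \<noteq> 0"
      using h by (auto simp: M_def)
    have "set (coeffs h) \<subseteq> gf 1"
      using h by (auto simp: M_def rat_poly_def coeffs_def)
    moreover have "length (coeffs h) = Suc d"
      using h nz by (auto simp: M_def length_coeffs)
    ultimately show "h \<in> Poly ` {xs. set xs \<subseteq> gf 1 \<and> length xs = Suc d}"
      by (intro image_eqI[of _ _ "coeffs h"]) auto
  qed
  moreover have "finite {xs. set xs \<subseteq> gf 1 \<and> length xs = Suc d}"
    using finite_gf[of 1] by (intro finite_lists_length_eq) auto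
  ultimately show ?thesis
    by (meson finite_imageI finite_subset)
qed

lemma rat_poly_add: "g \<in> rat_poly \<Longrightarrow> h \<in> rat_poly \<Longrightarrow> g + h \<in> rat_poly"
  by (auto simp: rat_poly_def intro!: gf_closed simp del: One_nat_def)

lemma rat_poly_monom: "c \<in> gf 1 \<Longrightarrow> monom c n \<in> rat_poly"
  by (auto simp: rat_poly_def intro: gf_closed simp del: One_nat_def)

lemma M_shift:
  assumes "h \<in> M d" "e \<in> gf 1" "d \<ge> 6"
  shows "h + monom e (d - 3) \<in> M d" "lam (h + monom e (d - 3)) = lam h - 3 * u * e"
proof -
  let ?h = "h + monom e (d - 3)"
  have h: "h \<in> rat_poly" "degree h = d" "coeff h d = 1" "coeff h 0 \<noteq> 0"
    using assms(1) by (auto simp: M_def)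
  have deg: "degree ?h = d"
    using h assms(3) degree_monom_le[of e "d - 3"] by (subst degree_add_eq_left) auto
  show "?h \<in> M d"
    using h assms(2,3) deg by (auto simp: M_def rat_poly_add rat_poly_monom simp del: One_nat_def)
  have r: "coeff (reflect_poly ?h) i = coeff (reflect_poly h) i + (if i = 3 then e else 0)" if "i \<le> 3" for i
    using that assms(3) h(2) deg by (auto simp: coeff_reflect_poly)
  have l: "coeff ?h i = coeff h i" if "i \<le> 2" for i
    using that assms(3) by auto
  show "lam ?h = lam h - 3 * u * e"
  proof -
    have rs: "coeff (reflect_poly ?h) 1 = coeff (reflect_poly h) 1"
      "coeff (reflect_poly ?h) 2 = coeff (reflect_poly h) 2"
      "coeff (reflect_poly ?h) 3 = coeff (reflect_poly h) 3 + e"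
      using r[of 1] r[of 2] r[of 3] by simp_all
    have ls: "coeff ?h 0 = coeff h 0" "coeff ?h 1 = coeff h 1" "coeff ?h 2 = coeff h 2"
      using l[of 0] l[of 1] l[of 2] by simp_all
    show ?thesis
      unfolding lam_def Let_def rs ls by (simp add: algebra_simps)
  qed
qed

text \<open>Adding e X^(d-3) permutes \<open>M d\<close> and shifts \<open>lam\<close> by -3 u e,
  which is made equal to some \<open>c\<close> with \<psi>(c) \<noteq> 1; the sum is then multiplied
  by \<psi>(c). The condition d - 3 \<ge> 3 keeps the shift away from the coefficients 0, 1, 2 that
  enter the inverse squares.\<close>

lemma a_eq_0:
  assumes "d \<ge> 6"
  shows "a d = 0"
proof -
  obtain c where c: "c \<in> gf 1" "\<psi> c \<noteq> 1"
    using psi_nontrivial by (auto simp: mem_gf1)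
  have three: "(3 :: 'k) \<noteq> 0"
  proof
    assume "(3 :: 'k) = 0"
    hence "of_nat 3 = (0 :: 'k)"
      by simp
    hence "p dvd 3"
      by (simp only: of_nat_eq_0_iff_char_dvd CHAR_p)
    thus False
      using p_gt_3 by (auto dest: dvd_imp_le)
  qed
  have "(3 :: 'k) \<in> gf 1"
    using of_nat_pow_p[of 3] by (simp add: mem_gf1)
  moreover have "u \<in> gf 1"
    using u_rat by (simp add: mem_gf1)
  ultimately have e: "- (c * inverse (3 * u)) \<in> gf 1"
    using c by (intro gf_closed)
  define e where "e = - (c * inverse (3 * u))"
  have e1: "e \<in> gf 1" "- e \<in> gf 1"
    using e gf_closed(7)[OF e] by (simp_all add: e_def)
  have ec: "- (3 * u * e) = c"
    using three u_nz by (simp add: e_def)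
  have chi: "chi (h + monom e (d - 3)) = \<psi> c * chi h" if "h \<in> M d" for h
  proof -
    have "lam (h + monom e (d - 3)) = - (3 * u * e) + lam h"
      using M_shift(2)[OF that e1(1) assms] by simp
    hence "lam (h + monom e (d - 3)) = c + lam h"
      by (simp only: ec)
    thus ?thesis
      using that c(1) lam_rat[of h] by (simp add: chi_def psi_add M_def mem_gf1)
  qed
  have "a d = (\<Sum>h\<in>M d. chi (h + monom e (d - 3)))"
    unfolding a_def
  proof (rule sum.reindex_bij_witness[of _ "\<lambda>h. h + monom e (d - 3)" "\<lambda>h. h + monom (- e) (d - 3)"])
    fix h assume "h \<in> M d"
    thus "h + monom e (d - 3) \<in> M d" "h + monom (- e) (d - 3) \<in> M d"
      using M_shift(1) e1 assms by blast+
  qed (simp_all add: add_monom add.assoc)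
  also have "\<dots> = \<psi> c * a d"
    unfolding a_def sum_distrib_left by (intro sum.cong refl chi)
  finally show ?thesis
    using c(2) by (simp add: algebra_simps)
qed

text \<open>For \<open>t\<close> in \<open>gf j\<close>, the characteristic polynomial of
  \<open>t\<close> over the prime field.\<close>

definition N :: "nat \<Rightarrow> 'k \<Rightarrow> 'k poly" where
  "N j t = (\<Prod>i<j. [:-(t ^ p ^ i), 1:])"

lemma N_rat: "t \<in> gf j \<Longrightarrow> N j t \<in> rat_poly"
proof -
  assume t: "t \<in> gf j"
  have "frob (N j t) = (\<Prod>i<j. [:-(t ^ p ^ Suc i), 1:])"
    by (simp add: N_def frob_prod frob_linear power_mult[symmetric] mult.commute)
  also have "\<dots> = (\<Prod>i\<in>{1..<Suc j}. [:-(t ^ p ^ i), 1:])"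
    by (rule prod.reindex_bij_witness[of _ "\<lambda>i. i - 1" Suc]) auto
  also have "\<dots> = N j t"
  proof (cases "j = 0")
    case False
    hence "{1..<Suc j} = insert j {1..<j}" "{..<j} = insert 0 {1..<j}"
      by auto
    thus ?thesis
      using t unfolding N_def by (simp add: gf_def)
  qed (simp add: N_def)
  finally show ?thesis
    by (simp add: rat_poly_frob)
qed

lemma degree_N: "degree (N j t) = j"
  unfolding N_def by (subst degree_prod_eq_sum_degree) auto

lemma lead_coeff_N: "lead_coeff (N j t) = 1"
  unfolding N_def by (simp add: lead_coeff_prod)

lemma N_nonzero: "N j t \<noteq> 0"
  using lead_coeff_N[of j t] by auto

lemma N_in_M:
  assumes "t \<in> gf j" "t \<noteq> 0"
  shows "N j t \<in> M j"
proof -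
  have "poly (N j t) 0 \<noteq> 0"
    using assms(2) by (simp add: N_def poly_prod prod_zero_iff)
  thus ?thesis
    using N_rat[OF assms(1)] lead_coeff_N degree_N by (simp add: M_def poly_0_coeff_0)
qed

lemma chi_N:
  assumes "t \<in> gf j" "t \<noteq> 0"
  shows "chi (N j t) = \<psi> (tr j (f t))"
proof -
  have "lam (N j t) = (\<Sum>i<j. f (t ^ p ^ i))"
    unfolding N_def using assms(2) by (subst lam_prod) (auto simp: lam_linear)
  also have "\<dots> = tr j (f t)"
    unfolding tr_def
  proof (intro sum.cong refl)
    fix i
    have uv: "u ^ p ^ i = u" "v ^ p ^ i = v"
      using gf1_frob[of u i] gf1_frob[of v i] u_rat v_rat by (simp_all add: mem_gf1)
    show "f (t ^ p ^ i) = f t ^ p ^ i"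
      unfolding f_def freshman power_mult_distrib uv
      by (simp add: power_int_minus power_inverse power_mult[symmetric] mult.commute)
  qed
  finally show ?thesis
    by (simp add: chi_def)
qed

text \<open>All conjugates of a root are roots, so two iterates of Frobenius agree at
  \<open>t\<close>; injectivity cancels the smaller one.\<close>

lemma gf_root:
  assumes "h \<in> rat_poly" "h \<noteq> 0" "poly h t = 0"
  shows "\<exists>m>0. t \<in> gf m"
proof -
  have "(\<lambda>i. t ^ p ^ i) ` UNIV \<subseteq> {x. poly h x = 0}"
  proof safe
    fix i
    have "order t h > 0"
      using assms by (simp add: order_gt_0_iff)
    hence "order (t ^ p ^ i) h > 0"
      using order_frob_iter_le[OF assms(1,2), of t i] by linarith
    thus "poly h (t ^ p ^ i) = 0"
      using assms by (simp add: order_gt_0_iff)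
  qed
  hence "finite ((\<lambda>i. t ^ p ^ i) ` UNIV)"
    using poly_roots_finite[OF assms(2)] finite_subset by blast
  hence "\<not> inj (\<lambda>i. t ^ p ^ i)"
    using finite_imageD infinite_UNIV_nat by blast
  then obtain i j where ij: "i < j" "t ^ p ^ i = t ^ p ^ j"
    unfolding inj_on_def by (metis linorder_neqE_nat)
  have "t ^ p ^ j = (t ^ p ^ (j - i)) ^ p ^ i"
    using ij(1) by (simp add: power_mult[symmetric] power_add[symmetric])
  with ij(2) have "(t ^ p ^ (j - i)) ^ p ^ i = t ^ p ^ i"
    by simp
  hence "t ^ p ^ (j - i) = t"
    by (rule frob_iter_inj)
  thus ?thesis
    using ij(1) by (intro exI[of _ "j - i"]) (auto simp: gf_def)
qed

text \<open>
  With \<open>m\<close> the degree of \<open>t\<close> over the prime field, \<open>N j t\<close> is the minimal polynomial of \<open>t\<close> to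
  the power \<open>j / m\<close>; so the \<open>j\<close> with \<open>N j t\<close> dividing \<open>h\<close> count the multiplicity of \<open>t\<close> in \<open>h\<close>.
\<close>

lemma card_N_dvd:
  assumes h: "h \<in> rat_poly" "h \<noteq> 0" and t: "poly h t = 0"
  shows "card {j \<in> {1..degree h}. t \<in> gf j \<and> N j t dvd h} = order t h"
proof -
  define m where "m = (LEAST m. m > 0 \<and> t \<in> gf m)"
  have m: "m > 0" "t \<in> gf m"
  proof -
    obtain m0 where "m0 > 0 \<and> t \<in> gf m0"
      using gf_root[OF assms] by blast
    from LeastI[of "\<lambda>m. m > 0 \<and> t \<in> gf m", OF this] show "m > 0" "t \<in> gf m"
      unfolding m_def by blast+
  qed
  have m_least: "m \<le> j" if "j > 0" "t \<in> gf j" for j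
    unfolding m_def using that by (intro Least_le) auto
  have per: "t ^ p ^ (i + m * k) = t ^ p ^ i" for i k
  proof (induction k)
    case (Suc k)
    have "t ^ p ^ (i + m * Suc k) = (t ^ p ^ m) ^ p ^ (i + m * k)"
      by (simp add: power_add power_mult[symmetric] mult_ac)
    thus ?case
      using Suc m(2) by (simp add: gf_def)
  qed simp
  have gf_iff: "t \<in> gf j \<longleftrightarrow> m dvd j" for j
  proof
    assume "m dvd j"
    then obtain k where "j = m * k"
      by (elim dvdE)
    thus "t \<in> gf j"
      using per[of 0 k] by (simp add: gf_def)
  next
    assume j: "t \<in> gf j"
    have "t ^ p ^ (j mod m) = t ^ p ^ (j mod m + m * (j div m))"
      by (rule per[symmetric])
    also have "j mod m + m * (j div m) = j"
      by simp
    finally have "t \<in> gf (j mod m)"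
      using j by (simp add: gf_def)
    hence "j mod m = 0"
      using m_least[of "j mod m"] mod_less_divisor[OF m(1), of j] by (cases "j mod m = 0") auto
    thus "m dvd j"
      by auto
  qed
  have inj: "inj_on (\<lambda>i. t ^ p ^ i) {..<m}"
  proof (rule linorder_inj_onI)
    fix i j assume ij: "i < j" "j \<in> {..<m}"
    show "t ^ p ^ i \<noteq> t ^ p ^ j"
    proof
      assume eq: "t ^ p ^ i = t ^ p ^ j"
      have "t ^ p ^ j = (t ^ p ^ (j - i)) ^ p ^ i"
        using ij(1) by (simp add: power_mult[symmetric] power_add[symmetric])
      with eq have "(t ^ p ^ (j - i)) ^ p ^ i = t ^ p ^ i"
        by simp
      hence "t ^ p ^ (j - i) = t"
        by (rule frob_iter_inj)
      hence "m \<le> j - i"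
        using ij by (intro m_least) (auto simp: gf_def)
      thus False
        using ij by simp
    qed
  qed auto
  define A where "A = (\<lambda>i. t ^ p ^ i) ` {..<m}"
  have tA: "t \<in> A"
    unfolding A_def using m(1) by (intro image_eqI[of _ _ 0]) auto
  have N_m: "N m t = (\<Prod>a\<in>A. [:-a, 1:])"
    unfolding N_def A_def by (subst prod.reindex[OF inj]) simp
  have N_mk: "N (m * k) t = N m t ^ k" for k
  proof (induction k)
    case (Suc k)
    have "N (m * Suc k) t = N (m * k) t * (\<Prod>i\<in>{m * k..<m * k + m}. [:-(t ^ p ^ i), 1:])"
      unfolding N_def lessThan_atLeast0
      by (subst prod.atLeastLessThan_concat) (auto simp: add.commute)
    also have "(\<Prod>i\<in>{m * k..<m * k + m}. [:-(t ^ p ^ i), 1:]) = (\<Prod>i<m. [:-(t ^ p ^ (i + m * k)), 1:])"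
      by (rule prod.reindex_bij_witness[of _ "\<lambda>i. i + m * k" "\<lambda>i. i - m * k"]) auto
    also have "\<dots> = N m t"
      by (simp add: per N_def)
    finally show ?case
      using Suc by (simp add: mult.commute)
  qed (simp add: N_def)
  have ord_N: "order t (N m t) = 1"
  proof -
    have "finite A"
      by (simp add: A_def)
    from this tA have "N m t = [:-t, 1:] * (\<Prod>a\<in>A - {t}. [:-a, 1:])"
      unfolding N_m by (rule prod.remove)
    moreover have "order t (\<Prod>a\<in>A - {t}. [:-a, 1:]) = 0"
      using \<open>finite A\<close> by (intro order_0I) (simp add: poly_prod prod_zero_iff)
    moreover have "order t [:-t, 1:] = 1"
      using order_power_n_n[of t 1] by simp
    moreover have "order t (N m t) = order t [:-t, 1:] + order t (\<Prod>a\<in>A - {t}. [:-a, 1:])"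
      using N_nonzero[of m t] unfolding calculation(1) by (rule order_mult)
    ultimately show ?thesis
      by linarith
  qed
  have ord_Nk: "order t (N m t ^ k) = k" for k
  proof (induction k)
    case (Suc k)
    have "N m t * N m t ^ k \<noteq> 0"
      using N_nonzero by simp
    thus ?case
      using Suc ord_N by (simp add: order_mult)
  qed simp
  have dvd_iff: "N (m * k) t dvd h \<longleftrightarrow> k \<le> order t h" for k
  proof
    assume "N (m * k) t dvd h"
    from dvd_imp_order_le[OF h(2) this, of t] show "k \<le> order t h"
      by (simp add: N_mk ord_Nk)
  next
    assume k: "k \<le> order t h"
    have "k \<le> order b h" if b: "b \<in> A" for b
    proof -
      obtain i where "b = t ^ p ^ i"
        using b unfolding A_def image_iff by blast
      thus ?thesis
        using order_frob_iter_le[OF h, of t i] k by simp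
    qed
    thus "N (m * k) t dvd h"
      unfolding N_mk N_m using h(2) by (intro prod_linear_power_dvd) (auto simp: A_def)
  qed
  have "{j \<in> {1..degree h}. t \<in> gf j \<and> N j t dvd h} = (\<lambda>k. m * k) ` {1..order t h}"
  proof (intro equalityI subsetI)
    fix j assume "j \<in> {j \<in> {1..degree h}. t \<in> gf j \<and> N j t dvd h}"
    hence j: "1 \<le> j" "m dvd j" "N j t dvd h"
      by (auto simp: gf_iff)
    obtain k where k: "j = m * k"
      using j(2) by (elim dvdE)
    have "k \<le> order t h" "k \<ge> 1"
      using j k dvd_iff by auto
    thus "j \<in> (\<lambda>k. m * k) ` {1..order t h}"
      using k by auto
  next
    fix j assume "j \<in> (\<lambda>k. m * k) ` {1..order t h}"
    then obtain k where "j = m * k" "k \<in> {1..order t h}"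
      by (elim imageE) blast
    hence k: "j = m * k" "1 \<le> k" "k \<le> order t h"
      by auto
    have d: "N j t dvd h"
      using k dvd_iff by simp
    hence "j \<le> degree h"
      using dvd_imp_degree_le[OF d h(2)] by (simp add: degree_N)
    thus "j \<in> {j \<in> {1..degree h}. t \<in> gf j \<and> N j t dvd h}"
      using k d m(1) by (auto simp: gf_iff)
  qed
  moreover have "inj_on (\<lambda>k. m * k) {1..order t h}"
    using m(1) by (auto simp: inj_on_def)
  ultimately show ?thesis
    by (simp add: card_image)
qed

lemma quotient_in_M:
  assumes "g \<in> M j" "h \<in> M n" "h = g * k"
  shows "k \<in> M (n - j)"
proof -
  have g: "frob g = g" "g \<noteq> 0" "degree g = j" "lead_coeff g = 1" "coeff g 0 \<noteq> 0"
    using assms(1) by (auto simp: M_def rat_poly_frob)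
  have h: "frob h = h" "h \<noteq> 0" "degree h = n" "lead_coeff h = 1" "coeff h 0 \<noteq> 0"
    using assms(2) by (auto simp: M_def rat_poly_frob)
  have "g * frob k = g * k"
    using g(1) h(1) unfolding assms(3) by (simp add: frob_mult)
  hence "frob k = k"
    using g(2) by simp
  moreover have "k \<noteq> 0"
    using h(2) assms(3) by auto
  hence "n = j + degree k"
    using g h(3) assms(3) by (simp add: degree_mult_eq)
  moreover have "lead_coeff k = 1"
    using g(4) h(4) unfolding assms(3) lead_coeff_mult by simp
  moreover have "coeff k 0 \<noteq> 0"
    using h(5) unfolding assms(3) by (auto simp: coeff_mult)
  ultimately show ?thesis
    by (simp add: M_def rat_poly_frob)
qed

lemma mult_in_M:
  assumes "g \<in> M j" "k \<in> M n"
  shows "g * k \<in> M (j + n)"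
proof -
  have g: "frob g = g" "degree g = j" "lead_coeff g = 1" "coeff g 0 \<noteq> 0"
    and k: "frob k = k" "degree k = n" "lead_coeff k = 1" "coeff k 0 \<noteq> 0"
    using assms by (auto simp: M_def rat_poly_frob)
  have "g \<noteq> 0" "k \<noteq> 0"
    using g(4) k(4) by auto
  hence "degree (g * k) = j + n"
    using g(2) k(2) by (simp add: degree_mult_eq)
  moreover have "lead_coeff (g * k) = 1"
    using g(3) k(3) by (simp only: lead_coeff_mult mult_1)
  moreover have "coeff (g * k) 0 \<noteq> 0"
    using g(4) k(4) by (simp add: coeff_mult)
  ultimately show ?thesis
    using g(1) k(1) by (simp add: M_def rat_poly_frob frob_mult)
qed

text \<open>The coefficient form of X L' = L \<Sum> S_j X^j. By multiplicativity, S_j a_(n-j) runs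
  over the factorisations h = N_j(t) k, and each \<open>h\<close> of degree \<open>n\<close> comes
  from exactly \<open>n\<close> pairs (j, t).\<close>

lemma newton_identity:
  assumes "n \<ge> 1"
  shows "of_nat n * a n = (\<Sum>j=1..n. S j * a (n - j))"
proof -
  have 1: "S j * a (n - j) = (\<Sum>h\<in>M n. of_nat (card {t\<in>gf j - {0}. N j t dvd h}) * chi h)"
    if j: "j \<in> {1..n}" for j
  proof -
    have finj: "finite (gf j)"
      using j by (intro finite_gf) auto
    have "S j * a (n - j) = (\<Sum>t\<in>gf j - {0}. chi (N j t)) * (\<Sum>k\<in>M (n - j). chi k)"
      by (simp add: S_def a_def chi_N)
    also have "\<dots> = (\<Sum>t\<in>gf j - {0}. \<Sum>k\<in>M (n - j). chi (N j t * k))"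
      unfolding sum_product
    proof (intro sum.cong refl)
      fix t k assume "t \<in> gf j - {0}" "k \<in> M (n - j)"
      thus "chi (N j t) * chi k = chi (N j t * k)"
        using chi_mult[OF N_in_M] by simp
    qed
    also have "\<dots> = (\<Sum>t\<in>gf j - {0}. \<Sum>h\<in>{h\<in>M n. N j t dvd h}. chi h)"
    proof (rule sum.cong[OF refl])
      fix t assume t: "t \<in> gf j - {0}"
      hence NM: "N j t \<in> M j"
        by (intro N_in_M) auto
      show "(\<Sum>k\<in>M (n - j). chi (N j t * k)) = (\<Sum>h\<in>{h\<in>M n. N j t dvd h}. chi h)"
      proof (rule sum.reindex_bij_witness[of _ "\<lambda>h. h div N j t" "\<lambda>k. N j t * k"])
        fix k assume "k \<in> M (n - j)"
        thus "N j t * k div N j t = k" "N j t * k \<in> {h\<in>M n. N j t dvd h}"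
          using mult_in_M[OF NM, of k "n - j"] j N_nonzero by auto
      next
        fix h assume h: "h \<in> {h\<in>M n. N j t dvd h}"
        hence eq: "h = N j t * (h div N j t)" and hM: "h \<in> M n"
          by simp_all
        show "h div N j t \<in> M (n - j)"
          by (rule quotient_in_M[OF NM hM eq])
        show "N j t * (h div N j t) = h"
          using h by simp
      qed auto
    qed
    also have "\<dots> = (\<Sum>t\<in>gf j - {0}. \<Sum>h\<in>M n. if N j t dvd h then chi h else 0)"
      by (simp add: sum.inter_filter finite_M)
    also have "\<dots> = (\<Sum>h\<in>M n. \<Sum>t\<in>gf j - {0}. if N j t dvd h then chi h else 0)"
      by (rule sum.swap)
    also have "\<dots> = (\<Sum>h\<in>M n. of_nat (card {t\<in>gf j - {0}. N j t dvd h}) * chi h)"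
      using finj by (simp add: sum.inter_filter[symmetric])
    finally show ?thesis .
  qed
  \<comment> \<open>For a fixed root \<open>t\<close> the admissible \<open>j\<close> number the
    multiplicity of \<open>t\<close>, and the multiplicities add up to the degree.\<close>
  have 2: "(\<Sum>j=1..n. card {t\<in>gf j - {0}. N j t dvd h}) = n" if h: "h \<in> M n" for h
  proof -
    have h': "h \<in> rat_poly" "h \<noteq> 0" "degree h = n" "coeff h 0 \<noteq> 0"
      using h by (auto simp: M_def)
    define R where "R = {t. poly h t = 0}"
    have finR: "finite R"
      unfolding R_def by (rule poly_roots_finite[OF h'(2)])
    have eq: "{t\<in>gf j - {0}. N j t dvd h} = {t\<in>R. t \<in> gf j \<and> N j t dvd h}" if "j \<in> {1..n}" for j
    proof -
      have "poly h t = 0" if "N j t dvd h" for t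
      proof -
        have "poly (N j t) t = 0"
          using \<open>j \<in> {1..n}\<close> by (auto simp: N_def poly_prod prod_zero_iff intro!: bexI[of _ 0])
        thus ?thesis
          using that by (auto elim!: dvdE)
      qed
      moreover have "t \<noteq> 0" if "poly h t = 0" for t
        using that h'(4) by (auto simp: poly_0_coeff_0)
      ultimately show ?thesis
        unfolding R_def by blast
    qed
    have "(\<Sum>j=1..n. card {t\<in>gf j - {0}. N j t dvd h}) =
      (\<Sum>j=1..n. \<Sum>t\<in>R. if t \<in> gf j \<and> N j t dvd h then 1 else 0)"
      using finR eq by (intro sum.cong refl) (simp add: sum.inter_filter[symmetric])
    also have "\<dots> = (\<Sum>t\<in>R. \<Sum>j=1..n. if t \<in> gf j \<and> N j t dvd h then 1 else 0)"
      by (rule sum.swap)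
    also have "\<dots> = (\<Sum>t\<in>R. card {j\<in>{1..n}. t \<in> gf j \<and> N j t dvd h})"
      by (simp add: sum.inter_filter[symmetric])
    also have "\<dots> = (\<Sum>t\<in>R. order t h)"
      using card_N_dvd[OF h'(1,2)] h'(3) by (intro sum.cong) (auto simp: R_def)
    also have "\<dots> = n"
      unfolding R_def using sum_order_eq_degree[OF h'(2)] h'(3) by simp
    finally show ?thesis .
  qed
  have "(\<Sum>j=1..n. S j * a (n - j)) =
     (\<Sum>j=1..n. \<Sum>h\<in>M n. of_nat (card {t\<in>gf j - {0}. N j t dvd h}) * chi h)"
    by (intro sum.cong refl 1)
  also have "\<dots> = (\<Sum>h\<in>M n. of_nat (\<Sum>j=1..n. card {t\<in>gf j - {0}. N j t dvd h}) * chi h)"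
    by (subst sum.swap) (simp add: sum_distrib_right)
  also have "\<dots> = (\<Sum>h\<in>M n. of_nat n * chi h)"
    by (intro sum.cong refl) (simp only: 2)
  finally show ?thesis
    by (simp add: a_def sum_distrib_left)
qed

text \<open>The L-function is a polynomial with constant term 1, hence a product of factors 1 - z X.
  Its logarithmic derivative, computed from this product and from \<open>newton_identity\<close>,
  identifies the sums with negated power sums.\<close>

lemma S_power_sums:
  obtains A :: "complex multiset" where "size A = 5" "\<And>n. n \<ge> 1 \<Longrightarrow> S n = - (\<Sum>z\<in>#A. z ^ n)"
proof -
  \<comment> \<open>The reversed L-polynomial. It is monic of degree 5 because
    \<open>a 0 = 1\<close>; should L have smaller degree, some of the five numbers are 0.\<close>
  define B where "B = (\<Sum>d\<le>5. monom (a d) (5 - d))"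
  have coeffB: "coeff B i = (if i \<le> 5 then a (5 - i) else 0)" for i
  proof -
    have "coeff B i = (\<Sum>d\<le>5. if d = 5 - i \<and> i \<le> 5 then a d else 0)"
      unfolding B_def coeff_sum coeff_monom by (intro sum.cong) auto
    also have "\<dots> = (if i \<le> 5 then a (5 - i) else 0)"
      by auto
    finally show ?thesis .
  qed
  have degB: "degree B = 5"
    using coeffB[of 5] a_0 by (intro antisym degree_le le_degree) (auto simp: coeffB)
  have nzB: "B \<noteq> 0"
    using degB by auto
  obtain A where A: "size A = degree B" "B = smult (lead_coeff B) (\<Prod>z\<in>#A. [:-z, 1:])"
    using alg_closed_imp_factorization[OF nzB] by blast
  have B_prod: "B = (\<Prod>z\<in>#A. [:-z, 1:])"
    using A(2) by (simp add: degB coeffB a_0)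
  define P where "P = (\<lambda>A. Abs_fps (\<lambda>n. if n = 0 then 0 else (\<Sum>z\<in>#A. z ^ n :: complex)))"
  define E where "E = (\<lambda>A. \<Prod>z\<in>#A. (1 - fps_const z * fps_X :: complex fps))"
  have E_deriv: "fps_X * fps_deriv (E A) = - (E A * P A)" for A
  proof (induction A)
    case empty
    show ?case
      by (auto simp: E_def P_def fps_eq_iff)
  next
    case (add z A)
    have geo: "(1 - fps_const z * fps_X) * P {#z#} = fps_const z * fps_X"
    proof (rule fps_ext)
      fix n
      show "((1 - fps_const z * fps_X) * P {#z#}) $ n = (fps_const z * fps_X) $ n"
        by (cases n; cases "n - 1") (auto simp: P_def left_diff_distrib mult.assoc fps_X_mult_nth)
    qed
    have Padd: "P (add_mset z A) = P {#z#} + P A"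
      by (auto simp: P_def fps_eq_iff)
    have Eadd: "E (add_mset z A) = (1 - fps_const z * fps_X) * E A"
      by (simp add: E_def)
    have "fps_X * fps_deriv (E (add_mset z A)) =
       - (fps_const z * fps_X * E A) + (1 - fps_const z * fps_X) * (fps_X * fps_deriv (E A))"
      unfolding Eadd by (simp add: algebra_simps)
    also have "\<dots> = - ((1 - fps_const z * fps_X) * P {#z#} * E A + (1 - fps_const z * fps_X) * (E A * P A))"
      unfolding add.IH geo by simp
    also have "\<dots> = - (E (add_mset z A) * P (add_mset z A))"
      unfolding Eadd Padd by (simp add: algebra_simps)
    finally show ?case .
  qed
  have E_a: "E A = Abs_fps a"
  proof (rule fps_ext)
    fix n
    have "fps_of_poly (reflect_poly (\<Prod>z\<in>#A. [:-z, 1:])) = E A"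
    proof (induction A)
      case (add z A)
      have "fps_of_poly (reflect_poly [:-z, 1:]) = 1 - fps_const z * fps_X"
        by (rule fps_ext) (auto simp: reflect_poly_def coeff_pCons fps_X_def split: nat.splits)
      thus ?case
        using add by (simp add: E_def reflect_poly_mult fps_of_poly_mult del: mult_pCons_left)
    qed (simp add: E_def)
    hence "E A $ n = coeff (reflect_poly B) n"
      by (simp add: B_prod flip: fps_of_poly_nth)
    also have "\<dots> = a n"
      using a_eq_0[of n] by (auto simp: coeff_reflect_poly degB coeffB)
    finally show "E A $ n = Abs_fps a $ n"
      by simp
  qed
  define T where "T = Abs_fps (\<lambda>n. if n = 0 then 0 else S n)"
  have "fps_X * fps_deriv (E A) = T * E A"
  proof (rule fps_ext)
    fix n
    show "(fps_X * fps_deriv (E A)) $ n = (T * E A) $ n"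
    proof (cases "n = 0")
      case False
      have "(T * E A) $ n = (\<Sum>j=0..n. T $ j * a (n - j))"
        by (simp add: fps_mult_nth E_a)
      also have "\<dots> = (\<Sum>j=1..n. S j * a (n - j))"
        by (subst sum.atLeast_Suc_atMost) (auto simp: T_def intro!: sum.cong)
      also have "\<dots> = of_nat n * a n"
        using False by (subst newton_identity) auto
      finally show ?thesis
        using False by (cases n) (auto simp: E_a)
    qed (auto simp: T_def fps_mult_nth)
  qed
  hence "T * E A = - (E A * P A)"
    by (simp add: E_deriv)
  hence "E A * (T + P A) = 0"
    by (simp add: distrib_left mult.commute[of "E A" T])
  moreover have "E A $ 0 = 1"
    by (simp add: E_a a_0)
  hence "E A \<noteq> 0"
    by auto
  ultimately have TP: "T + P A = 0"
    by simp
  have "S n = - (\<Sum>z\<in>#A. z ^ n)" if "n \<ge> 1" for n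
  proof -
    have "(T + P A) $ n = 0"
      unfolding TP by simp
    thus ?thesis
      using that by (simp add: T_def P_def eq_neg_iff_add_eq_0)
  qed
  with A(1) degB show ?thesis
    using that by metis
qed

end

text \<open>Replacing s_n by s_(n+1) - z s_n removes the term of \<open>z\<close>, multiplies the
  other coefficients by nonzero factors and preserves boundedness. Iteration leaves a bounded
  geometric sequence in \<open>w\<close> alone.\<close>

lemma bounded_power_sums:
  fixes c :: "complex \<Rightarrow> complex"
  assumes "finite Z" "\<And>z. z \<in> Z \<Longrightarrow> c z \<noteq> 0" "\<And>n. n \<ge> n0 \<Longrightarrow> norm (\<Sum>z\<in>Z. c z * z ^ n) \<le> C" "w \<in> Z"
  shows "norm w \<le> 1"
  using assms
proof (induction "card Z" arbitrary: Z c C)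
  case 0
  thus ?case
    by simp
next
  case (Suc k)
  show ?case
  proof (cases "Z = {w}")
    case True
    have "norm (c w) * norm w ^ n \<le> C" if "n \<ge> n0" for n
      using Suc.prems(3)[OF that] by (simp add: True norm_mult norm_power)
    moreover have "norm (c w) > 0"
      using Suc.prems(2,4) by simp
    ultimately have bd: "norm w ^ n \<le> C / norm (c w)" if "n \<ge> n0" for n
      using that by (simp add: field_simps)
    show ?thesis
    proof (rule ccontr)
      assume "\<not> norm w \<le> 1"
      then obtain n where n: "C / norm (c w) < norm w ^ n"
        using real_arch_pow[of "norm w"] by auto
      also have "norm w ^ n \<le> norm w ^ (n + n0)"
        using \<open>\<not> norm w \<le> 1\<close> by (intro power_increasing) auto
      also have "\<dots> \<le> C / norm (c w)"
        by (rule bd) simp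
      finally show False
        by simp
    qed
  next
    case False
    then obtain z where z: "z \<in> Z" "z \<noteq> w"
      using Suc.prems(4) by blast
    define d where "d = (\<lambda>x. c x * (x - z))"
    show ?thesis
    proof (rule Suc.hyps(1)[of "Z - {z}" d "C + norm z * C"])
      show "k = card (Z - {z})"
        using Suc.hyps(2) Suc.prems(1) z(1) by simp
      show "finite (Z - {z})"
        using Suc.prems(1) by simp
      show "d x \<noteq> 0" if "x \<in> Z - {z}" for x
        using that Suc.prems(2) by (auto simp: d_def)
      show "w \<in> Z - {z}"
        using z Suc.prems(4) by blast
      fix n assume n: "n \<ge> n0"
      have "(\<Sum>x\<in>Z - {z}. d x * x ^ n) = (\<Sum>x\<in>Z. d x * x ^ n)"
        using Suc.prems(1) by (intro sum.mono_neutral_left) (auto simp: d_def)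
      also have "\<dots> = (\<Sum>x\<in>Z. c x * x ^ Suc n) - z * (\<Sum>x\<in>Z. c x * x ^ n)"
        by (simp add: d_def sum_distrib_left sum_subtractf algebra_simps)
      also have "norm \<dots> \<le> norm (\<Sum>x\<in>Z. c x * x ^ Suc n) + norm (z * (\<Sum>x\<in>Z. c x * x ^ n))"
        by (rule norm_triangle_ineq4)
      also have "\<dots> \<le> C + norm z * C"
      proof -
        have "norm (\<Sum>x\<in>Z. c x * x ^ Suc n) \<le> C"
          by (rule Suc.prems(3)) (use n in simp)
        moreover have "norm z * norm (\<Sum>x\<in>Z. c x * x ^ n) \<le> norm z * C"
          by (intro mult_left_mono Suc.prems(3) n) simp
        ultimately show ?thesis
          unfolding norm_mult by (rule add_mono)
      qed
      finally show "norm (\<Sum>x\<in>Z - {z}. d x * x ^ n) \<le> C + norm z * C" .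
    qed
  qed
qed

lemma sum_mset_conv_count:
  fixes g :: "'a \<Rightarrow> 'b :: comm_semiring_1"
  shows "(\<Sum>x\<in>#B. g x) = (\<Sum>x\<in>set_mset B. of_nat (count B x) * g x)"
proof (induction B)
  case (add y B)
  have "(\<Sum>x\<in>set_mset (add_mset y B). of_nat (count (add_mset y B) x) * g x) =
     (\<Sum>x\<in>insert y (set_mset B). of_nat (count B x) * g x + (if x = y then g x else 0))"
    by (intro sum.cong) (auto simp: algebra_simps)
  also have "\<dots> = (\<Sum>x\<in>insert y (set_mset B). of_nat (count B x) * g x) + g y"
    by (simp add: sum.distrib)
  also have "(\<Sum>x\<in>insert y (set_mset B). of_nat (count B x) * g x) = (\<Sum>x\<in>set_mset B. of_nat (count B x) * g x)"
    by (intro sum.mono_neutral_right) (auto simp: not_in_iff)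
  finally show ?case
    using add by (simp add: add.commute)
qed simp

context weil
begin

theorem weil_bound: "norm (\<Sum>t\<in>gf 1 - {0}. \<psi> (f t)) \<le> 5 * sqrt (real p)"
proof -
  obtain A where A: "size A = 5" "\<And>n. n \<ge> 1 \<Longrightarrow> S n = - (\<Sum>z\<in>#A. z ^ n)"
    by (rule S_power_sums) blast
  \<comment> \<open>The sums are bounded at even exponents 2 \<mu> and in units of p^\<mu>, which
    suggests z^2 / p. Equal values are merged with positive multiplicities, so no coefficient is
    zero.\<close>
  define B where "B = image_mset (\<lambda>z. z ^ 2 / of_nat p) A"
  have pw: "(\<Sum>z\<in>#A. z ^ (2 * \<mu>)) = of_nat p ^ \<mu> * (\<Sum>w\<in>set_mset B. of_nat (count B w) * w ^ \<mu>)" for \<mu>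
  proof -
    have "(\<Sum>w\<in>#B. w ^ \<mu>) = (\<Sum>z\<in>#A. z ^ (2 * \<mu>)) / of_nat p ^ \<mu>"
      unfolding B_def by (induction A) (auto simp: power_mult[symmetric] power_divide add_divide_distrib)
    moreover have "(\<Sum>w\<in>#B. w ^ \<mu>) = (\<Sum>w\<in>set_mset B. of_nat (count B w) * w ^ \<mu>)"
      by (rule sum_mset_conv_count)
    ultimately show ?thesis
      using p_pos by (simp add: field_simps)
  qed
  have bd: "norm w \<le> 1" if w: "w \<in> set_mset B" for w
  proof (rule bounded_power_sums[of "set_mset B" "\<lambda>w. of_nat (count B w)" "50 * p ^ 2" "21 * real p ^ 2"])
    fix \<mu> assume \<mu>: "\<mu> \<ge> 50 * p ^ 2"
    have "\<mu> < p ^ \<mu>"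
      using p_gt_3 by (intro power_gt_expt) auto
    hence "p ^ \<mu> \<ge> 50 * p ^ 2"
      using \<mu> by simp
    hence "norm (S (2 * \<mu>)) \<le> 21 * real p ^ 2 * real p ^ \<mu>"
      by (rule S_bound)
    moreover have "\<mu> > 0"
      using \<mu> p_pos by (auto intro: gr0I)
    hence "norm (S (2 * \<mu>)) = real p ^ \<mu> * norm (\<Sum>w\<in>set_mset B. of_nat (count B w) * w ^ \<mu>)"
      using A(2)[of "2 * \<mu>"] by (simp add: pw norm_mult norm_power)
    ultimately show "norm (\<Sum>w\<in>set_mset B. of_nat (count B w) * w ^ \<mu>) \<le> 21 * real p ^ 2"
      using p_pos by (simp add: field_simps)
  qed (use w in auto)
  have "norm z \<le> sqrt (real p)" if "z \<in># A" for z
  proof -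
    have "norm (z ^ 2 / of_nat p) \<le> 1"
      using that by (intro bd) (auto simp: B_def)
    hence "norm z ^ 2 \<le> real p"
      using p_pos by (simp add: norm_divide norm_power)
    thus ?thesis
      by (rule real_le_rsqrt)
  qed
  hence "(\<Sum>z\<in>#A. norm z) \<le> (\<Sum>z\<in>#A. sqrt (real p))"
    by (intro sum_mset_mono)
  also have "\<dots> = 5 * sqrt (real p)"
    using A(1) by simp
  also have "norm (\<Sum>z\<in>#A. z) \<le> (\<Sum>z\<in>#A. norm z)"
    by (induction A) (auto intro: norm_triangle_le)
  ultimately have "norm (S 1) \<le> 5 * sqrt (real p)"
    using A(2)[of 1] by simp
  thus ?thesis
    by (simp add: S_def tr_def)
qed

end

section \<open>The exponential sums\<close>

definition e_mod :: "nat \<Rightarrow> int \<Rightarrow> complex" where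
  "e_mod q n = cis (2 * pi * of_int n / of_nat q)"

text \<open>The units modulo \<open>q\<close>, each paired with its inverse, so that t^(-2) becomes
  s^2 without an inversion function.\<close>

definition inv_pairs :: "nat \<Rightarrow> (int \<times> int) set" where
  "inv_pairs q = {(t, s). t \<in> {0..<int q} \<and> s \<in> {0..<int q} \<and> [t * s = 1] (mod int q)}"

definition expo_sum :: "nat \<Rightarrow> int \<Rightarrow> int \<Rightarrow> complex" where
  "expo_sum q u v = (\<Sum>(t, s)\<in>inv_pairs q. e_mod q (u * t ^ 3 + v * s ^ 2))"

lemma e_mod_add: "e_mod q (m + n) = e_mod q m * e_mod q n"
  by (simp add: e_mod_def cis_mult add_divide_distrib ring_distribs)

lemma norm_e_mod [simp]: "norm (e_mod q n) = 1"
  by (simp add: e_mod_def)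

lemma e_mod_0 [simp]: "e_mod q 0 = 1"
  by (simp add: e_mod_def)

lemma e_mod_mult_self: "e_mod q (int q * k) = 1"
proof (cases "q = 0")
  case False
  have "e_mod q (int q * k) = cis (2 * pi * of_int k)"
    using False by (simp add: e_mod_def field_simps)
  also have "\<dots> = 1"
    by (rule cis_multiple_2pi) simp
  finally show ?thesis .
qed (simp add: e_mod_def)

lemma e_mod_cong:
  assumes "[m = n] (mod int q)"
  shows "e_mod q m = e_mod q n"
proof -
  obtain k where "m = n + int q * k"
    using assms by (metis cong_iff_lin cong_sym)
  thus ?thesis
    by (simp add: e_mod_add e_mod_mult_self)
qed

lemma cis_eq_1_imp_Ints: "cis (2 * pi * x) = 1 \<Longrightarrow> x \<in> \<int>"
proof -
  assume "cis (2 * pi * x) = 1"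
  hence "cos (2 * pi * x) = 1"
    by (metis cis.sel(1) one_complex.sel(1))
  then obtain n :: int where "2 * pi * x = of_int n * 2 * pi"
    using cos_one_2pi_int by auto
  thus ?thesis
    by simp
qed

lemma e_mod_eq_1_iff:
  assumes "q > 0"
  shows "e_mod q n = 1 \<longleftrightarrow> int q dvd n"
proof
  assume "e_mod q n = 1"
  hence "cis (2 * pi * (of_int n / of_nat q)) = 1"
    by (simp add: e_mod_def)
  hence "real_of_int n / real q \<in> \<int>"
    by (rule cis_eq_1_imp_Ints)
  then obtain k where "real_of_int n / real q = of_int k"
    by (elim Ints_cases)
  hence "real_of_int n = of_int (k * int q)"
    using assms by (simp add: field_simps)
  hence "n = k * int q"
    by (simp only: of_int_eq_iff)
  thus "int q dvd n"
    by simp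
next
  assume "int q dvd n"
  thus "e_mod q n = 1"
    by (elim dvdE) (simp add: e_mod_mult_self)
qed

lemma finite_inv_pairs [simp]: "finite (inv_pairs q)"
proof -
  have "inv_pairs q \<subseteq> {0..<int q} \<times> {0..<int q}"
    by (auto simp: inv_pairs_def)
  thus ?thesis
    by (rule finite_subset) simp
qed

text \<open>The prime field inside \<open>'k\<close> is the image of the integers, as this image
  already supplies \<open>p\<close> roots of X^p - X. On it \<open>e_mod p\<close> becomes a
  nontrivial character, to which the bound on the curve applies.\<close>

lemma weil_expo_sum_aux:
  fixes dummy :: "'k :: alg_closed_field itself"
  assumes p: "prime p" "p > 3" and char: "CHAR('k) = p" and u: "\<not> int p dvd u"
  shows "norm (expo_sum p u v) \<le> 5 * sqrt (real p)"
proof -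
  define h :: "int \<Rightarrow> 'k" where "h = of_int"
  have h_eq: "h a = h b \<longleftrightarrow> [a = b] (mod int p)" for a b
  proof -
    have 1: "h c = 0 \<longleftrightarrow> int p dvd c" for c
      by (simp add: h_def of_int_eq_0_iff_char_dvd char)
    have "h a = h b \<longleftrightarrow> h (a - b) = 0"
      by (simp add: h_def)
    also have "\<dots> \<longleftrightarrow> [a = b] (mod int p)"
      by (simp add: 1 cong_iff_dvd_diff)
    finally show ?thesis .
  qed
  have frob: "h a ^ p = h a" for a
  proof -
    have nat: "(of_nat k :: 'k) ^ p = of_nat k" for k
    proof (induction k)
      case (Suc k)
      have "(1 + of_nat k :: 'k) ^ p = 1 ^ p + of_nat k ^ p"
        by (rule freshmans_dream) (simp_all add: p char)
      thus ?case
        using Suc by simp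
    qed (use p in auto)
    have "h a = h (a mod int p)"
      unfolding h_eq by simp
    also have "\<dots> = of_nat (nat (a mod int p))"
      using p by (simp add: h_def)
    finally show ?thesis
      using nat by simp
  qed
  \<comment> \<open>An arbitrary integer preimage; two choices differ by a multiple of
    \<open>p\<close>, which \<open>e_mod p\<close> does not see.\<close>
  define g :: "'k \<Rightarrow> int" where "g = (\<lambda>x. SOME a. h a = x)"
  have gh: "[g (h a) = a] (mod int p)" for a
  proof -
    have "h (g (h a)) = h a"
      unfolding g_def by (rule someI[of _ a]) simp
    thus ?thesis
      by (simp add: h_eq)
  qed
  define \<psi> where "\<psi> = (\<lambda>x. e_mod p (g x))"
  have \<psi>h: "\<psi> (h a) = e_mod p a" for a
    unfolding \<psi>_def by (intro e_mod_cong gh)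
  have inj: "inj_on h {0..<int p}"
    by (auto simp: inj_on_def h_eq cong_def)
  have roots: "{x :: 'k. x ^ p = x} = h ` {0..<int p}"
  proof -
    let ?f = "monom 1 p + (- monom 1 1) :: 'k poly"
    have deg: "degree ?f = p"
      using p by (subst degree_add_eq_left) (auto simp: degree_monom_eq)
    have nz: "?f \<noteq> 0"
    proof
      assume "?f = 0"
      thus False
        using deg p by (simp only: degree_0)
    qed
    have eq: "{x. poly ?f x = 0} = {x. x ^ p = x}"
      by (simp add: poly_monom)
    have "h ` {0..<int p} \<subseteq> {x. x ^ p = x}"
      using frob by auto
    moreover have "finite {x :: 'k. x ^ p = x}"
      using poly_roots_finite[OF nz] unfolding eq .
    moreover have "card {x :: 'k. x ^ p = x} \<le> card (h ` {0..<int p})"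
      using card_poly_roots_bound[OF nz] unfolding eq deg by (simp add: card_image inj)
    ultimately have "h ` {0..<int p} = {x :: 'k. x ^ p = x}"
      by (intro card_seteq)
    thus ?thesis
      by (rule sym)
  qed
  interpret W: weil p "h u" "h v" \<psi>
  proof
    show "h u \<noteq> 0"
      using u h_eq[of u 0] by (simp add: h_def cong_0_iff)
    show "\<psi> (x + y) = \<psi> x * \<psi> y" if xy: "x ^ p = x" "y ^ p = y" for x y
    proof -
      have "x \<in> h ` {0..<int p}" "y \<in> h ` {0..<int p}"
        using xy unfolding roots[symmetric] by simp_all
      then obtain a b where "x = h a" "y = h b"
        by (elim imageE)
      moreover from this have "x + y = h (a + b)"
        by (simp add: h_def)
      ultimately show ?thesis
        by (simp add: \<psi>h e_mod_add)
    qed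
    have "\<psi> (h 1) \<noteq> 1"
      using p by (simp add: \<psi>h e_mod_eq_1_iff)
    thus "\<exists>x. x ^ p = x \<and> \<psi> x \<noteq> 1"
      using frob by blast
  qed (use p char frob in \<open>auto simp: \<psi>_def\<close>)
  have "expo_sum p u v = (\<Sum>t\<in>W.gf 1 - {0}. \<psi> (W.f t))"
    unfolding expo_sum_def
  proof (rule sum.reindex_bij_witness[of _ "\<lambda>x. (g x mod int p, g (inverse x) mod int p)" "\<lambda>(t, s). h t"])
    fix ts assume ts: "ts \<in> inv_pairs p"
    obtain t s where [simp]: "ts = (t, s)"
      by force
    have r: "t \<in> {0..<int p}" "s \<in> {0..<int p}" "[t * s = 1] (mod int p)"
      using ts by (auto simp: inv_pairs_def)
    have "h (t * s) = h 1"
      using r(3) by (simp add: h_eq)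
    hence hs: "h t * h s = 1"
      by (simp add: h_def)
    hence inv: "inverse (h t) = h s"
      by (rule inverse_unique)
    show "(g (case ts of (t, s) \<Rightarrow> h t) mod int p, g (inverse (case ts of (t, s) \<Rightarrow> h t)) mod int p) = ts"
      using r(1,2) gh[of t] gh[of s] by (simp add: inv cong_def)
    show "(case ts of (t, s) \<Rightarrow> h t) \<in> W.gf 1 - {0}"
      using hs frob[of t] by (auto simp: W.gf_def)
    have "W.f (h t) = h (u * t ^ 3 + v * s ^ 2)"
      by (simp add: W.f_def power_int_minus power_inverse[symmetric] inv) (simp add: h_def)
    thus "\<psi> (W.f (case ts of (t, s) \<Rightarrow> h t)) = (case ts of (t, s) \<Rightarrow> e_mod p (u * t ^ 3 + v * s ^ 2))"
      by (simp add: \<psi>h)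
  next
    fix x assume x: "x \<in> W.gf 1 - {0}"
    hence "x \<in> h ` {0..<int p}"
      unfolding roots[symmetric] by (simp add: W.gf_def)
    then obtain a where a: "x = h a"
      by (elim imageE)
    have "inverse x ^ p = inverse x"
      using x by (simp add: W.gf_def power_inverse)
    hence "inverse x \<in> h ` {0..<int p}"
      unfolding roots[symmetric] by simp
    then obtain b where b: "inverse x = h b"
      by (elim imageE)
    have hg: "h (g (h c) mod int p) = h c" for c
      unfolding h_eq using gh[of c] by (simp add: cong_def)
    have ga: "h (g x mod int p) = x" "h (g (inverse x) mod int p) = inverse x"
      using hg[of a] hg[of b] unfolding a[symmetric] b[symmetric] .
    show "(case (g x mod int p, g (inverse x) mod int p) of (t, s) \<Rightarrow> h t) = x"
      using ga by simp
    have "h ((g x mod int p) * (g (inverse x) mod int p)) = h 1"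
      using ga x by (simp add: h_def)
    thus "(g x mod int p, g (inverse x) mod int p) \<in> inv_pairs p"
      using p unfolding h_eq by (simp add: inv_pairs_def)
  qed
  thus ?thesis
    using W.weil_bound by simp
qed

definition weil_bound_holds :: "nat \<Rightarrow> bool" where
  "weil_bound_holds p \<longleftrightarrow> (\<forall>u v. \<not> int p dvd u \<longrightarrow> norm (expo_sum p u v) \<le> 5 * sqrt (real p))"

text \<open>
  Types cannot depend on a variable prime \<open>p\<close>. The field is therefore built over one fixed prime,
  chosen to violate the bound if any prime does.
\<close>

definition critical_prime :: nat where
  "critical_prime = (if \<exists>p. prime p \<and> p > 3 \<and> \<not> weil_bound_holds p
     then SOME p. prime p \<and> p > 3 \<and> \<not> weil_bound_holds p else 5)"

lemma critical_prime: "prime critical_prime" "critical_prime > 3"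
proof -
  have "prime critical_prime \<and> critical_prime > 3"
  proof (cases "\<exists>p. prime p \<and> p > 3 \<and> \<not> weil_bound_holds p")
    case True
    from someI_ex[OF this] show ?thesis
      unfolding critical_prime_def using True by simp
  next
    case False
    have "critical_prime = 5"
      unfolding critical_prime_def using False by (rule if_not_P)
    moreover have "prime (5 :: nat)"
      by simp
    ultimately show ?thesis
      by simp
  qed
  thus "prime critical_prime" "critical_prime > 3"
    by blast+
qed

section \<open>A field of prime order\<close>

typedef prime_field = "{0..<int critical_prime}"
  using critical_prime by (intro exI[of _ 0]) auto

setup_lifting type_definition_prime_field

instantiation prime_field :: field
begin

lift_definition zero_prime_field :: prime_field is 0
  using critical_prime by auto

lift_definition one_prime_field :: prime_field is 1
  using critical_prime by auto

lift_definition plus_prime_field :: "prime_field \<Rightarrow> prime_field \<Rightarrow> prime_field"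
  is "\<lambda>x y. (x + y) mod int critical_prime"
  using critical_prime by auto

lift_definition minus_prime_field :: "prime_field \<Rightarrow> prime_field \<Rightarrow> prime_field"
  is "\<lambda>x y. (x - y) mod int critical_prime"
  using critical_prime by auto

lift_definition uminus_prime_field :: "prime_field \<Rightarrow> prime_field"
  is "\<lambda>x. (- x) mod int critical_prime"
  using critical_prime by auto

lift_definition times_prime_field :: "prime_field \<Rightarrow> prime_field \<Rightarrow> prime_field"
  is "\<lambda>x y. (x * y) mod int critical_prime"
  using critical_prime by auto

lift_definition inverse_prime_field :: "prime_field \<Rightarrow> prime_field"
  is "\<lambda>x. if x = 0 then 0 else (SOME y. [x * y = 1] (mod int critical_prime)) mod int critical_prime"
  using critical_prime by auto

definition divide_prime_field :: "prime_field \<Rightarrow> prime_field \<Rightarrow> prime_field" where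
  "divide_prime_field x y = x * inverse y"

instance
proof
  fix a b c :: prime_field
  show "a * b * c = a * (b * c)"
    by transfer (simp add: mod_mult_left_eq mod_mult_right_eq mult.assoc)
  show "a * b = b * a"
    by transfer (simp add: mult.commute)
  show "1 * a = a"
    by transfer simp
  show "a + b + c = a + (b + c)"
    by transfer (simp add: mod_add_left_eq mod_add_right_eq add.assoc)
  show "a + b = b + a"
    by transfer (simp add: add.commute)
  show "0 + a = a"
    by transfer simp
  show "- a + a = 0"
    by transfer (simp add: mod_add_left_eq)
  show "a - b = a + - b"
    by transfer (simp add: mod_add_right_eq)
  show "(a + b) * c = a * c + b * c"
    by transfer (simp add: mod_mult_left_eq mod_add_eq ring_distribs)
  show "(0 :: prime_field) \<noteq> 1"
    by transfer simp
  show "a div b = a * inverse b"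
    by (rule divide_prime_field_def)
  show "inverse (0 :: prime_field) = 0"
    by transfer simp
  show "inverse a * a = 1" if "a \<noteq> 0"
    using that
  proof transfer
    fix a assume a: "a \<in> {0..<int critical_prime}" "a \<noteq> 0"
    have "\<not> int critical_prime dvd a"
      using a zdvd_not_zless[of a "int critical_prime"] by auto
    hence "coprime a (int critical_prime)"
      using critical_prime(1) by (metis coprime_commute prime_imp_coprime prime_nat_int_transfer)
    hence "\<exists>y. [a * y = 1] (mod int critical_prime)"
      by (rule cong_solve_coprime_int)
    hence "[a * (SOME y. [a * y = 1] (mod int critical_prime)) = 1] (mod int critical_prime)"
      by (rule someI_ex)
    thus "(if a = 0 then 0 else (SOME y. [a * y = 1] (mod int critical_prime)) mod int critical_prime) * a
        mod int critical_prime = 1"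
      using a critical_prime(2) by (simp add: cong_def mod_mult_right_eq mult.commute)
  qed
qed

end

lemma CHAR_prime_field: "CHAR(prime_field) = critical_prime"
proof (rule CHAR_eqI)
  have rep: "Rep_prime_field (of_nat n) = int n mod int critical_prime" for n
  proof (induction n)
    case 0
    show ?case
      by (simp add: zero_prime_field.rep_eq)
  next
    case (Suc n)
    thus ?case
      by (simp add: plus_prime_field.rep_eq one_prime_field.rep_eq mod_add_right_eq)
  qed
  have zero: "of_nat n = (0 :: prime_field) \<longleftrightarrow> int n mod int critical_prime = 0" for n
    by (simp add: Rep_prime_field_inject[symmetric] rep zero_prime_field.rep_eq)
  show "of_nat critical_prime = (0 :: prime_field)"
    by (simp add: zero)
  show "critical_prime dvd n" if "of_nat n = (0 :: prime_field)" for n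
    using that by (simp add: zero mod_eq_0_iff_dvd flip: int_dvd_int_iff)
qed

text \<open>The algebraic closure of \<open>prime_field\<close> gives the bound for
  \<open>critical_prime\<close>. If it failed for any \<open>p\<close>, then
  \<open>critical_prime\<close> would have been chosen to violate it.\<close>

theorem weil_expo_sum:
  assumes "prime p" "p > 3" "\<not> int p dvd u"
  shows "norm (expo_sum p u v) \<le> 5 * sqrt (real p)"
proof -
  have "weil_bound_holds critical_prime"
    unfolding weil_bound_holds_def
    using weil_expo_sum_aux[where ?'k = "prime_field alg_closure", OF critical_prime] CHAR_prime_field by simp
  moreover have "\<not> weil_bound_holds critical_prime" if "\<not> weil_bound_holds p"
  proof -
    have "\<exists>p. prime p \<and> p > 3 \<and> \<not> weil_bound_holds p"
      using that assms by blast
    from this someI_ex[OF this] show ?thesis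
      unfolding critical_prime_def by simp
  qed
  ultimately show ?thesis
    using assms(3) unfolding weil_bound_holds_def by blast
qed

section \<open>Prime power moduli\<close>

lemma prime_power_induct [consumes 1, case_names one step]:
  fixes n :: nat
  assumes "n > 0" and one: "P 1"
    and step: "\<And>p k m. prime p \<Longrightarrow> k > 0 \<Longrightarrow> m > 0 \<Longrightarrow> \<not> p dvd m \<Longrightarrow> P m \<Longrightarrow> P (p ^ k * m)"
  shows "P n"
  using assms(1)
proof (induction n rule: less_induct)
  case (less n)
  show ?case
  proof (cases "n = 1")
    case False
    then obtain p where p: "prime p" "p dvd n"
      using prime_factor_nat by blast
    define k where "k = multiplicity p n"
    define m where "m = n div p ^ k"
    have n: "n = p ^ k * m"
      by (simp add: m_def k_def multiplicity_dvd)
    have k: "k > 0"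
      using p less.prems by (simp add: k_def prime_multiplicity_gt_zero_iff)
    have m: "m > 0"
      using less.prems n by (auto intro: gr0I)
    have nd: "\<not> p dvd m"
      using multiplicity_decompose[of n p] less.prems prime_gt_1_nat[OF p(1)] by (simp add: m_def k_def)
    have "p ^ k > 1"
      by (rule one_less_power[OF prime_gt_1_nat[OF p(1)] k])
    hence "m < n"
      using m n by simp
    thus ?thesis
      using step[OF p(1) k m nd less.IH] m n by simp
  next
    case True
    show ?thesis
      using one by (simp only: True)
  qed
qed

lemma card_divisors_mult_le:
  fixes m n :: nat
  assumes "m > 0" "n > 0"
  shows "card {d. d dvd m * n} \<le> card {d. d dvd m} * card {d. d dvd n}"
proof -
  have fin: "finite {d. d dvd m}" "finite {d. d dvd n}"
    using assms by (auto intro: finite_divisors_nat)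
  have "{d. d dvd m * n} \<subseteq> (\<lambda>(a, b). a * b) ` ({d. d dvd m} \<times> {d. d dvd n})"
  proof
    fix d assume "d \<in> {d. d dvd m * n}"
    then obtain a b where "d = a * b" "a dvd m" "b dvd n"
      using division_decomp[of d m n] by auto
    thus "d \<in> (\<lambda>(a, b). a * b) ` ({d. d dvd m} \<times> {d. d dvd n})"
      by auto
  qed
  hence "card {d. d dvd m * n} \<le> card ((\<lambda>(a, b). a * b) ` ({d. d dvd m} \<times> {d. d dvd n}))"
    using fin by (intro card_mono) auto
  also have "\<dots> \<le> card ({d. d dvd m} \<times> {d. d dvd n})"
    using fin by (intro card_image_le) auto
  finally show ?thesis
    by (simp add: card_cartesian_product)
qed

lemma card_divisors_prime_power: "prime p \<Longrightarrow> card {d. d dvd (p :: nat) ^ k} \<le> Suc k"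
proof -
  assume p: "prime p"
  have "{d. d dvd p ^ k} \<subseteq> (\<lambda>i. p ^ i) ` {..k}"
    using divides_primepow_nat[OF p] by auto
  hence "card {d. d dvd p ^ k} \<le> card ((\<lambda>i. p ^ i) ` {..k})"
    by (intro card_mono) auto
  also have "\<dots> \<le> card {..k}"
    by (rule card_image_le) simp
  finally show ?thesis
    by simp
qed

lemma linear_le_exponential:
  fixes \<epsilon> :: real
  assumes "\<epsilon> > 0"
  obtains D where "D \<ge> 1" "\<And>k :: nat. real (Suc k) \<le> D * 2 powr (\<epsilon> * real k)"
proof -
  define c where "c = \<epsilon> * ln 2"
  have c: "c > 0"
    using assms by (simp add: c_def)
  show ?thesis
  proof (rule that[of "1 + 1 / c"])
    show "1 + 1 / c \<ge> 1"
      using c by simp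
    fix k :: nat
    have e: "2 powr (\<epsilon> * real k) = exp (c * real k)"
      by (simp add: powr_def c_def mult_ac)
    have "1 + c * real k \<le> exp (c * real k)"
      by (rule exp_ge_add_one_self)
    moreover have "1 \<le> exp (c * real k)"
      using c by simp
    ultimately have "1 + real k \<le> exp (c * real k) + exp (c * real k) / c"
    proof -
      have "c * 1 \<le> c * exp (c * real k)"
        using c \<open>1 \<le> exp (c * real k)\<close> by (intro mult_left_mono) auto
      moreover have "c * (1 + real k) = c * 1 + c * real k"
        "c * (exp (c * real k) + exp (c * real k) / c) = c * exp (c * real k) + exp (c * real k)"
        using c by (simp_all add: distrib_left)
      ultimately have "c * (1 + real k) \<le> c * (exp (c * real k) + exp (c * real k) / c)"
        using \<open>1 + c * real k \<le> exp (c * real k)\<close> by linarith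
      thus ?thesis
        using c by simp
    qed
    thus "real (Suc k) \<le> (1 + 1 / c) * 2 powr (\<epsilon> * real k)"
      by (simp add: e algebra_simps)
  qed
qed

text \<open>
  The primes \<open>p\<close> with \<open>p\<^sup>\<epsilon> < 2 C\<close> are finite in number and cost a bounded factor \<open>D\<close> each;
  the other primes cost nothing.
\<close>

lemma submultiplicative_growth:
  fixes F :: "nat \<Rightarrow> real" and C \<epsilon> :: real
  assumes \<epsilon>: "\<epsilon> > 0" and C: "C \<ge> 1" and F1: "F 1 \<le> 1" and F0: "\<And>n. F n \<ge> 0"
    and F: "\<And>p k m. prime p \<Longrightarrow> k > 0 \<Longrightarrow> m > 0 \<Longrightarrow> \<not> p dvd m \<Longrightarrow> F (p ^ k * m) \<le> C * real (Suc k) * F m"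
  obtains A where "A > 0" "\<And>n. n > 0 \<Longrightarrow> F n \<le> A * real n powr \<epsilon>"
proof -
  obtain D0 where D0: "D0 \<ge> 1" "\<And>k :: nat. real (Suc k) \<le> D0 * 2 powr (\<epsilon> * real k)"
    using linear_le_exponential[OF \<epsilon>] by blast
  define D where "D = C * D0"
  have D: "D \<ge> 1"
    using C D0(1) mult_mono[of 1 C 1 D0] by (simp add: D_def)
  define Y where "Y = (2 * C) powr (1 / \<epsilon>)"
  define B where "B = {p :: nat. real p < Y}"
  have finB: "finite B"
  proof (rule finite_subset)
    show "B \<subseteq> {..nat \<lceil>Y\<rceil>}"
      unfolding B_def by (auto simp: le_nat_iff) linarith
  qed simp
  have step: "C * real (Suc k) \<le> (if p \<in> B then D else 1) * real (p ^ k) powr \<epsilon>" if p: "prime p" and k: "k > 0" for p k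
  proof -
    have p2: "real p \<ge> 2"
      using prime_ge_2_nat[OF p] by simp
    have pk: "real (p ^ k) powr \<epsilon> = real p powr (\<epsilon> * real k)"
      using p2 by (simp add: powr_powr mult.commute flip: powr_realpow)
    show ?thesis
    proof (cases "p \<in> B")
      case True
      have "C * real (Suc k) \<le> C * (D0 * 2 powr (\<epsilon> * real k))"
        using C D0(2)[of k] by (intro mult_left_mono) auto
      also have "\<dots> \<le> D * real p powr (\<epsilon> * real k)"
        unfolding D_def mult.assoc using C D0(1) p2 \<epsilon>
        by (intro mult_left_mono powr_mono2) auto
      finally show ?thesis
        using True pk by simp
    next
      case False
      have "2 * C = Y powr \<epsilon>"
        using C \<epsilon> by (simp add: Y_def powr_powr)
      also have "\<dots> \<le> real p powr \<epsilon>"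
        using False \<epsilon> by (intro powr_mono2) (auto simp: B_def Y_def)
      finally have pe: "2 * C \<le> real p powr \<epsilon>" .
      have "real (Suc k) \<le> 2 ^ k"
      proof -
        have "Suc k \<le> 2 ^ k"
          using less_exp[of k] by (simp add: Suc_le_eq)
        hence "real (Suc k) \<le> real (2 ^ k)"
          by (simp only: of_nat_le_iff)
        thus ?thesis
          by simp
      qed
      moreover have "C \<le> C ^ k"
        using C k by (simp add: self_le_power)
      ultimately have "C * real (Suc k) \<le> C ^ k * 2 ^ k"
        using C by (intro mult_mono) auto
      also have "\<dots> = (2 * C) ^ k"
        by (simp add: power_mult_distrib)
      also have "\<dots> \<le> (real p powr \<epsilon>) ^ k"
        using pe C by (intro power_mono) auto
      also have "\<dots> = real p powr (\<epsilon> * real k)"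
        using p2 by (simp add: powr_powr flip: powr_realpow)
      finally show ?thesis
        using False pk by simp
    qed
  qed
  have main: "F n \<le> D ^ card (prime_factors n \<inter> B) * real n powr \<epsilon>" if "n > 0" for n
    using that
  proof (induction n rule: prime_power_induct)
    case one
    show ?case
      using F1 by simp
  next
    case (step p k m)
    let ?c = "if p \<in> B then D else 1"
    have pf: "prime_factors (p ^ k * m) = insert p (prime_factors m)"
      using step by (simp add: prime_factors_product prime_factors_power prime_prime_factors)
    have pn: "p \<notin> prime_factors m"
      using step(4) by auto
    have D': "?c * D ^ card (prime_factors m \<inter> B) = D ^ card (prime_factors (p ^ k * m) \<inter> B)"
      unfolding pf using pn finB by (simp add: Int_insert_left)
    have "F (p ^ k * m) \<le> C * real (Suc k) * F m"
      by (rule F) fact+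
    also have "\<dots> \<le> (?c * real (p ^ k) powr \<epsilon>) * (D ^ card (prime_factors m \<inter> B) * real m powr \<epsilon>)"
      using D F0 by (intro mult_mono \<open>\<And>p k. prime p \<Longrightarrow> k > 0 \<Longrightarrow> C * real (Suc k) \<le> (if p \<in> B then D else 1) * real (p ^ k) powr \<epsilon>\<close> step.hyps step.IH) auto
    also have "\<dots> = (?c * D ^ card (prime_factors m \<inter> B)) * real (p ^ k * m) powr \<epsilon>"
      by (simp add: powr_mult mult_ac)
    also note D'
    finally show ?case .
  qed
  show ?thesis
  proof (rule that[of "D ^ card B"])
    show "D ^ card B > 0"
      using D by simp
    fix n :: nat assume n: "n > 0"
    have "card (prime_factors n \<inter> B) \<le> card B"
      using finB by (intro card_mono) auto
    hence "D ^ card (prime_factors n \<inter> B) * real n powr \<epsilon> \<le> D ^ card B * real n powr \<epsilon>"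
      using D by (intro mult_right_mono power_increasing) auto
    thus "F n \<le> D ^ card B * real n powr \<epsilon>"
      using main[OF n] by linarith
  qed
qed

lemma card_roots_mod_prime:
  fixes F :: "int poly"
  assumes p: "prime p" and "\<not> int p dvd lead_coeff F"
  shows "card {x \<in> {0..<int p}. int p dvd poly F x} \<le> degree F"
  using assms(2)
proof (induction "degree F" arbitrary: F)
  case 0
  then obtain c where "F = [:c:]"
    by (metis degree_eq_zeroE)
  thus ?case
    using 0 by simp
next
  case (Suc n)
  let ?R = "\<lambda>F. {x \<in> {0..<int p}. int p dvd poly F x}"
  show ?case
  proof (cases "?R F = {}")
    case False
    then obtain a where a: "a \<in> {0..<int p}" "int p dvd poly F a"
      by blast
    define G where "G = synthetic_div F a"
    have FG: "F = [:-a, 1:] * G + [:poly F a:]"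
      unfolding G_def by (rule synthetic_div_correct'[symmetric])
    have dG: "degree G = n"
      using Suc.hyps(2) by (simp add: G_def degree_synthetic_div)
    have G0: "G \<noteq> 0"
      using Suc.hyps(2) FG by (metis add_0 degree_pCons_0 mult_zero_right nat.distinct(1))
    have "lead_coeff F = coeff ([:-a, 1:] * G) (Suc n) + coeff [:poly F a:] (Suc n)"
      using FG Suc.hyps(2) by (metis coeff_add)
    also have "\<dots> = lead_coeff G"
      using dG by (simp add: coeff_eq_0)
    finally have lG: "\<not> int p dvd lead_coeff G"
      using Suc.prems by simp
    have "?R F \<subseteq> insert a (?R G)"
    proof
      fix x assume x: "x \<in> ?R F"
      have "poly F x = (x - a) * poly G x + poly F a"
        by (subst FG) (simp add: left_diff_distrib)
      hence "int p dvd (x - a) * poly G x"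
        using x a(2) by (simp add: dvd_add_left_iff)
      hence "int p dvd x - a \<or> int p dvd poly G x"
        using p by (simp add: prime_dvd_mult_iff)
      moreover have "x = a" if "int p dvd x - a"
        using that x a(1) by (auto simp: mod_eq_dvd_iff[symmetric])
      ultimately show "x \<in> insert a (?R G)"
        using x by blast
    qed
    moreover have "finite (?R G)"
      by (rule finite_subset[of _ "{0..<int p}"]) auto
    ultimately have "card (?R F) \<le> card (insert a (?R G))"
      by (intro card_mono) auto
    also have "\<dots> \<le> Suc (card (?R G))"
      by (rule card_insert_le_m1) auto
    also have "\<dots> \<le> Suc n"
      using Suc.hyps(1)[OF dG[symmetric] lG] dG by simp
    finally show ?thesis
      using Suc.hyps(2) by simp
  qed (simp only: card.empty)
qed

section \<open>Pairs of inverse residues and Gauss sums\<close>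

lemma inv_pairs_unique:
  assumes "(t, s) \<in> inv_pairs q" "(t, s') \<in> inv_pairs q"
  shows "s = s'"
proof -
  have "[s * (t * s') = s' * (t * s)] (mod int q)"
    by (simp add: mult_ac)
  moreover have "[s * (t * s') = s * 1] (mod int q)"
    using assms by (intro cong_mult) (auto simp: inv_pairs_def)
  moreover have "[s' * (t * s) = s' * 1] (mod int q)"
    using assms by (intro cong_mult) (auto simp: inv_pairs_def)
  ultimately have "[s = s'] (mod int q)"
    by (simp add: cong_def)
  thus ?thesis
    using assms by (auto simp: inv_pairs_def cong_def)
qed

lemma inv_pairs_swap: "(t, s) \<in> inv_pairs q \<longleftrightarrow> (s, t) \<in> inv_pairs q"
  by (auto simp: inv_pairs_def mult.commute)

lemma inj_on_fst_inv_pairs: "inj_on fst (inv_pairs q)"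
  by (auto simp: inj_on_def dest: inv_pairs_unique)

lemma fst_inv_pairs:
  assumes "q > 0"
  shows "fst ` inv_pairs q = {t \<in> {0..<int q}. coprime t (int q)}"
proof (intro equalityI subsetI)
  fix t assume "t \<in> fst ` inv_pairs q"
  then obtain s where "(t, s) \<in> inv_pairs q"
    by force
  thus "t \<in> {t \<in> {0..<int q}. coprime t (int q)}"
    using coprime_iff_invertible_int by (auto simp: inv_pairs_def)
next
  fix t assume t: "t \<in> {t \<in> {0..<int q}. coprime t (int q)}"
  then obtain s where "[t * s = 1] (mod int q)"
    using cong_solve_coprime_int by blast
  hence "(t, s mod int q) \<in> inv_pairs q"
    using t assms by (auto simp: inv_pairs_def cong_def mod_mult_right_eq)
  thus "t \<in> fst ` inv_pairs q"
    by force
qed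

lemma card_inv_pairs_le: "card (inv_pairs q) \<le> q"
proof -
  have "card (inv_pairs q) = card (fst ` inv_pairs q)"
    using inj_on_fst_inv_pairs by (simp add: card_image)
  also have "\<dots> \<le> card {0..<int q}"
    by (intro card_mono) (auto simp: inv_pairs_def)
  finally show ?thesis
    by simp
qed

lemma norm_expo_sum_le: "norm (expo_sum q u v) \<le> real q"
proof -
  have "norm (expo_sum q u v) \<le> (\<Sum>x\<in>inv_pairs q. 1)"
    unfolding expo_sum_def by (rule sum_norm_le) auto
  thus ?thesis
    using card_inv_pairs_le[of q] by (simp add: le_trans flip: of_nat_le_iff)
qed

text \<open>Multiplication by a unit permutes \<open>S\<close>. Stability is stated for
  \<open>w\<close> and its inverse together, which supplies both directions of the
  bijection.\<close>

lemma sum_inv_pairs_shift: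
  assumes w: "[w * w' = 1] (mod int q)" and q: "q > 0" and S: "S \<subseteq> inv_pairs q"
    and stable: "\<And>t s a b. (t, s) \<in> inv_pairs q \<Longrightarrow> [a * b = 1] (mod int q) \<Longrightarrow> (a = w \<and> b = w') \<or> (a = w' \<and> b = w) \<Longrightarrow>
       (t, s) \<in> S \<Longrightarrow> ((t * a) mod int q, (s * b) mod int q) \<in> S"
  shows "(\<Sum>(t, s)\<in>S. F t s) = (\<Sum>(t, s)\<in>S. F ((t * w) mod int q) ((s * w') mod int q))"
proof -
  have w': "[w' * w = 1] (mod int q)"
    using w by (simp add: mult.commute)
  have undo: "((x * a) mod int q * b) mod int q = x" if "x \<in> {0..<int q}" "[a * b = 1] (mod int q)" for x a b
  proof -
    have "[x * (a * b) = x * 1] (mod int q)"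
      using that(2) by (intro cong_mult) auto
    thus ?thesis
      using that(1) by (simp add: cong_def mod_mult_left_eq mult.assoc)
  qed
  show ?thesis
  proof (rule sum.reindex_bij_witness[of _ "\<lambda>(t, s). ((t * w) mod int q, (s * w') mod int q)"
        "\<lambda>(t, s). ((t * w') mod int q, (s * w) mod int q)"])
    fix ts assume ts: "ts \<in> S"
    obtain t s where [simp]: "ts = (t, s)"
      by force
    have I: "(t, s) \<in> inv_pairs q" "t \<in> {0..<int q}" "s \<in> {0..<int q}"
      using ts S by (auto simp: inv_pairs_def)
    show "(case case ts of (t, s) \<Rightarrow> ((t * w') mod int q, (s * w) mod int q) of
       (t, s) \<Rightarrow> ((t * w) mod int q, (s * w') mod int q)) = ts"
      using undo[OF I(2) w'] undo[OF I(3) w] by simp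
    show "(case case ts of (t, s) \<Rightarrow> ((t * w) mod int q, (s * w') mod int q) of
       (t, s) \<Rightarrow> ((t * w') mod int q, (s * w) mod int q)) = ts"
      using undo[OF I(2) w] undo[OF I(3) w'] by simp
    show "(case ts of (t, s) \<Rightarrow> ((t * w') mod int q, (s * w) mod int q)) \<in> S"
      using stable[OF I(1) w'] ts by simp
    show "(case ts of (t, s) \<Rightarrow> ((t * w) mod int q, (s * w') mod int q)) \<in> S"
      using stable[OF I(1) w] ts by simp
    show "(case case ts of (t, s) \<Rightarrow> ((t * w') mod int q, (s * w) mod int q) of
       (t, s) \<Rightarrow> F ((t * w) mod int q) ((s * w') mod int q)) = (case ts of (t, s) \<Rightarrow> F t s)"
      using undo[OF I(2) w'] undo[OF I(3) w] by simp
  qed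
qed

lemma inv_pairs_shift:
  assumes "(t, s) \<in> inv_pairs q" "[w * w' = 1] (mod int q)" "q > 0"
  shows "((t * w) mod int q, (s * w') mod int q) \<in> inv_pairs q"
proof -
  have "[t * s * (w * w') = 1 * 1] (mod int q)"
    using assms by (intro cong_mult) (auto simp: inv_pairs_def)
  hence "[(t * w) * (s * w') = 1] (mod int q)"
    by (simp add: mult_ac)
  hence "[((t * w) mod int q) * ((s * w') mod int q) = 1] (mod int q)"
    by (simp add: cong_def mod_mult_eq)
  thus ?thesis
    using assms(3) by (simp add: inv_pairs_def)
qed

lemma e_mod_poly_mod: "e_mod q (u * (t mod int q) ^ 3 + v * (s mod int q) ^ 2) = e_mod q (u * t ^ 3 + v * s ^ 2)"
  by (intro e_mod_cong cong_add cong_mult cong_pow) auto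

lemma e_mod_scale: "a > 0 \<Longrightarrow> e_mod (a * b) (int a * n) = e_mod b n"
  by (simp add: e_mod_def mult.assoc)

lemma int_div_less:
  fixes x a b :: int
  assumes "b > 0" "x < a * b"
  shows "x div b < a"
proof (rule ccontr)
  assume "\<not> x div b < a"
  hence "a * b \<le> (x div b) * b"
    using assms(1) by (intro mult_right_mono) auto
  also have "\<dots> \<le> x"
    using pos_mod_sign[OF assms(1), of x] div_mult_mod_eq[of x b] by linarith
  finally show False
    using assms(2) by simp
qed

lemma sum_e_mod_multiples:
  assumes "q > 0"
  shows "(\<Sum>z<q. e_mod q (int z * a)) = (if int q dvd a then of_nat q else 0)"
proof (cases "int q dvd a")
  case True
  hence "e_mod q (int z * a) = 1" for z
    using assms by (simp add: e_mod_eq_1_iff)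
  thus ?thesis
    using True by simp
next
  case False
  have pw: "e_mod q (int z * a) = e_mod q a ^ z" for z
    by (induction z) (simp_all add: e_mod_add ring_distribs)
  have ne: "e_mod q a \<noteq> 1"
    using False assms by (simp add: e_mod_eq_1_iff)
  have "e_mod q a ^ q = 1"
    using e_mod_mult_self[of q a] pw[of q] by simp
  thus ?thesis
    using False ne by (simp add: pw sum_gp_strict)
qed

text \<open>In the square of the modulus, with z = y + h, the phase is linear in \<open>y\<close>
  with coefficient 2 a h, so the sum over \<open>y\<close> leaves only h = 0.\<close>

lemma norm_gauss_sum:
  assumes p: "prime p" "p > 2" and a: "\<not> int p dvd a"
  shows "norm (\<Sum>z<p. e_mod p (a * int z ^ 2 + b * int z)) = sqrt (real p)"
proof -
  let ?g = "\<lambda>z. e_mod p (a * z ^ 2 + b * z)"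
  let ?G = "\<Sum>z\<in>{0..<int p}. ?g z"
  have conv: "(\<Sum>z<p. e_mod p (h (int z))) = (\<Sum>z\<in>{0..<int p}. e_mod p (h z))" for h
    by (rule sum.reindex_bij_witness[of _ nat int]) auto
  have cnj: "cnj (e_mod p n) = e_mod p (- n)" for n
    by (simp add: e_mod_def cis_cnj)
  have per: "(\<Sum>z\<in>{0..<int p}. ?g z * c y z) = (\<Sum>h\<in>{0..<int p}. ?g (y + h) * c y ((y + h) mod int p))"
    if y: "y \<in> {0..<int p}" for y c
  proof (rule sum.reindex_bij_witness[of _ "\<lambda>h. (y + h) mod int p" "\<lambda>z. (z - y) mod int p"])
    fix z assume z: "z \<in> {0..<int p}"
    have e: "(y + (z - y) mod int p) mod int p = z"
      using z by (simp add: mod_add_right_eq)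
    show "(y + (z - y) mod int p) mod int p = z"
      by (rule e)
    show "(z - y) mod int p \<in> {0..<int p}"
      using z by simp
    have "[y + (z - y) mod int p = z] (mod int p)"
      using e z by (simp add: cong_def)
    hence "?g (y + (z - y) mod int p) = ?g z"
      by (intro e_mod_cong cong_add cong_mult cong_pow) auto
    thus "?g (y + (z - y) mod int p) * c y ((y + (z - y) mod int p) mod int p) = ?g z * c y z"
      by (simp only: e)
  next
    fix h assume h: "h \<in> {0..<int p}"
    show "((y + h) mod int p - y) mod int p = h"
      using h by (simp add: mod_diff_left_eq)
    show "(y + h) mod int p \<in> {0..<int p}"
      using h by simp
  qed
  have "?G * cnj ?G = (\<Sum>y\<in>{0..<int p}. \<Sum>z\<in>{0..<int p}. ?g z * cnj (?g y))"
    unfolding cnj_sum sum_product by (rule sum.swap)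
  also have "\<dots> = (\<Sum>y\<in>{0..<int p}. \<Sum>h\<in>{0..<int p}. ?g (y + h) * cnj (?g y))"
    using per[where c = "\<lambda>y z. cnj (?g y)"] by (rule sum.cong[OF refl])
  also have "\<dots> = (\<Sum>y\<in>{0..<int p}. \<Sum>h\<in>{0..<int p}. ?g h * e_mod p (y * (2 * a * h)))"
  proof (intro sum.cong refl)
    fix y h
    show "?g (y + h) * cnj (?g y) = ?g h * e_mod p (y * (2 * a * h))"
      unfolding cnj e_mod_add[symmetric] by (rule arg_cong[of _ _ "e_mod p"]) (simp add: power2_eq_square algebra_simps)
  qed
  also have "\<dots> = (\<Sum>h\<in>{0..<int p}. ?g h * (\<Sum>y\<in>{0..<int p}. e_mod p (y * (2 * a * h))))"
    by (subst sum.swap) (simp add: sum_distrib_left)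
  also have "\<dots> = (\<Sum>h\<in>{0..<int p}. if h = 0 then of_nat p else 0)"
  proof (intro sum.cong refl)
    fix h assume h: "h \<in> {0..<int p}"
    have "(\<Sum>y\<in>{0..<int p}. e_mod p (y * (2 * a * h))) = (if int p dvd 2 * a * h then of_nat p else 0)"
      using conv[of "\<lambda>y. y * (2 * a * h)"] sum_e_mod_multiples[of p "2 * a * h"] p by simp
    moreover have "int p dvd 2 * a * h \<longleftrightarrow> h = 0"
    proof -
      have "\<not> int p dvd 2"
        using p(2) zdvd_not_zless by fastforce
      moreover have "int p dvd h \<longleftrightarrow> h = 0"
        using h zdvd_not_zless[of h "int p"] by force
      ultimately show ?thesis
        using p(1) a by (simp add: prime_dvd_mult_iff)
    qed
    ultimately show "?g h * (\<Sum>y\<in>{0..<int p}. e_mod p (y * (2 * a * h))) = (if h = 0 then of_nat p else 0)"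
      by simp
  qed
  also have "\<dots> = of_nat p"
    using p by simp
  finally have G2: "?G * cnj ?G = of_nat p" .
  have "of_real (norm ?G ^ 2) = (of_real (real p) :: complex)"
    unfolding complex_norm_square G2 by simp
  hence "norm ?G ^ 2 = real p"
    by (simp only: of_real_eq_iff)
  hence "norm ?G = sqrt (real p)"
    by (simp add: real_sqrt_unique)
  thus ?thesis
    using conv[of "\<lambda>z. a * z ^ 2 + b * z"] by simp
qed

text \<open>The difference of fifth powers is (t1 - t2) F with F congruent to 5 t2^4 modulo
  \<open>p\<close>. So powers of \<open>p\<close> can be lost only to 3 u or to 5: none for p \<ge>
  7, and at most one for the primes 2, 3, 5.\<close>

lemma prime_power_cong_fifth:
  assumes p: "prime p" and t: "[t1 = t2] (mod int p)" "\<not> int p dvd t1"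
    and d: "int p ^ j dvd 3 * u * (t1 ^ 5 - t2 ^ 5)" and e: "\<not> int p ^ 2 dvd 3 * u" "p \<ge> 7 \<Longrightarrow> \<not> int p dvd u"
    and e5: "p = 5 \<Longrightarrow> \<not> int p dvd u"
  shows "int p ^ (if p \<ge> 7 then j else j - 1) dvd t1 - t2"
proof -
  have pp: "prime (int p)"
    using p by simp
  define F where "F = t1 ^ 4 + t1 ^ 3 * t2 + t1 ^ 2 * t2 ^ 2 + t1 * t2 ^ 3 + t2 ^ 4"
  have fac: "t1 ^ 5 - t2 ^ 5 = (t1 - t2) * F"
    by (simp add: F_def algebra_simps power_numeral_reduce)
  obtain y where y: "t1 = t2 + int p * y"
    using t(1) by (metis cong_iff_lin cong_sym)
  have t2: "\<not> int p dvd t2"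
    using t(2) y by (simp add: dvd_add_left_iff)
  have F: "F = 5 * t2 ^ 4 + int p * y * (10 * t2 ^ 3) + (int p * y) ^ 2 * (10 * t2 ^ 2 + 5 * t2 * (int p * y) + (int p * y) ^ 2)"
    unfolding F_def y by (simp add: algebra_simps power_numeral_reduce)
  have d': "int p ^ j dvd (3 * u) * F * (t1 - t2)"
    using d by (simp add: fac mult_ac)
  have dvd5: "int p dvd 5 \<longleftrightarrow> p = 5"
  proof
    assume "int p dvd 5"
    hence "p dvd 5"
      by (metis int_dvd_int_iff of_nat_numeral)
    moreover have "prime (5 :: nat)"
      by simp
    ultimately show "p = 5"
      using p primes_dvd_imp_eq by blast
  qed simp
  have dvd3: "int p dvd 3 \<longleftrightarrow> p = 3"
  proof
    assume "int p dvd 3"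
    hence "p dvd 3"
      by (metis int_dvd_int_iff of_nat_numeral)
    moreover have "prime (3 :: nat)"
      by simp
    ultimately show "p = 3"
      using p primes_dvd_imp_eq by blast
  qed simp
  have cancel: "int p ^ i dvd x" if "int p ^ i dvd c * x" "\<not> int p dvd c" for i c x
  proof -
    have "coprime (int p ^ i) c"
      using that(2) pp by (simp add: prime_imp_coprime)
    thus ?thesis
      using that(1) by (simp add: coprime_dvd_mult_right_iff)
  qed
  have cancel1: "int p ^ (i - 1) dvd x" if h: "int p ^ i dvd c * x" and n: "\<not> int p ^ 2 dvd c" for i c x
  proof (cases "int p dvd c \<and> i \<ge> 1")
    case True
    then obtain c' where c': "c = int p * c'"
      by (elim conjE dvdE)
    have "\<not> int p dvd c'"
      using n by (auto simp: c' power2_eq_square)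
    moreover have "int p ^ i = int p * int p ^ (i - 1)"
      using True by (cases i) auto
    hence "int p * int p ^ (i - 1) dvd int p * (c' * x)"
      using h by (simp add: c' mult.assoc)
    hence "int p ^ (i - 1) dvd c' * x"
      using p by (simp add: prime_gt_0_nat)
    ultimately show ?thesis
      by (intro cancel[of "i - 1" c' x])
  next
    case False
    show ?thesis
    proof (cases "i \<ge> 1")
      case True
      hence "int p ^ i dvd x"
        using False h by (intro cancel[of i c x]) auto
      thus ?thesis
        by (rule dvd_trans[rotated]) (simp add: le_imp_power_dvd)
    qed simp
  qed
  show ?thesis
  proof (cases "p = 5")
    case True
    \<comment> \<open>All terms of \<open>F\<close> except 5 t2^4 are multiples of 25 when p =
      5.\<close>
    have "\<not> int p ^ 2 dvd F"
    proof
      assume "int p ^ 2 dvd F"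
      hence "25 dvd 5 * t2 ^ 4 + 25 * (2 * y * t2 ^ 3 + y ^ 2 * (10 * t2 ^ 2 + 5 * t2 * (int p * y) + (int p * y) ^ 2))"
        unfolding F True by (simp add: algebra_simps power2_eq_square)
      hence "25 dvd 5 * t2 ^ 4"
        by (simp only: dvd_add_times_triv_right_iff dvd_add_left_iff dvd_triv_left)
      hence "5 * 5 dvd 5 * t2 ^ 4"
        by simp
      hence "5 dvd t2 ^ 4"
        by (simp only: dvd_mult_cancel_left) simp
      hence "int p dvd t2"
        using pp prime_dvd_power[of "int p" t2 4] by (simp add: True)
      thus False
        using t2 by simp
    qed
    moreover have "\<not> int p dvd 3 * u"
      using e5[OF True] pp True dvd3 by (simp add: prime_dvd_mult_iff)
    hence "int p ^ j dvd F * (t1 - t2)"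
      using d' cancel[of j "3 * u" "F * (t1 - t2)"] by (simp add: mult.assoc)
    ultimately have "int p ^ (j - 1) dvd t1 - t2"
      by (intro cancel1)
    thus ?thesis
      using True by simp
  next
    case False
    have "\<not> int p dvd F"
    proof
      assume "int p dvd F"
      moreover have "F = 5 * t2 ^ 4 + int p * (y * (10 * t2 ^ 3) + y * (int p * y) * (10 * t2 ^ 2 + 5 * t2 * (int p * y) + (int p * y) ^ 2))"
        unfolding F by (simp add: algebra_simps power2_eq_square)
      ultimately have "int p dvd 5 * t2 ^ 4"
        by (simp only: dvd_add_left_iff dvd_triv_left)
      thus False
        using pp t2 dvd5 False by (simp add: prime_dvd_mult_iff prime_dvd_power_iff)
    qed
    hence *: "int p ^ j dvd 3 * u * (t1 - t2)"
      using d' cancel[of j F "3 * u * (t1 - t2)"] by (simp add: mult_ac)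
    show ?thesis
    proof (cases "p \<ge> 7")
      case True
      have "\<not> int p dvd 3 * u"
        using e(2)[OF True] pp True dvd3 by (simp add: prime_dvd_mult_iff)
      from cancel[OF * this] show ?thesis
        using True by simp
    next
      case F: False
      from cancel1[OF * e(1)] show ?thesis
        using F by simp
    qed
  qed
qed

text \<open>Critical points satisfy 3 u t^5 = 2 v modulo p^j. They lie in at most 5 classes modulo
  \<open>p\<close>, by the degree if p \<ge> 7 and trivially otherwise. A class holds one of them if
  p \<ge> 7, and at most p \<le> 5 otherwise; hence 25.\<close>

lemma card_critical_points_le:
  assumes p: "prime p" and j: "j \<ge> 1" and uv: "\<not> (int p dvd u \<and> int p dvd v)"
  shows "card {(t, s) \<in> inv_pairs (p ^ j). int p ^ j dvd 3 * u * t ^ 3 - 2 * v * s ^ 2} \<le> 25"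
proof -
  have pp: "prime (int p)"
    using p by simp
  define R where "R = {(t, s) \<in> inv_pairs (p ^ j). int p ^ j dvd 3 * u * t ^ 3 - 2 * v * s ^ 2}"
  define A where "A = fst ` R"
  have finR: "finite R"
    by (rule finite_subset[of _ "inv_pairs (p ^ j)"]) (auto simp: R_def)
  have inj: "inj_on fst R"
    by (rule inj_on_subset[OF inj_on_fst_inv_pairs[of "p ^ j"]]) (auto simp: R_def)
  have pj: "int p dvd int p ^ j"
    using j by (simp add: dvd_power)
  have At: "t \<in> {0..<int p ^ j} \<and> \<not> int p dvd t \<and> int p ^ j dvd 3 * u * t ^ 5 - 2 * v" if "t \<in> A" for t
  proof -
    obtain s where ts: "(t, s) \<in> inv_pairs (p ^ j)" "int p ^ j dvd 3 * u * t ^ 3 - 2 * v * s ^ 2"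
      using \<open>t \<in> A\<close> by (auto simp: A_def R_def)
    have c: "[t * s = 1] (mod int p ^ j)" "t \<in> {0..<int p ^ j}"
      using ts by (auto simp: inv_pairs_def)
    have "\<not> int p dvd t"
    proof
      assume "int p dvd t"
      hence "int p dvd t * s"
        by simp
      moreover have "int p dvd t * s - 1"
        using c(1) pj by (meson cong_iff_dvd_diff dvd_trans)
      ultimately have "int p dvd 1"
        using dvd_diff[of "int p" "t * s" "t * s - 1"] by simp
      thus False
        using pp by (simp add: not_prime_unit)
    qed
    moreover have "int p ^ j dvd 3 * u * t ^ 5 - 2 * v"
    proof -
      have "int p ^ j dvd t ^ 2 * (3 * u * t ^ 3 - 2 * v * s ^ 2)"
        using ts(2) by (rule dvd_mult)
      moreover have "t ^ 2 * (3 * u * t ^ 3 - 2 * v * s ^ 2) = (3 * u * t ^ 5 - 2 * v) - 2 * v * ((t * s) ^ 2 - 1)"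
        by (simp add: algebra_simps power_numeral_reduce)
      moreover have "int p ^ j dvd (t * s) ^ 2 - 1"
        using cong_pow[OF c(1), of 2] by (simp add: cong_iff_dvd_diff)
      hence "int p ^ j dvd 2 * v * ((t * s) ^ 2 - 1)"
        by (rule dvd_mult)
      ultimately show ?thesis
        using dvd_add[of "int p ^ j" "(3 * u * t ^ 5 - 2 * v) - 2 * v * ((t * s) ^ 2 - 1)" "2 * v * ((t * s) ^ 2 - 1)"]
        by simp
    qed
    ultimately show ?thesis
      using c(2) by blast
  qed
  show ?thesis
  proof (cases "A = {}")
    case True
    thus ?thesis
      by (simp add: A_def R_def[symmetric])
  next
    case False
    then obtain t0 where t0: "t0 \<in> A"
      by blast
    note T0 = At[OF t0]
    have p_t0: "int p dvd 3 * u * t0 ^ 5 - 2 * v"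
      using T0 pj dvd_trans by blast
    have p2: "int p dvd 2 \<longleftrightarrow> p = 2"
    proof
      assume "int p dvd 2"
      hence "p dvd 2"
        by (metis int_dvd_int_iff of_nat_numeral)
      thus "p = 2"
        using p primes_dvd_imp_eq two_is_prime_nat by blast
    qed simp
    \<comment> \<open>A critical point then makes \<open>p\<close> divide 2 v, but \<open>p\<close>
      does not divide \<open>v\<close>.\<close>
    have p_u: "p = 2" if "int p dvd u"
    proof -
      have "int p dvd 3 * u * t0 ^ 5"
        using that by simp
      hence "int p dvd 2 * v"
        using p_t0 dvd_diff[of "int p" "3 * u * t0 ^ 5" "3 * u * t0 ^ 5 - 2 * v"] by simp
      thus ?thesis
        using that uv pp p2 by (simp add: prime_dvd_mult_iff)
    qed
    \<comment> \<open>For p = 3 a second factor would divide \<open>u\<close>, contrary to the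
      previous step; for p = 2, a multiple of 4 would make 2 divide \<open>v\<close> too.\<close>
    have u2: "\<not> int p ^ 2 dvd 3 * u" if j2: "j \<ge> 2"
    proof
      assume h: "int p ^ 2 dvd 3 * u"
      have "int p dvd 3 * u"
        using h by (meson dvd_trans dvd_power zero_less_numeral)
      hence "p = 3 \<or> int p dvd u"
      proof -
        have "p = 3" if "int p dvd 3"
        proof -
          have "p dvd 3"
            using that by (metis int_dvd_int_iff of_nat_numeral)
          moreover have "prime (3 :: nat)"
            by simp
          ultimately show ?thesis
            using p primes_dvd_imp_eq by blast
        qed
        thus ?thesis
          using \<open>int p dvd 3 * u\<close> pp by (auto simp: prime_dvd_mult_iff)
      qed
      thus False
      proof
        assume "p = 3"
        hence "int p dvd u"
          using h by (auto simp: power2_eq_square)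
        thus False
          using p_u \<open>p = 3\<close> by simp
      next
        assume pu: "int p dvd u"
        have p_eq: "p = 2"
          by (rule p_u[OF pu])
        have "int p ^ 2 dvd 3 * u * t0 ^ 5 - 2 * v"
          using T0 j2 le_imp_power_dvd dvd_trans by blast
        moreover have "int p ^ 2 dvd 3 * u * t0 ^ 5"
          using h by (rule dvd_mult2)
        ultimately have "int p ^ 2 dvd 2 * v"
          using dvd_diff[of "int p ^ 2" "3 * u * t0 ^ 5" "3 * u * t0 ^ 5 - 2 * v"] by simp
        hence "int p dvd v"
          by (auto simp: p_eq power2_eq_square)
        thus False
          using uv pu by simp
      qed
    qed
    define m where "m = (if p \<ge> 7 then j else j - 1)"
    have close: "int p ^ m dvd t1 - t2" if "t1 \<in> A" "t2 \<in> A" "[t1 = t2] (mod int p)" for t1 t2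
    proof (cases "j \<ge> 2 \<or> p \<ge> 7")
      case True
      have "int p ^ j dvd (3 * u * t1 ^ 5 - 2 * v) - (3 * u * t2 ^ 5 - 2 * v)"
        using At[OF that(1)] At[OF that(2)] by (intro dvd_diff[OF conjunct2[OF conjunct2] conjunct2[OF conjunct2]])
      hence d: "int p ^ j dvd 3 * u * (t1 ^ 5 - t2 ^ 5)"
        by (simp add: algebra_simps)
      have n2: "\<not> int p ^ 2 dvd 3 * u"
      proof (cases "j \<ge> 2")
        case False
        hence p7: "p \<ge> 7"
          using True by simp
        show ?thesis
        proof
          assume "int p ^ 2 dvd 3 * u"
          hence "int p dvd 3 * u"
            by (meson dvd_trans dvd_power zero_less_numeral)
          moreover have "\<not> int p dvd 3"
            using p7 zdvd_not_zless[of 3 "int p"] by simp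
          ultimately have "int p dvd u"
            using pp by (simp add: prime_dvd_mult_iff)
          thus False
            using p_u p7 by simp
        qed
      qed (rule u2)
      show ?thesis
        unfolding m_def using At[OF that(1)] p_u
        by (intro prime_power_cong_fifth[OF p that(3) _ d n2]) auto
    next
      case False
      hence "m = 0"
        using j by (simp add: m_def)
      thus ?thesis
        by simp
    qed
    define B where "B = (\<lambda>t. t mod int p) ` A"
    have finA: "finite A"
      using finR by (simp add: A_def)
    have finB: "finite B"
      using finA by (simp add: B_def)
    have p0: "p > 0"
      using p by (simp add: prime_gt_0_nat)
    have cardB: "card B \<le> 5"
    proof (cases "p \<ge> 7")
      case True
      define F where "F = monom (3 * u) 5 - [:2 * v:]"
      have nu: "\<not> int p dvd 3 * u"
      proof -
        have "\<not> int p dvd 3"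
          using True zdvd_not_zless[of 3 "int p"] by simp
        thus ?thesis
          using p_u True pp by (auto simp: prime_dvd_mult_iff)
      qed
      hence u0: "u \<noteq> 0"
        by auto
      have degF: "degree F = 5"
        using u0 unfolding F_def diff_conv_add_uminus
        by (subst degree_add_eq_left) (auto simp: degree_monom_eq)
      have lF: "lead_coeff F = 3 * u"
        unfolding degF by (simp add: F_def coeff_pCons)
      have "B \<subseteq> {x \<in> {0..<int p}. int p dvd poly F x}"
      proof
        fix x assume "x \<in> B"
        then obtain t where t: "t \<in> A" "x = t mod int p"
          by (auto simp: B_def)
        have "int p dvd 3 * u * t ^ 5 - 2 * v"
          using At[OF t(1)] pj dvd_trans by blast
        moreover have "[3 * u * x ^ 5 - 2 * v = 3 * u * t ^ 5 - 2 * v] (mod int p)"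
          unfolding t(2) by (intro cong_diff cong_mult cong_pow) auto
        ultimately have "int p dvd 3 * u * x ^ 5 - 2 * v"
          using cong_dvd_iff by blast
        thus "x \<in> {x \<in> {0..<int p}. int p dvd poly F x}"
          using t(2) p0 by (simp add: F_def poly_monom)
      qed
      moreover have "finite {x \<in> {0..<int p}. int p dvd poly F x}"
        by (rule finite_subset[of _ "{0..<int p}"]) auto
      ultimately have "card B \<le> card {x \<in> {0..<int p}. int p dvd poly F x}"
        by (intro card_mono)
      also have "\<dots> \<le> degree F"
        by (rule card_roots_mod_prime[OF p]) (simp add: lF nu)
      finally show ?thesis
        by (simp add: degF)
    next
      case False
      have "p \<noteq> 6"
        using p by auto
      hence "p \<le> 5"
        using False by linarith
      moreover have "B \<subseteq> {0..<int p}"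
        using p0 by (auto simp: B_def)
      hence "card B \<le> card {0..<int p}"
        by (intro card_mono) auto
      ultimately show ?thesis
        by simp
    qed
    have fib: "card {t \<in> A. t mod int p = x} \<le> 5" if xB: "x \<in> B" for x
    proof (cases "p \<ge> 7")
      case True
      have "t1 = t2" if t12: "t1 \<in> {t \<in> A. t mod int p = x}" "t2 \<in> {t \<in> A. t mod int p = x}" for t1 t2
      proof -
        have "[t1 = t2] (mod int p)"
          using t12 by (simp add: cong_def)
        with t12 have "int p ^ m dvd t1 - t2"
          by (intro close) auto
        hence "[t1 = t2] (mod int p ^ j)"
          using True by (simp add: m_def cong_iff_dvd_diff)
        thus ?thesis
          using At[of t1] At[of t2] t12 by (auto simp: cong_def)
      qed
      hence "card {t \<in> A. t mod int p = x} \<le> Suc 0"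
        using finA by (intro card_le_Suc0_iff_eq[THEN iffD2]) auto
      thus ?thesis
        by simp
    next
      case False
      have "p \<noteq> 6"
        using p by auto
      hence p5: "p \<le> 5"
        using False by linarith
      obtain t1 where t1: "t1 \<in> A" "t1 mod int p = x"
        using xB unfolding B_def by blast
      \<comment> \<open>The points of a class agree modulo p^(j-1), which leaves \<open>p\<close>
        choices for the last digit.\<close>
      have "{t \<in> A. t mod int p = x} \<subseteq> (\<lambda>r. t1 mod int p ^ (j - 1) + int p ^ (j - 1) * r) ` {0..<int p}"
      proof
        fix t assume t: "t \<in> {t \<in> A. t mod int p = x}"
        have "int p ^ (j - 1) dvd t - t1"
          using close[of t t1] t t1 False by (auto simp: m_def cong_def)
        hence m: "t mod int p ^ (j - 1) = t1 mod int p ^ (j - 1)"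
          by (simp add: mod_eq_dvd_iff)
        have e: "t = t1 mod int p ^ (j - 1) + int p ^ (j - 1) * (t div int p ^ (j - 1))"
          unfolding m[symmetric] by simp
        have "int p ^ j = int p ^ (j - 1) * int p"
          using j by (cases j) auto
        hence "t < int p * int p ^ (j - 1)"
          using At[of t] t by (simp add: mult.commute)
        hence "t div int p ^ (j - 1) < int p"
          using p0 by (intro int_div_less) auto
        moreover have "t div int p ^ (j - 1) \<ge> 0"
          using At[of t] t p0 by (simp add: pos_imp_zdiv_nonneg_iff)
        ultimately show "t \<in> (\<lambda>r. t1 mod int p ^ (j - 1) + int p ^ (j - 1) * r) ` {0..<int p}"
          using e by (intro image_eqI[of _ _ "t div int p ^ (j - 1)"]) auto
      qed
      hence "card {t \<in> A. t mod int p = x} \<le> card ((\<lambda>r. t1 mod int p ^ (j - 1) + int p ^ (j - 1) * r) ` {0..<int p})"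
        by (intro card_mono) auto
      also have "\<dots> \<le> card {0..<int p}"
        by (rule card_image_le) simp
      finally show ?thesis
        using p5 by simp
    qed
    have "card R = card A"
      unfolding A_def using inj by (simp add: card_image)
    also have "A = (\<Union>x\<in>B. {t \<in> A. t mod int p = x})"
      by (auto simp: B_def)
    also have "card \<dots> \<le> (\<Sum>x\<in>B. card {t \<in> A. t mod int p = x})"
      by (rule card_UN_le[OF finB])
    also have "\<dots> \<le> (\<Sum>x\<in>B. 5)"
      by (intro sum_mono fib)
    also have "\<dots> \<le> 25"
      using cardB by simp
    finally show ?thesis
      by (simp add: R_def)
  qed
qed

lemma sum_case_prod_const: "(\<Sum>(t, s)\<in>S. c * F t s) = c * (\<Sum>(t, s)\<in>S. F t s)" for c :: complex
  by (simp add: sum_distrib_left case_prod_unfold)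

text \<open>Stationary phase: the substitution \<open>t \<mapsto> t (1 + p\<^sup>m z)\<close> leaves only the critical points.\<close>

lemma expo_sum_prime_power_critical:
  assumes p: "prime p" and k: "k = j + m" "j \<le> m" "m \<ge> 1"
  shows "expo_sum (p ^ k) u v = (\<Sum>(t, s)\<in>{(t, s) \<in> inv_pairs (p ^ k). int p ^ j dvd 3 * u * t ^ 3 - 2 * v * s ^ 2}.
     e_mod (p ^ k) (u * t ^ 3 + v * s ^ 2))"
proof -
  define q where "q = p ^ k"
  have p0: "p > 0"
    using p by (simp add: prime_gt_0_nat)
  have q0: "q > 0"
    using p0 by (simp add: q_def)
  have q: "int q = int p ^ j * int p ^ m"
    by (simp add: q_def k(1) power_add)
  have q2: "int q dvd int p ^ m * int p ^ m"
    unfolding q using k(2) by (intro mult_dvd_mono le_imp_power_dvd dvd_refl)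
  have shift: "expo_sum q u v = (\<Sum>(t, s)\<in>inv_pairs q. e_mod q (u * t ^ 3 + v * s ^ 2) *
     e_mod (p ^ j) (int z * (3 * u * t ^ 3 - 2 * v * s ^ 2)))" for z :: nat
  proof -
    define x where "x = int p ^ m * int z"
    have x2: "int q dvd x * x"
      using dvd_mult2[OF q2, of "int z * int z"] by (simp add: x_def mult_ac)
    have w: "[(1 + x) * (1 - x) = 1] (mod int q)"
      using x2 by (simp add: cong_iff_dvd_diff algebra_simps)
    have "expo_sum q u v = (\<Sum>(t, s)\<in>inv_pairs q. e_mod q (u * ((t * (1 + x)) mod int q) ^ 3 + v * ((s * (1 - x)) mod int q) ^ 2))"
      unfolding expo_sum_def using inv_pairs_shift q0 by (intro sum_inv_pairs_shift[OF w q0]) auto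
    also have "\<dots> = (\<Sum>(t, s)\<in>inv_pairs q. e_mod q (u * t ^ 3 + v * s ^ 2) *
       e_mod (p ^ j) (int z * (3 * u * t ^ 3 - 2 * v * s ^ 2)))"
    proof (rule sum.cong[OF refl], clarify)
      fix t s
      let ?D = "3 * u * t ^ 3 - 2 * v * s ^ 2"
      have "u * (t * (1 + x)) ^ 3 + v * (s * (1 - x)) ^ 2 - ((u * t ^ 3 + v * s ^ 2) + x * ?D) =
         (x * x) * (u * t ^ 3 * (3 + x) + v * s ^ 2)"
        by (simp add: algebra_simps power2_eq_square power3_eq_cube)
      hence "[u * (t * (1 + x)) ^ 3 + v * (s * (1 - x)) ^ 2 = (u * t ^ 3 + v * s ^ 2) + x * ?D] (mod int q)"
        using x2 by (simp add: cong_iff_dvd_diff)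
      hence "e_mod q (u * ((t * (1 + x)) mod int q) ^ 3 + v * ((s * (1 - x)) mod int q) ^ 2) =
         e_mod q (u * t ^ 3 + v * s ^ 2) * e_mod q (x * ?D)"
        unfolding e_mod_poly_mod e_mod_add[symmetric] by (rule e_mod_cong)
      moreover have "e_mod q (x * ?D) = e_mod (p ^ j) (int z * ?D)"
        using p0 e_mod_scale[of "p ^ m" "p ^ j" "int z * ?D"]
        by (simp add: x_def q_def k(1) power_add mult_ac)
      ultimately show "e_mod q (u * ((t * (1 + x)) mod int q) ^ 3 + v * ((s * (1 - x)) mod int q) ^ 2) =
         e_mod q (u * t ^ 3 + v * s ^ 2) * e_mod (p ^ j) (int z * ?D)"
        by simp
    qed
    finally show ?thesis .
  qed
  let ?c = "of_nat (p ^ j) :: complex"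
  have "?c * expo_sum q u v = (\<Sum>z<p ^ j. expo_sum q u v)"
    by simp
  also have "\<dots> = (\<Sum>z<p ^ j. \<Sum>(t, s)\<in>inv_pairs q. e_mod q (u * t ^ 3 + v * s ^ 2) *
     e_mod (p ^ j) (int z * (3 * u * t ^ 3 - 2 * v * s ^ 2)))"
    by (intro sum.cong refl shift)
  also have "\<dots> = (\<Sum>(t, s)\<in>inv_pairs q. e_mod q (u * t ^ 3 + v * s ^ 2) *
     (\<Sum>z<p ^ j. e_mod (p ^ j) (int z * (3 * u * t ^ 3 - 2 * v * s ^ 2))))"
    by (subst sum.swap) (simp add: case_prod_unfold sum_distrib_left)
  also have "\<dots> = (\<Sum>(t, s)\<in>inv_pairs q. if int p ^ j dvd 3 * u * t ^ 3 - 2 * v * s ^ 2 then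
     ?c * e_mod q (u * t ^ 3 + v * s ^ 2) else 0)"
  proof (rule sum.cong[OF refl], clarify)
    fix t s
    show "e_mod q (u * t ^ 3 + v * s ^ 2) * (\<Sum>z<p ^ j. e_mod (p ^ j) (int z * (3 * u * t ^ 3 - 2 * v * s ^ 2))) =
       (if int p ^ j dvd 3 * u * t ^ 3 - 2 * v * s ^ 2 then ?c * e_mod q (u * t ^ 3 + v * s ^ 2) else 0)"
      using p0 sum_e_mod_multiples[of "p ^ j" "3 * u * t ^ 3 - 2 * v * s ^ 2"] by simp
  qed
  also have "\<dots> = (\<Sum>(t, s)\<in>{(t, s) \<in> inv_pairs q. int p ^ j dvd 3 * u * t ^ 3 - 2 * v * s ^ 2}.
     ?c * e_mod q (u * t ^ 3 + v * s ^ 2))"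
    by (auto simp: case_prod_unfold sum.inter_filter intro!: sum.cong)
  also have "\<dots> = ?c * (\<Sum>(t, s)\<in>{(t, s) \<in> inv_pairs q. int p ^ j dvd 3 * u * t ^ 3 - 2 * v * s ^ 2}.
     e_mod q (u * t ^ 3 + v * s ^ 2))"
    by (rule sum_case_prod_const)
  finally show ?thesis
    using p0 by (simp add: q_def)
qed

text \<open>Criticality depends on residues modulo p^j only, and \<open>t\<close> determines
  \<open>s\<close>, so a critical point has at most p^m lifts.\<close>

lemma card_critical_lift:
  assumes p: "prime p" and j: "j \<ge> 1" and uv: "\<not> (int p dvd u \<and> int p dvd v)"
  shows "card {(t, s) \<in> inv_pairs (p ^ (j + m)). int p ^ j dvd 3 * u * t ^ 3 - 2 * v * s ^ 2} \<le> 25 * p ^ m"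
proof -
  define R where "R = {(t, s) \<in> inv_pairs (p ^ (j + m)). int p ^ j dvd 3 * u * t ^ 3 - 2 * v * s ^ 2}"
  define R0 where "R0 = {(t, s) \<in> inv_pairs (p ^ j). int p ^ j dvd 3 * u * t ^ 3 - 2 * v * s ^ 2}"
  have p0: "p > 0"
    using p by (simp add: prime_gt_0_nat)
  have finR0: "finite R0"
    by (rule finite_subset[of _ "inv_pairs (p ^ j)"]) (auto simp: R0_def)
  have P: "int (p ^ (j + m)) = int p ^ j * int p ^ m"
    by (simp add: power_add)
  define g where "g = (\<lambda>(t :: int, s :: int). ((t mod int p ^ j, s mod int p ^ j), t div int p ^ j))"
  have "g ` R \<subseteq> R0 \<times> {0..<int p ^ m}"
  proof safe
    fix t s t' s' r assume ts: "(t, s) \<in> R" and g: "((t', s'), r) = g (t, s)"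
    have t': "t' = t mod int p ^ j" "s' = s mod int p ^ j" "r = t div int p ^ j"
      using g by (simp_all add: g_def)
    have t: "t \<in> {0..<int p ^ j * int p ^ m}" "[t * s = 1] (mod int p ^ j * int p ^ m)"
      "int p ^ j dvd 3 * u * t ^ 3 - 2 * v * s ^ 2"
      using ts by (auto simp: R_def inv_pairs_def power_add)
    have "[t * s = 1] (mod int p ^ j)"
      using t(2) by (rule cong_modulus_mult)
    hence "[t' * s' = 1] (mod int p ^ j)"
      by (simp add: t' cong_def mod_mult_eq)
    moreover have "[3 * u * t' ^ 3 - 2 * v * s' ^ 2 = 3 * u * t ^ 3 - 2 * v * s ^ 2] (mod int p ^ j)"
      unfolding t' by (intro cong_diff cong_mult cong_pow) auto
    hence "int p ^ j dvd 3 * u * t' ^ 3 - 2 * v * s' ^ 2"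
      using t(3) cong_dvd_iff by blast
    ultimately show "(t', s') \<in> R0"
      using p0 by (simp add: R0_def inv_pairs_def t')
    have "r < int p ^ m"
      unfolding t' using t(1) p0 by (intro int_div_less) (auto simp: mult.commute)
    moreover have "r \<ge> 0"
      unfolding t' using t(1) p0 by (simp add: pos_imp_zdiv_nonneg_iff)
    ultimately show "r \<in> {0..<int p ^ m}"
      by simp
  qed
  moreover have "inj_on g R"
  proof (rule inj_onI)
    fix x y assume xy: "x \<in> R" "y \<in> R" "g x = g y"
    obtain t s t' s' where [simp]: "x = (t, s)" "y = (t', s')"
      by (metis surj_pair)
    have m: "t mod int p ^ j = t' mod int p ^ j" "t div int p ^ j = t' div int p ^ j"
      using xy(3) by (auto simp: g_def)
    have "t = t'"
      using div_mult_mod_eq[of t "int p ^ j"] div_mult_mod_eq[of t' "int p ^ j"] m by metis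
    thus "x = y"
      using xy(1,2) inv_pairs_unique[of t s "p ^ (j + m)" s'] by (auto simp: R_def)
  qed
  ultimately have "card R \<le> card (R0 \<times> {0..<int p ^ m})"
    using finR0 by (intro card_inj_on_le) auto
  also have "\<dots> = card R0 * p ^ m"
    by (simp add: card_cartesian_product nat_power_eq)
  also have "\<dots> \<le> 25 * p ^ m"
    unfolding R0_def by (intro mult_right_mono card_critical_points_le assms) simp
  finally show ?thesis
    by (simp add: R_def)
qed

lemma norm_sum_e_mod_le: "finite S \<Longrightarrow> norm (\<Sum>(t, s)\<in>S. e_mod q (F t s)) \<le> real (card S)"
  using sum_norm_le[of S "\<lambda>(t, s). e_mod q (F t s)" "\<lambda>_. 1"] by (auto simp: case_prod_unfold)

text \<open>The hypothesis \<open>j \<le> m\<close> admits m = j + 1 besides m = j. This cruder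
  bound for odd exponents settles the primes below 7.\<close>

lemma expo_sum_even_prime_power:
  assumes p: "prime p" and j: "j \<ge> 1" and uv: "\<not> (int p dvd u \<and> int p dvd v)"
    and k: "k = j + m" "j \<le> m"
  shows "norm (expo_sum (p ^ k) u v) \<le> 25 * real p ^ m"
proof -
  let ?S = "{(t, s) \<in> inv_pairs (p ^ k). int p ^ j dvd 3 * u * t ^ 3 - 2 * v * s ^ 2}"
  have "finite ?S"
    by (rule finite_subset[of _ "inv_pairs (p ^ k)"]) auto
  hence "norm (expo_sum (p ^ k) u v) \<le> real (card ?S)"
    using j k by (subst expo_sum_prime_power_critical[OF p k]) (auto intro: norm_sum_e_mod_le)
  also have "\<dots> \<le> real (25 * p ^ m)"
    unfolding of_nat_le_iff k(1) by (rule card_critical_lift[OF p j uv])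
  finally show ?thesis
    by simp
qed

text \<open>After restriction to the critical points, the finer substitution t (1 + p^j z) produces
  a quadratic phase in \<open>z\<close> modulo \<open>p\<close>. Averaging over \<open>z\<close>
  puts a Gauss sum of size sqrt(p), divided by \<open>p\<close>, at each of at most 25 p^(j+1)
  points.\<close>

lemma expo_sum_odd_prime_power:
  assumes p: "prime p" "p \<ge> 7" and j: "j \<ge> 1" and uv: "\<not> (int p dvd u \<and> int p dvd v)"
  shows "norm (expo_sum (p ^ (2 * j + 1)) u v) \<le> 25 * real p ^ j * sqrt (real p)"
proof -
  define q where "q = p ^ (2 * j + 1)"
  define D where "D = (\<lambda>t s. 3 * u * t ^ 3 - 2 * v * s ^ 2)"
  define T where "T = {(t, s) \<in> inv_pairs q. int p ^ j dvd D t s}"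
  have pp: "prime (int p)"
    using p by simp
  have p0: "p > 0"
    using p by simp
  have q0: "q > 0"
    using p0 by (simp add: q_def)
  have q: "int q = int p ^ j * (int p ^ j * int p)"
    by (simp add: q_def power_add mult_2)
  have finT: "finite T"
    by (rule finite_subset[of _ "inv_pairs q"]) (auto simp: T_def)
  have KT: "expo_sum q u v = (\<Sum>(t, s)\<in>T. e_mod q (u * t ^ 3 + v * s ^ 2))"
    unfolding q_def T_def D_def by (rule expo_sum_prime_power_critical[OF p(1), of _ j "j + 1"]) auto
  have inner: "norm (\<Sum>z<p. e_mod p (3 * (u * t ^ 3 + v * s ^ 2) * int z ^ 2 + D t s div int p ^ j * int z)) = sqrt (real p)"
    if ts: "(t, s) \<in> T" for t s
  proof (rule norm_gauss_sum)
    \<comment> \<open>If \<open>p\<close> divided this as well as \<open>D t s\<close>, it would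
      divide 5 v s^2 and then 3 u t^3, hence both \<open>u\<close> and \<open>v\<close>.\<close>
    show "\<not> int p dvd 3 * (u * t ^ 3 + v * s ^ 2)"
    proof
      assume h: "int p dvd 3 * (u * t ^ 3 + v * s ^ 2)"
      have "int p dvd int p ^ j"
        using j by (simp add: dvd_power)
      hence d: "int p dvd D t s"
        using ts by (auto simp: T_def intro: dvd_trans)
      have np: "\<not> int p dvd 5" "\<not> int p dvd 3"
        using p(2) zdvd_not_zless[of 5 "int p"] zdvd_not_zless[of 3 "int p"] by simp_all
      have c: "[t * s = 1] (mod int p)"
      proof -
        have "[t * s = 1] (mod int q)"
          using ts by (simp add: T_def inv_pairs_def)
        moreover have "int p dvd int q"
          by (simp add: q)
        ultimately show ?thesis
          by (rule cong_dvd_modulus)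
      qed
      have nts: "\<not> int p dvd t" "\<not> int p dvd s"
      proof -
        have "\<not> int p dvd t * s"
          using cong_dvd_iff[OF c] pp not_prime_unit by blast
        thus "\<not> int p dvd t" "\<not> int p dvd s"
          by auto
      qed
      have "int p dvd 3 * (u * t ^ 3 + v * s ^ 2) - D t s"
        using h d by (rule dvd_diff)
      hence "int p dvd 5 * (v * s ^ 2)"
        by (simp add: D_def algebra_simps)
      hence v: "int p dvd v"
        using np nts pp by (simp add: prime_dvd_mult_iff prime_dvd_power_iff)
      have "int p dvd D t s + 2 * v * s ^ 2"
        using d v by (intro dvd_add) auto
      hence "int p dvd 3 * (u * t ^ 3)"
        by (simp add: D_def mult.assoc)
      hence "int p dvd u"
        using np nts pp by (simp add: prime_dvd_mult_iff prime_dvd_power_iff)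
      with v uv show False
        by simp
    qed
  qed (use p in auto)
  have shift: "expo_sum q u v = (\<Sum>(t, s)\<in>T. e_mod q (u * t ^ 3 + v * s ^ 2) *
     e_mod p (3 * (u * t ^ 3 + v * s ^ 2) * int z ^ 2 + D t s div int p ^ j * int z))" for z :: nat
  proof -
    define x where "x = int p ^ j * int z"
    have x3: "int q dvd x ^ 3"
    proof -
      have "int p dvd int p ^ j"
        using j by (simp add: dvd_power)
      hence "int q dvd int p ^ j * (int p ^ j * int p ^ j)"
        unfolding q by (intro mult_dvd_mono dvd_refl)
      hence "int q dvd int p ^ j * (int p ^ j * int p ^ j) * (int z ^ 3)"
        by (rule dvd_mult2)
      thus ?thesis
        by (simp add: x_def power3_eq_cube mult_ac)
    qed
    \<comment> \<open>Here x^3, but not x^2 in general, vanishes modulo \<open>q\<close>, so the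
      inverse is taken to second order; 3 j \<ge> 2 j + 1 is used.\<close>
    have w: "[(1 + x) * (1 - x + x ^ 2) = 1] (mod int q)"
    proof -
      have "(1 + x) * (1 - x + x ^ 2) - 1 = x ^ 3"
        by (simp add: algebra_simps power2_eq_square power3_eq_cube)
      thus ?thesis
        using x3 by (simp add: cong_iff_dvd_diff)
    qed
    have pjx: "int p ^ j dvd x"
      by (simp add: x_def)
    have pjq: "int p ^ j dvd int q"
      by (simp add: q)
    have stable: "((t * a) mod int q, (s * b) mod int q) \<in> T"
      if "(t, s) \<in> inv_pairs q" "[a * b = 1] (mod int q)"
        "(a = 1 + x \<and> b = 1 - x + x ^ 2) \<or> (a = 1 - x + x ^ 2 \<and> b = 1 + x)" "(t, s) \<in> T" for t s a b
    proof -
      have ab: "[a = 1] (mod int p ^ j)" "[b = 1] (mod int p ^ j)"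
        using that(3) pjx by (auto simp: cong_iff_dvd_diff power2_eq_square)
      have "[(t * a) mod int q = t * a] (mod int p ^ j)" "[(s * b) mod int q = s * b] (mod int p ^ j)"
        by (rule cong_dvd_modulus[OF _ pjq], simp)+
      moreover have "[t * a = t * 1] (mod int p ^ j)" "[s * b = s * 1] (mod int p ^ j)"
        using cong_mult[OF cong_refl ab(1), of t] cong_mult[OF cong_refl ab(2), of s] by blast+
      ultimately have "[(t * a) mod int q = t] (mod int p ^ j)" "[(s * b) mod int q = s] (mod int p ^ j)"
        by (metis cong_trans mult.right_neutral)+
      hence "[D ((t * a) mod int q) ((s * b) mod int q) = D t s] (mod int p ^ j)"
        unfolding D_def by (intro cong_diff cong_mult cong_pow cong_refl)
      moreover have "int p ^ j dvd D t s"
        using that(4) by (simp add: T_def)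
      ultimately have "int p ^ j dvd D ((t * a) mod int q) ((s * b) mod int q)"
        using cong_dvd_iff by blast
      thus ?thesis
        using inv_pairs_shift[OF that(1,2) q0] by (simp add: T_def)
    qed
    have "expo_sum q u v = (\<Sum>(t, s)\<in>T. e_mod q (u * ((t * (1 + x)) mod int q) ^ 3 + v * ((s * (1 - x + x ^ 2)) mod int q) ^ 2))"
      unfolding KT
    proof (rule sum_inv_pairs_shift[OF w q0])
      show "T \<subseteq> inv_pairs q"
        by (auto simp: T_def)
    qed (rule stable)
    also have "\<dots> = (\<Sum>(t, s)\<in>T. e_mod q (u * t ^ 3 + v * s ^ 2) *
       e_mod p (3 * (u * t ^ 3 + v * s ^ 2) * int z ^ 2 + D t s div int p ^ j * int z))"
    proof (rule sum.cong[OF refl], clarify)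
      fix t s assume ts: "(t, s) \<in> T"
      let ?E = "u * t ^ 3 + v * s ^ 2"
      have Dj: "D t s = int p ^ j * (D t s div int p ^ j)"
        using ts by (simp add: T_def)
      have "u * (t * (1 + x)) ^ 3 + v * (s * (1 - x + x ^ 2)) ^ 2 - (?E + (x * D t s + 3 * x ^ 2 * ?E)) =
         x ^ 3 * (u * t ^ 3 + v * s ^ 2 * (x - 2))"
        by (simp add: D_def algebra_simps power2_eq_square power3_eq_cube)
      hence "[u * (t * (1 + x)) ^ 3 + v * (s * (1 - x + x ^ 2)) ^ 2 = ?E + (x * D t s + 3 * x ^ 2 * ?E)] (mod int q)"
        using x3 by (simp add: cong_iff_dvd_diff)
      hence "e_mod q (u * ((t * (1 + x)) mod int q) ^ 3 + v * ((s * (1 - x + x ^ 2)) mod int q) ^ 2) =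
         e_mod q ?E * e_mod q (x * D t s + 3 * x ^ 2 * ?E)"
        unfolding e_mod_poly_mod e_mod_add[symmetric] by (rule e_mod_cong)
      moreover have "e_mod q (x * D t s + 3 * x ^ 2 * ?E) = e_mod p (3 * ?E * int z ^ 2 + D t s div int p ^ j * int z)"
      proof -
        have "x * D t s + 3 * x ^ 2 * ?E = (int p ^ j * int p ^ j) * (3 * ?E * int z ^ 2 + D t s div int p ^ j * int z)"
          by (subst Dj) (simp add: x_def algebra_simps power2_eq_square)
        moreover have "e_mod q ((int p ^ j * int p ^ j) * n) = e_mod p n" for n
        proof -
          have "q = (p ^ j * p ^ j) * p"
            by (simp add: q_def power_add mult_2)
          thus ?thesis
            using p0 e_mod_scale[of "p ^ j * p ^ j" p n] by simp
        qed
        ultimately show ?thesis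
          by simp
      qed
      ultimately show "e_mod q (u * ((t * (1 + x)) mod int q) ^ 3 + v * ((s * (1 - x + x ^ 2)) mod int q) ^ 2) =
         e_mod q ?E * e_mod p (3 * ?E * int z ^ 2 + D t s div int p ^ j * int z)"
        by simp
    qed
    finally show ?thesis .
  qed
  have "of_nat p * expo_sum q u v = (\<Sum>z<p. expo_sum q u v)"
    by simp
  also have "\<dots> = (\<Sum>z<p. \<Sum>(t, s)\<in>T. e_mod q (u * t ^ 3 + v * s ^ 2) *
     e_mod p (3 * (u * t ^ 3 + v * s ^ 2) * int z ^ 2 + D t s div int p ^ j * int z))"
    by (intro sum.cong refl shift)
  also have "\<dots> = (\<Sum>(t, s)\<in>T. e_mod q (u * t ^ 3 + v * s ^ 2) *
     (\<Sum>z<p. e_mod p (3 * (u * t ^ 3 + v * s ^ 2) * int z ^ 2 + D t s div int p ^ j * int z)))"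
    by (subst sum.swap) (simp add: case_prod_unfold sum_distrib_left)
  finally have "real p * norm (expo_sum q u v) = norm \<dots>"
    by (metis (no_types) norm_mult norm_of_nat)
  also have "\<dots> \<le> (\<Sum>x\<in>T. sqrt (real p))"
  proof (rule sum_norm_le, clarify)
    fix t s assume "(t, s) \<in> T"
    from inner[OF this] show "norm (e_mod q (u * t ^ 3 + v * s ^ 2) *
       (\<Sum>z<p. e_mod p (3 * (u * t ^ 3 + v * s ^ 2) * int z ^ 2 + D t s div int p ^ j * int z))) \<le> sqrt (real p)"
      by (simp only: norm_mult norm_e_mod mult_1 order_refl)
  qed
  also have "\<dots> \<le> 25 * real p ^ (j + 1) * sqrt (real p)"
  proof -
    have "card T \<le> 25 * p ^ (j + 1)"
    proof -
      have e: "2 * j + 1 = j + (j + 1)"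
        by simp
      show ?thesis
        unfolding T_def D_def q_def e by (rule card_critical_lift[OF p(1) j uv])
    qed
    hence "real (card T) \<le> real (25 * p ^ (j + 1))"
      by (simp only: of_nat_le_iff)
    thus ?thesis
      by (simp add: mult_right_mono)
  qed
  finally have "real p * norm (expo_sum q u v) \<le> real p * (25 * real p ^ j * sqrt (real p))"
    by (simp add: mult_ac)
  thus ?thesis
    using p0 by (simp add: q_def)
qed

text \<open>For p \<le> 3 the trivial bound is enough. If \<open>p\<close> divides \<open>u\<close>,
  what remains is a quadratic Gauss sum without its term at 0.\<close>

lemma expo_sum_prime:
  assumes p: "prime p" and uv: "\<not> (int p dvd u \<and> int p dvd v)"
  shows "norm (expo_sum p u v) \<le> 5 * sqrt (real p)"
proof (cases "p > 3")
  case False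
  have "sqrt (real p) * sqrt (real p) \<le> 5 * sqrt (real p)"
  proof (rule mult_right_mono)
    have "real p \<le> 5 ^ 2"
      using False by simp
    thus "sqrt (real p) \<le> 5"
      by (intro real_le_lsqrt) auto
  qed simp
  thus ?thesis
    using norm_expo_sum_le[of p u v] by simp
next
  case p3: True
  show ?thesis
  proof (cases "int p dvd u")
    case False
    thus ?thesis
      by (rule weil_expo_sum[OF p p3])
  next
    case True
    have v: "\<not> int p dvd v"
      using uv True by simp
    have p0: "p > 0"
      using p3 by simp
    have fst_eq: "fst ` inv_pairs p = {0..<int p} - {0}"
    proof -
      have "coprime t (int p) \<longleftrightarrow> t \<noteq> 0" if "t \<in> {0..<int p}" for t
      proof
        assume "coprime t (int p)"
        thus "t \<noteq> 0"
          using p3 by auto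
      next
        assume "t \<noteq> 0"
        hence "\<not> int p dvd t"
          using that zdvd_not_zless[of t "int p"] by auto
        thus "coprime t (int p)"
          using p by (metis coprime_commute prime_imp_coprime prime_nat_int_transfer)
      qed
      thus ?thesis
        unfolding fst_inv_pairs[OF p0] by auto
    qed
    let ?g = "\<lambda>s. e_mod p (v * s ^ 2 + 0 * s)"
    have "expo_sum p u v = (\<Sum>(t, s)\<in>inv_pairs p. ?g s)"
      unfolding expo_sum_def
    proof (rule sum.cong[OF refl], clarify)
      fix t s
      have "int p dvd u * t ^ 3"
        using True by simp
      hence "e_mod p (u * t ^ 3) = 1"
        using p0 by (simp add: e_mod_eq_1_iff)
      thus "e_mod p (u * t ^ 3 + v * s ^ 2) = ?g s"
        by (simp add: e_mod_add)
    qed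
    also have "\<dots> = (\<Sum>(t, s)\<in>inv_pairs p. ?g t)"
      by (rule sum.reindex_bij_witness[of _ prod.swap prod.swap]) (auto simp: inv_pairs_swap)
    also have "\<dots> = (\<Sum>t\<in>fst ` inv_pairs p. ?g t)"
      using inj_on_fst_inv_pairs by (simp add: sum.reindex case_prod_unfold)
    also have "\<dots> = (\<Sum>t\<in>{0..<int p}. ?g t) - ?g 0"
      unfolding fst_eq using p0 by (simp add: sum_diff1)
    also have "(\<Sum>t\<in>{0..<int p}. ?g t) = (\<Sum>z<p. e_mod p (v * int z ^ 2 + 0 * int z))"
      by (rule sum.reindex_bij_witness[of _ int nat]) auto
    finally have "norm (expo_sum p u v) \<le> sqrt (real p) + 1"
      using norm_triangle_ineq4[of "\<Sum>z<p. e_mod p (v * int z ^ 2 + 0 * int z)" 1]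
        norm_gauss_sum[OF p _ v, of 0] p3 by simp
    moreover have "1 \<le> sqrt (real p)"
      using p3 by simp
    ultimately show ?thesis
      by linarith
  qed
qed

lemma expo_sum_prime_power:
  assumes p: "prime p" and k: "k \<ge> 1" and uv: "\<not> (int p dvd u \<and> int p dvd v)"
  shows "norm (expo_sum (p ^ k) u v) \<le> 75 * sqrt (real (p ^ k))"
proof -
  have p0: "real p > 0"
    using p by (simp add: prime_gt_0_nat)
  have sq: "sqrt (real p ^ (2 * j)) = real p ^ j" for j
    using p0 by (simp add: real_sqrt_power power_mult)
  consider "k = 1" | j where "k = 2 * j" "j \<ge> 1" | j where "k = 2 * j + 1" "j \<ge> 1"
  proof -
    have "k = 1 \<or> (\<exists>j\<ge>1. k = 2 * j) \<or> (\<exists>j\<ge>1. k = 2 * j + 1)"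
      using k by presburger
    thus ?thesis
      using that by blast
  qed
  thus ?thesis
  proof cases
    case 1
    have "5 * sqrt (real p) \<le> 75 * sqrt (real p)"
      by (intro mult_right_mono) auto
    with expo_sum_prime[OF p uv] show ?thesis
      unfolding 1 power_one_right by linarith
  next
    case (2 j)
    have "norm (expo_sum (p ^ k) u v) \<le> 25 * real p ^ j"
      using 2 by (intro expo_sum_even_prime_power[OF p _ uv, of j]) auto
    also have "\<dots> \<le> 75 * real p ^ j"
      using p0 by (intro mult_right_mono) auto
    finally show ?thesis
      using 2 sq by simp
  next
    case (3 j)
    have sqk: "sqrt (real (p ^ k)) = real p ^ j * sqrt (real p)"
      using 3 sq[of j] by (simp add: real_sqrt_mult)
    show ?thesis
    proof (cases "p \<ge> 7")
      case True
      have "norm (expo_sum (p ^ k) u v) \<le> 25 * real p ^ j * sqrt (real p)"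
        unfolding 3(1) by (rule expo_sum_odd_prime_power[OF p True 3(2) uv])
      also have "\<dots> \<le> 75 * (real p ^ j * sqrt (real p))"
        using p0 by simp
      finally show ?thesis
        by (simp only: sqk)
    next
      case False
      \<comment> \<open>For p = 2, 3, 5 the cruder bound loses sqrt(p) \<le> 3, which turns 25 into
        75.\<close>
      have "norm (expo_sum (p ^ k) u v) \<le> 25 * real p ^ (j + 1)"
        using 3 by (intro expo_sum_even_prime_power[OF p _ uv, of j]) auto
      also have "\<dots> = 25 * (real p ^ j * sqrt (real p)) * sqrt (real p)"
        using p0 by simp
      also have "\<dots> \<le> 25 * (real p ^ j * sqrt (real p)) * 3"
      proof (rule mult_left_mono)
        show "sqrt (real p) \<le> 3"
          using False by (intro real_le_lsqrt) auto
      qed (use p0 in simp)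
      finally show ?thesis
        by (simp only: sqk)
    qed
  qed
qed

text \<open>After cancelling p^i the phase depends on residues modulo p^k, and each unit there has
  exactly p^i lifts; since k \<ge> 1, every lift is again a unit.\<close>

lemma expo_sum_scale:
  assumes p: "prime p" and k: "k \<ge> 1"
  shows "expo_sum (p ^ (i + k)) (int p ^ i * u) (int p ^ i * v) = of_nat (p ^ i) * expo_sum (p ^ k) u v"
proof -
  define q where "q = p ^ k"
  define Q where "Q = p ^ (i + k)"
  have p0: "p > 0"
    using p by (simp add: prime_gt_0_nat)
  have Q: "int Q = int q * int (p ^ i)" "Q > 0" "q > 0"
    using p0 by (simp_all add: Q_def q_def power_add mult.commute)
  have qQ: "int q dvd int Q"
    by (simp add: Q)
  define g where "g = (\<lambda>(t :: int, s :: int). (t mod int q, s mod int q))"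
  have g_in: "g x \<in> inv_pairs q" if x: "x \<in> inv_pairs Q" for x
  proof -
    obtain t s where [simp]: "x = (t, s)"
      by force
    have "[t * s = 1] (mod int Q)"
      using x by (simp add: inv_pairs_def)
    hence "[t * s = 1] (mod int q)"
      using qQ by (rule cong_dvd_modulus)
    thus ?thesis
      using Q by (simp add: g_def inv_pairs_def cong_def mod_mult_eq)
  qed
  have fibre: "card {x \<in> inv_pairs Q. g x = y} = p ^ i" if y: "y \<in> inv_pairs q" for y
  proof -
    obtain t0 s0 where [simp]: "y = (t0, s0)"
      by force
    have y': "t0 \<in> {0..<int q}" "s0 \<in> {0..<int q}"
      using y by (auto simp: inv_pairs_def)
    have cop: "coprime t0 (int q)"
    proof -
      have "t0 \<in> fst ` inv_pairs q"
        using y by force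
      thus ?thesis
        unfolding fst_inv_pairs[OF Q(3)] by simp
    qed
    let ?F = "{x \<in> inv_pairs Q. g x = y}"
    have "fst ` ?F = (\<lambda>r. t0 + int q * r) ` {0..<int (p ^ i)}"
    proof (intro equalityI subsetI)
      fix t assume "t \<in> fst ` ?F"
      then obtain s where ts: "(t, s) \<in> inv_pairs Q" "t mod int q = t0"
        by (auto simp: g_def)
      have t: "t \<in> {0..<int (p ^ i) * int q}"
        using ts(1) Q(1) by (auto simp: inv_pairs_def mult.commute)
      have "t = t0 + int q * (t div int q)"
        using ts(2) mod_mult_div_eq[of t "int q"] by simp
      moreover have "t div int q < int (p ^ i)"
        using t Q by (intro int_div_less) auto
      moreover have "t div int q \<ge> 0"
        using t Q by (simp add: pos_imp_zdiv_nonneg_iff)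
      ultimately show "t \<in> (\<lambda>r. t0 + int q * r) ` {0..<int (p ^ i)}"
        by (intro image_eqI[of _ _ "t div int q"]) auto
    next
      fix t assume "t \<in> (\<lambda>r. t0 + int q * r) ` {0..<int (p ^ i)}"
      then obtain r where "t = t0 + int q * r" "r \<in> {0..<int (p ^ i)}"
        by (elim imageE)
      hence r: "t = t0 + int q * r" "0 \<le> r" "r + 1 \<le> int (p ^ i)"
        by auto
      have tm: "t mod int q = t0"
        using y' by (simp add: r(1))
      have "int q * (r + 1) \<le> int q * int (p ^ i)"
        using r(3) by (intro mult_left_mono) auto
      hence tQ: "t \<in> {0..<int Q}"
        using y' r Q by (auto simp: distrib_left)
      have "coprime t (int q)"
        using cop coprime_mod_left_iff[of "int q" t] Q(3) unfolding tm by simp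
      hence "coprime t (int p)"
        using k by (simp add: q_def)
      hence "coprime t (int Q)"
        by (simp add: Q_def)
      hence "t \<in> fst ` inv_pairs Q"
        unfolding fst_inv_pairs[OF Q(2)] using tQ by simp
      then obtain s where s: "(t, s) \<in> inv_pairs Q"
        by force
      have "(t0, s mod int q) \<in> inv_pairs q"
        using g_in[OF s] tm by (simp add: g_def)
      hence "s mod int q = s0"
        using inv_pairs_unique y by auto
      thus "t \<in> fst ` ?F"
        using s tm by (force simp: g_def)
    qed
    moreover have "inj_on fst ?F"
      by (rule inj_on_subset[OF inj_on_fst_inv_pairs[of Q]]) auto
    moreover have "inj_on (\<lambda>r. t0 + int q * r) {0..<int (p ^ i)}"
      using Q(3) by (auto simp: inj_on_def)
    ultimately have "card ?F = card {0..<int (p ^ i)}"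
      using card_image[of fst ?F] card_image[of "\<lambda>r. t0 + int q * r" "{0..<int (p ^ i)}"] by simp
    thus ?thesis
      by (simp only: card_atLeastLessThan_int diff_0_right nat_int)
  qed
  let ?h = "\<lambda>(t, s). e_mod q (u * t ^ 3 + v * s ^ 2)"
  have "expo_sum Q (int p ^ i * u) (int p ^ i * v) = (\<Sum>x\<in>inv_pairs Q. ?h (g x))"
    unfolding expo_sum_def
  proof (rule sum.cong[OF refl], clarify)
    fix t s
    have "e_mod Q (int p ^ i * u * t ^ 3 + int p ^ i * v * s ^ 2) = e_mod (p ^ i * q) (int (p ^ i) * (u * t ^ 3 + v * s ^ 2))"
      by (simp add: Q_def q_def power_add distrib_left mult.assoc)
    also have "\<dots> = e_mod q (u * t ^ 3 + v * s ^ 2)"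
      using p0 by (intro e_mod_scale) simp
    finally show "e_mod Q (int p ^ i * u * t ^ 3 + int p ^ i * v * s ^ 2) = ?h (g (t, s))"
      by (simp add: g_def e_mod_poly_mod)
  qed
  also have "\<dots> = (\<Sum>y\<in>inv_pairs q. \<Sum>x\<in>{x \<in> inv_pairs Q. g x = y}. ?h (g x))"
    using g_in by (intro sum.group[symmetric]) auto
  also have "\<dots> = (\<Sum>y\<in>inv_pairs q. of_nat (p ^ i) * ?h y)"
    by (intro sum.cong refl) (simp add: fibre)
  also have "\<dots> = of_nat (p ^ i) * expo_sum q u v"
    by (simp add: expo_sum_def sum_distrib_left case_prod_unfold)
  finally show ?thesis
    by (simp only: Q_def q_def)
qed

lemma expo_sum_prime_power_gcd:
  assumes p: "prime p" and k: "k \<ge> 1"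
  shows "norm (expo_sum (p ^ k) u v) \<le> 75 * sqrt (real (p ^ k)) * sqrt (real_of_int (gcd (gcd u v) (int (p ^ k))))"
proof -
  define g where "g = gcd (gcd u v) (int (p ^ k))"
  have p0: "p > 0"
    using p by (simp add: prime_gt_0_nat)
  have "nat g dvd p ^ k"
    unfolding g_def by (metis gcd_dvd2 int_dvd_int_iff gcd_ge_0_int int_nat_eq)
  then obtain i where i: "i \<le> k" "nat g = p ^ i"
    using divides_primepow_nat[OF p] by blast
  have g: "g = int p ^ i"
    using i(2) by (metis g_def gcd_ge_0_int int_nat_eq of_nat_power)
  show ?thesis
  proof (cases "i = k")
    case True
    \<comment> \<open>Both coefficients vanish modulo p^k, and the trivial bound p^k is sqrt(p^k)
      times the root of the gcd.\<close>
    have "norm (expo_sum (p ^ k) u v) \<le> sqrt (real (p ^ k)) * sqrt (real (p ^ k))"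
      using norm_expo_sum_le[of "p ^ k" u v] by simp
    also have "\<dots> \<le> 75 * sqrt (real (p ^ k)) * sqrt (real (p ^ k))"
      by (intro mult_right_mono) auto
    finally show ?thesis
      unfolding g_def[symmetric] g True by simp
  next
    case False
    define m where "m = k - i"
    have m: "m \<ge> 1" "k = i + m"
      using False i(1) by (auto simp: m_def)
    have "g dvd u" "g dvd v"
      unfolding g_def by (meson dvd_trans gcd_dvd1 gcd_dvd2)+
    then obtain u' v' where uv: "u = int p ^ i * u'" "v = int p ^ i * v'"
      unfolding g by (elim dvdE)
    have nd: "\<not> (int p dvd u' \<and> int p dvd v')"
    proof
      assume h: "int p dvd u' \<and> int p dvd v'"
      have "int p ^ Suc i dvd u" "int p ^ Suc i dvd v"
        using h unfolding uv by (simp_all add: mult.commute mult_dvd_mono)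
      moreover have "int p ^ Suc i dvd int (p ^ k)"
        using m by (simp add: le_imp_power_dvd del: power_Suc)
      ultimately have "int p ^ Suc i dvd int p ^ i"
        unfolding g[symmetric] g_def by (intro gcd_greatest)
      hence "p ^ Suc i dvd p ^ i"
        by (metis int_dvd_int_iff of_nat_power)
      hence "Suc i \<le> i"
        using prime_gt_1_nat[OF p] by (rule power_dvd_imp_le)
      thus False
        by simp
    qed
    have "norm (expo_sum (p ^ k) u v) = real p ^ i * norm (expo_sum (p ^ m) u' v')"
      unfolding m(2) uv expo_sum_scale[OF p m(1)] by (simp add: norm_mult norm_power)
    also have "\<dots> \<le> real p ^ i * (75 * sqrt (real (p ^ m)))"
      by (intro mult_left_mono expo_sum_prime_power[OF p m(1) nd]) simp
    also have "\<dots> = 75 * sqrt (real (p ^ k)) * sqrt (real p ^ i)"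
      unfolding m(2) by (simp add: power_add real_sqrt_mult)
    finally show ?thesis
      unfolding g_def[symmetric] g by simp
  qed
qed

text \<open>Bezout's identity splits n / (q1 q2) into n b / q1 + n a / q2. The Chinese remainder
  theorem then factors the sum, with coefficients twisted by \<open>b\<close> and
  \<open>a\<close>.\<close>

lemma expo_sum_mult:
  assumes q: "q1 > 0" "q2 > 0" and ab: "a * int q1 + b * int q2 = 1"
  shows "expo_sum (q1 * q2) u v = expo_sum q1 (u * b) (v * b) * expo_sum q2 (u * a) (v * a)"
proof -
  let ?h1 = "\<lambda>(t, s). e_mod q1 (u * b * t ^ 3 + v * b * s ^ 2)"
  let ?h2 = "\<lambda>(t, s). e_mod q2 (u * a * t ^ 3 + v * a * s ^ 2)"
  define c where "c = (\<lambda>x y. (x * (b * int q2) + y * (a * int q1)) mod int (q1 * q2))"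
  have c1: "[c x y = x] (mod int q1)" and c2: "[c x y = y] (mod int q2)" for x y
  proof -
    have "[c x y = x * (b * int q2) + y * (a * int q1)] (mod int (q1 * q2))"
      by (simp add: c_def)
    hence 1: "[c x y = x * (b * int q2) + y * (a * int q1)] (mod int q1)"
      and 2: "[c x y = x * (b * int q2) + y * (a * int q1)] (mod int q2)"
      by (auto intro: cong_dvd_modulus)
    have "x * (b * int q2) + y * (a * int q1) - x = int q1 * (a * (y - x)) + x * (a * int q1 + b * int q2 - 1)"
      by (simp add: algebra_simps)
    also have "\<dots> = int q1 * (a * (y - x))"
      using ab by simp
    finally have "[x * (b * int q2) + y * (a * int q1) = x] (mod int q1)"
      by (simp add: cong_iff_dvd_diff)
    with 1 show "[c x y = x] (mod int q1)"
      by (rule cong_trans)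
    have "x * (b * int q2) + y * (a * int q1) - y = int q2 * (b * (x - y)) + y * (a * int q1 + b * int q2 - 1)"
      by (simp add: algebra_simps)
    also have "\<dots> = int q2 * (b * (x - y))"
      using ab by simp
    finally have "[x * (b * int q2) + y * (a * int q1) = y] (mod int q2)"
      by (simp add: cong_iff_dvd_diff)
    with 2 show "[c x y = y] (mod int q2)"
      by (rule cong_trans)
  qed
  have cop: "coprime (int q1) (int q2)"
  proof (rule coprimeI)
    fix d assume "d dvd int q1" "d dvd int q2"
    hence "d dvd a * int q1 + b * int q2"
      by simp
    thus "d dvd 1"
      by (simp only: ab)
  qed
  have c_range: "c x y \<in> {0..<int (q1 * q2)}" for x y
    using q by (simp add: c_def del: of_nat_mult)
  have uniq: "x = y" if "[x = y] (mod int q1)" "[x = y] (mod int q2)" "x \<in> {0..<int (q1 * q2)}" "y \<in> {0..<int (q1 * q2)}" for x y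
  proof -
    have "[x = y] (mod (int q1 * int q2))"
      using that(1,2) cop by (rule coprime_cong_mult)
    thus ?thesis
      using that(3,4) by (simp add: cong_def)
  qed
  have "expo_sum q1 (u * b) (v * b) * expo_sum q2 (u * a) (v * a) = (\<Sum>(x, y)\<in>inv_pairs q1 \<times> inv_pairs q2. ?h1 x * ?h2 y)"
    by (simp add: expo_sum_def sum_product sum.cartesian_product)
  also have "\<dots> = expo_sum (q1 * q2) u v"
    unfolding expo_sum_def
  proof (rule sum.reindex_bij_witness[of _
      "\<lambda>(t, s). ((t mod int q1, s mod int q1), (t mod int q2, s mod int q2))"
      "\<lambda>((t1, s1), (t2, s2)). (c t1 t2, c s1 s2)"], goal_cases)
    case (1 x)
    then obtain t1 s1 t2 s2 where x: "x = ((t1, s1), (t2, s2))" "(t1, s1) \<in> inv_pairs q1" "(t2, s2) \<in> inv_pairs q2"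
      by auto
    thus ?case
      using c1[of t1 t2] c1[of s1 s2] c2[of t1 t2] c2[of s1 s2] by (auto simp: inv_pairs_def cong_def)
  next
    case (2 x)
    then obtain t1 s1 t2 s2 where x: "x = ((t1, s1), (t2, s2))" "(t1, s1) \<in> inv_pairs q1" "(t2, s2) \<in> inv_pairs q2"
      by auto
    have "[c t1 t2 * c s1 s2 = t1 * s1] (mod int q1)" "[c t1 t2 * c s1 s2 = t2 * s2] (mod int q2)"
      by (intro cong_mult c1 c2)+
    hence "[c t1 t2 * c s1 s2 = 1] (mod int q1)" "[c t1 t2 * c s1 s2 = 1] (mod int q2)"
      using x cong_trans unfolding inv_pairs_def by blast+
    hence "[c t1 t2 * c s1 s2 = 1] (mod (int q1 * int q2))"
      using cop by (rule coprime_cong_mult)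
    thus ?case
      using x(1) c_range by (simp add: inv_pairs_def)
  next
    case (3 y)
    obtain t s where [simp]: "y = (t, s)"
      by force
    have ts: "t \<in> {0..<int (q1 * q2)}" "s \<in> {0..<int (q1 * q2)}"
      using 3 by (auto simp: inv_pairs_def)
    have "c (r mod int q1) (r mod int q2) = r" if "r \<in> {0..<int (q1 * q2)}" for r
    proof (rule uniq[OF _ _ c_range that])
      show "[c (r mod int q1) (r mod int q2) = r] (mod int q1)"
        using c1[of "r mod int q1" "r mod int q2"] by (simp add: cong_def)
      show "[c (r mod int q1) (r mod int q2) = r] (mod int q2)"
        using c2[of "r mod int q1" "r mod int q2"] by (simp add: cong_def)
    qed
    thus ?case
      using ts by simp
  next
    case (4 y)
    obtain t s where [simp]: "y = (t, s)"
      by force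
    have "[t * s = 1] (mod int q1 * int q2)"
      using 4 by (simp add: inv_pairs_def)
    hence "[t * s = 1] (mod int q1)" "[t * s = 1] (mod int q2)"
      by (auto intro: cong_dvd_modulus)
    thus ?case
      using q by (simp add: inv_pairs_def cong_def mod_mult_eq)
  next
    case (5 x)
    then obtain t1 s1 t2 s2 where x: "x = ((t1, s1), (t2, s2))"
      by (metis surj_pair)
    define T where "T = c t1 t2"
    define S where "S = c s1 s2"
    define n where "n = u * T ^ 3 + v * S ^ 2"
    have "n = int q1 * (n * a) + int q2 * (n * b)"
    proof -
      have "n = n * (a * int q1 + b * int q2)"
        by (simp add: ab)
      thus ?thesis
        by (simp add: algebra_simps)
    qed
    hence "e_mod (q1 * q2) n = e_mod (q1 * q2) (int q1 * (n * a)) * e_mod (q2 * q1) (int q2 * (n * b))"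
      by (metis e_mod_add mult.commute)
    also have "\<dots> = e_mod q2 (n * a) * e_mod q1 (n * b)"
      using q by (simp only: e_mod_scale)
    finally have e: "e_mod (q1 * q2) n = e_mod q2 (n * a) * e_mod q1 (n * b)" .
    have "[n * b = u * b * t1 ^ 3 + v * b * s1 ^ 2] (mod int q1)"
    proof -
      have "[(u * T ^ 3 + v * S ^ 2) * b = (u * t1 ^ 3 + v * s1 ^ 2) * b] (mod int q1)"
        unfolding T_def S_def by (intro cong_mult cong_add cong_pow cong_refl c1)
      thus ?thesis
        by (simp add: n_def algebra_simps)
    qed
    moreover have "[n * a = u * a * t2 ^ 3 + v * a * s2 ^ 2] (mod int q2)"
    proof -
      have "[(u * T ^ 3 + v * S ^ 2) * a = (u * t2 ^ 3 + v * s2 ^ 2) * a] (mod int q2)"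
        unfolding T_def S_def by (intro cong_mult cong_add cong_pow cong_refl c2)
      thus ?thesis
        by (simp add: n_def algebra_simps)
    qed
    ultimately have "e_mod (q1 * q2) n = ?h2 (t2, s2) * ?h1 (t1, s1)"
      unfolding e by (auto intro!: arg_cong2[of _ _ _ _ "(*)"] e_mod_cong)
    thus ?case
      unfolding x n_def T_def S_def by (simp add: mult.commute)
  qed
  finally show ?thesis
    by simp
qed

definition omega :: "nat \<Rightarrow> nat" where
  "omega n = card (prime_factors n)"

lemma omega_prime_power_mult:
  assumes "prime p" "k > 0" "m > 0" "\<not> p dvd m"
  shows "omega (p ^ k * m) = Suc (omega m)"
proof -
  have "prime_factors (p ^ k * m) = insert p (prime_factors m)"
    using assms by (simp add: prime_factors_product prime_factors_power prime_prime_factors)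
  moreover have "p \<notin> prime_factors m"
    using assms(4) by auto
  ultimately show ?thesis
    by (simp add: omega_def)
qed

text \<open>The Bezout multipliers are units for the respective factors, so the twists do not change
  the gcds, and gcds with coprime factors multiply.\<close>

theorem expo_sum_bound:
  assumes "q > 0"
  shows "norm (expo_sum q u v) \<le> 75 ^ omega q * sqrt (real q) * sqrt (real_of_int (gcd (gcd u v) (int q)))"
  using assms
proof (induction q arbitrary: u v rule: prime_power_induct)
  case one
  show ?case
    using norm_expo_sum_le[of 1 u v] by (simp add: omega_def)
next
  case (step p k m)
  have p0: "p ^ k > 0"
    using step.hyps(1) by (simp add: prime_gt_0_nat)
  have cop: "coprime (int (p ^ k)) (int m)"
    using step.hyps by (simp add: prime_imp_coprime del: of_nat_power)
  obtain a b where ab: "a * int (p ^ k) + b * int m = 1"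
    using bezout_int[of "int (p ^ k)" "int m"] cop by auto
  have gcd_eq: "gcd (gcd (u * c) (v * c)) n = gcd (gcd u v) n" if "coprime c n" for c n :: int
  proof -
    have "gcd (u * c) (v * c) = \<bar>c\<bar> * gcd u v"
      using gcd_mult_distrib_int[of c u v] by (simp add: mult.commute)
    moreover have "coprime n \<bar>c\<bar>"
      using that by (simp add: coprime_commute)
    ultimately show ?thesis
      by (simp add: gcd_mult_left_left_cancel)
  qed
  have cb: "coprime b (int (p ^ k))" and ca: "coprime a (int m)"
  proof -
    show "coprime b (int (p ^ k))"
    proof (rule coprimeI)
      fix d assume "d dvd b" "d dvd int (p ^ k)"
      hence "d dvd a * int (p ^ k) + b * int m"
        by (intro dvd_add dvd_mult dvd_mult2)
      thus "d dvd 1"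
        by (simp only: ab)
    qed
    show "coprime a (int m)"
    proof (rule coprimeI)
      fix d assume "d dvd a" "d dvd int m"
      hence "d dvd a * int (p ^ k) + b * int m"
        by (intro dvd_add dvd_mult dvd_mult2)
      thus "d dvd 1"
        by (simp only: ab)
    qed
  qed
  define G where "G = gcd u v"
  have gm: "gcd G (int (p ^ k)) * gcd G (int m) \<le> gcd G (int (p ^ k * m))"
  proof (rule zdvd_imp_le)
    have "coprime (gcd G (int (p ^ k))) (gcd G (int m))"
      using cop by (rule coprime_divisors[rotated 2]) auto
    hence "gcd G (int (p ^ k)) * gcd G (int m) dvd G"
      by (intro divides_mult) auto
    moreover have "gcd G (int (p ^ k)) * gcd G (int m) dvd int (p ^ k) * int m"
      by (intro mult_dvd_mono) auto
    ultimately show "gcd G (int (p ^ k)) * gcd G (int m) dvd gcd G (int (p ^ k * m))"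
      by (simp del: of_nat_power)
    show "gcd G (int (p ^ k * m)) > 0"
      using p0 step.hyps(3) by (simp add: gcd_pos_int del: of_nat_mult)
  qed
  have "norm (expo_sum (p ^ k * m) u v) = norm (expo_sum (p ^ k) (u * b) (v * b)) * norm (expo_sum m (u * a) (v * a))"
    using expo_sum_mult[OF p0 step.hyps(3) ab] by (simp add: norm_mult)
  also have "\<dots> \<le> (75 * sqrt (real (p ^ k)) * sqrt (real_of_int (gcd G (int (p ^ k))))) *
      (75 ^ omega m * sqrt (real m) * sqrt (real_of_int (gcd G (int m))))"
    using expo_sum_prime_power_gcd[OF step.hyps(1), of k "u * b" "v * b"] step.IH[of "u * a" "v * a"] step.hyps(2)
    unfolding gcd_eq[OF cb] gcd_eq[OF ca] G_def by (intro mult_mono) auto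
  also have "\<dots> = 75 ^ omega (p ^ k * m) * sqrt (real (p ^ k * m)) *
      sqrt (real_of_int (gcd G (int (p ^ k)) * gcd G (int m)))"
    using omega_prime_power_mult[OF step.hyps(1-4)] by (simp add: real_sqrt_mult)
  also have "\<dots> \<le> 75 ^ omega (p ^ k * m) * sqrt (real (p ^ k * m)) * sqrt (real_of_int (gcd G (int (p ^ k * m))))"
    using gm by (intro mult_left_mono real_sqrt_le_mono) (simp_all only: of_int_le_iff, simp)
  finally show ?case
    unfolding G_def .
qed

section \<open>Solutions in boxes\<close>

text \<open>The first factor collects the constants at the prime powers, the second comes from
  averaging square roots of gcds over frequencies.\<close>

definition weight :: "nat \<Rightarrow> real" where
  "weight q = 75 ^ omega q * real (card {d. d dvd q})"

lemma weight_ge_card_divisors: "real (card {d. d dvd q}) \<le> weight q"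
  using mult_right_mono[of 1 "75 ^ omega q :: real" "real (card {d. d dvd q})"]
  by (simp add: weight_def)

lemma card_int_multiples_le:
  fixes d H :: nat
  assumes "d \<ge> 1" "H \<ge> 1"
  shows "real (card {u \<in> {- int H<..<int H}. int d dvd u}) \<le> 2 * real H / real d + 1"
proof -
  define m where "m = int H div int d"
  have m0: "m \<ge> 0"
    using assms by (simp add: m_def pos_imp_zdiv_nonneg_iff)
  have "{u \<in> {- int H<..<int H}. int d dvd u} \<subseteq> (\<lambda>k. int d * k) ` {-m..m}"
  proof
    fix u assume u: "u \<in> {u \<in> {- int H<..<int H}. int d dvd u}"
    then obtain k where k: "u = int d * k"
      by blast
    have "\<bar>u\<bar> \<le> int H"
      using u by (simp add: abs_le_iff)
    hence "int d * \<bar>k\<bar> \<le> int H"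
      unfolding k by (simp only: abs_mult abs_of_nat)
    hence "(int d * \<bar>k\<bar>) div int d \<le> m"
      unfolding m_def using assms by (intro zdiv_mono1) auto
    hence "\<bar>k\<bar> \<le> m"
      using assms by simp
    thus "u \<in> (\<lambda>k. int d * k) ` {-m..m}"
      using k by (auto simp: abs_le_iff)
  qed
  hence "card {u \<in> {- int H<..<int H}. int d dvd u} \<le> card ((\<lambda>k. int d * k) ` {-m..m})"
    by (intro card_mono) auto
  also have "\<dots> \<le> card {-m..m}"
    by (rule card_image_le) simp
  also have "\<dots> = nat (2 * m + 1)"
    by simp
  finally have "real (card {u \<in> {- int H<..<int H}. int d dvd u}) \<le> real (nat (2 * m + 1))"
    by (simp only: of_nat_le_iff)
  also have "\<dots> = 2 * real_of_int m + 1"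
    using m0 by simp
  also have "real_of_int m \<le> real H / real d"
    using real_of_int_div4[of "int H" "int d"] by (simp add: m_def)
  finally show ?thesis
    by simp
qed

text \<open>The square root of the gcd is one of the terms sqrt(d) with \<open>d\<close> dividing
  \<open>q\<close>, \<open>u\<close> and \<open>v\<close>. In sqrt(d) (2 H / d + 1)(2 G / d + 1)
  only the product of the ones keeps the full sqrt(d) \<le> sqrt(q); the rest is at most 8 H
  G.\<close>

lemma sum_sqrt_gcd_le:
  fixes q H G :: nat
  assumes "q > 0" "H \<ge> 1" "G \<ge> 1"
  shows "(\<Sum>u\<in>{- int H<..<int H}. \<Sum>v\<in>{- int G<..<int G}. sqrt (real_of_int (gcd (gcd u v) (int q)))) \<le>
     real (card {d. d dvd q}) * (8 * real H * real G + sqrt (real q))"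
proof -
  let ?U = "{- int H<..<int H}" and ?V = "{- int G<..<int G}" and ?D = "{d. d dvd q}"
  have finD: "finite ?D"
    using assms(1) by (simp add: finite_divisors_nat)
  have "(\<Sum>u\<in>?U. \<Sum>v\<in>?V. sqrt (real_of_int (gcd (gcd u v) (int q)))) \<le>
    (\<Sum>u\<in>?U. \<Sum>v\<in>?V. \<Sum>d\<in>?D. if int d dvd u \<and> int d dvd v then sqrt (real d) else 0)"
  proof (intro sum_mono)
    fix u v :: int
    define g where "g = nat (gcd (gcd u v) (int q))"
    have g: "int g = gcd (gcd u v) (int q)"
      by (simp add: g_def)
    have "int g dvd int q" "int g dvd u" "int g dvd v"
      unfolding g by (meson dvd_trans gcd_dvd1 gcd_dvd2)+
    hence gd: "g \<in> ?D" "int g dvd u \<and> int g dvd v"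
      by auto
    have "sqrt (real_of_int (gcd (gcd u v) (int q))) = (if int g dvd u \<and> int g dvd v then sqrt (real g) else 0)"
      using gd(2) unfolding g[symmetric] by simp
    also have "\<dots> \<le> (\<Sum>d\<in>?D. if int d dvd u \<and> int d dvd v then sqrt (real d) else 0)"
      using finD gd(1) by (intro member_le_sum) auto
    finally show "sqrt (real_of_int (gcd (gcd u v) (int q))) \<le> \<dots>" .
  qed
  also have "\<dots> = (\<Sum>d\<in>?D. \<Sum>u\<in>?U. \<Sum>v\<in>?V. if int d dvd u \<and> int d dvd v then sqrt (real d) else 0)"
  proof -
    have "(\<Sum>u\<in>?U. \<Sum>v\<in>?V. \<Sum>d\<in>?D. if int d dvd u \<and> int d dvd v then sqrt (real d) else 0) =
      (\<Sum>u\<in>?U. \<Sum>d\<in>?D. \<Sum>v\<in>?V. if int d dvd u \<and> int d dvd v then sqrt (real d) else 0)"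
      by (rule sum.cong[OF refl], rule sum.swap)
    also have "\<dots> = (\<Sum>d\<in>?D. \<Sum>u\<in>?U. \<Sum>v\<in>?V. if int d dvd u \<and> int d dvd v then sqrt (real d) else 0)"
      by (rule sum.swap)
    finally show ?thesis .
  qed
  also have "\<dots> = (\<Sum>d\<in>?D. sqrt (real d) * (real (card {u\<in>?U. int d dvd u}) * real (card {v\<in>?V. int d dvd v})))"
  proof (rule sum.cong[OF refl])
    fix d
    have "(\<Sum>u\<in>?U. \<Sum>v\<in>?V. if int d dvd u \<and> int d dvd v then sqrt (real d) else 0) =
       (\<Sum>u\<in>?U. \<Sum>v\<in>?V. sqrt (real d) * ((if int d dvd u then 1 else 0) * (if int d dvd v then 1 else 0)))"
      by (intro sum.cong refl) auto
    also have "\<dots> = sqrt (real d) * ((\<Sum>u\<in>?U. if int d dvd u then 1 else 0) * (\<Sum>v\<in>?V. if int d dvd v then 1 else 0))"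
      unfolding sum_product by (simp only: sum_distrib_left)
    also have "\<dots> = sqrt (real d) * (real (card {u\<in>?U. int d dvd u}) * real (card {v\<in>?V. int d dvd v}))"
      by (simp only: sum.inter_filter[symmetric] finite_greaterThanLessThan_int) simp
    finally show "(\<Sum>u\<in>?U. \<Sum>v\<in>?V. if int d dvd u \<and> int d dvd v then sqrt (real d) else 0) = \<dots>" .
  qed
  also have "\<dots> \<le> (\<Sum>d\<in>?D. 8 * real H * real G + sqrt (real q))"
  proof (rule sum_mono)
    fix d assume d: "d \<in> ?D"
    have d1: "d \<ge> 1"
      using d assms(1) by (auto intro: Suc_leI gr0I)
    have dq: "d \<le> q"
      using d assms(1) by (auto dest: dvd_imp_le)
    have sd: "sqrt (real d) \<ge> 1"
      using d1 by simp
    have sd2: "sqrt (real d) \<le> real d"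
      using d1 by (intro real_le_lsqrt) (auto simp: power2_eq_square)
    have sdd: "sqrt (real d) / real d \<le> 1"
      using sd2 d1 by simp
    have "sqrt (real d) * (real (card {u\<in>?U. int d dvd u}) * real (card {v\<in>?V. int d dvd v})) \<le>
       sqrt (real d) * ((2 * real H / real d + 1) * (2 * real G / real d + 1))"
      using d1 assms by (intro mult_left_mono mult_mono card_int_multiples_le) auto
    also have "\<dots> = (sqrt (real d) / real d) * (4 * real H * real G / real d) + (sqrt (real d) / real d) * (2 * real H)
       + (sqrt (real d) / real d) * (2 * real G) + sqrt (real d)"
      by (simp add: algebra_simps add_divide_distrib)
    also have "\<dots> \<le> 1 * (4 * real H * real G) + 1 * (2 * real H) + 1 * (2 * real G) + sqrt (real q)"
    proof (intro add_mono mult_mono sdd)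
      show "4 * real H * real G / real d \<le> 4 * real H * real G"
        using d1 divide_left_mono[of 1 "real d" "4 * real H * real G"] by simp
      show "sqrt (real d) \<le> sqrt (real q)"
        using dq by simp
    qed auto
    also have "\<dots> \<le> 8 * real H * real G + sqrt (real q)"
    proof -
      have "real H * 1 \<le> real H * real G" "1 * real G \<le> real H * real G"
        using assms by (auto intro!: mult_mono)
      thus ?thesis
        by linarith
    qed
    finally show "sqrt (real d) * (real (card {u\<in>?U. int d dvd u}) * real (card {v\<in>?V. int d dvd v})) \<le>
      8 * real H * real G + sqrt (real q)" .
  qed
  finally show ?thesis
    by simp
qed

text \<open>For fixed \<open>h\<close> the differences h - h' are distinct, so each value occurs at
  most \<open>H\<close> times in all.\<close>

lemma sum_differences_le:
  fixes f :: "int \<Rightarrow> real" and H :: nat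
  assumes "\<And>u. f u \<ge> 0"
  shows "(\<Sum>h<H. \<Sum>h'<H. f (int h - int h')) \<le> real H * (\<Sum>u\<in>{- int H<..<int H}. f u)"
proof -
  have "(\<Sum>h'<H. f (int h - int h')) \<le> (\<Sum>u\<in>{- int H<..<int H}. f u)" if "h < H" for h
  proof -
    have "(\<Sum>h'<H. f (int h - int h')) = (\<Sum>u\<in>(\<lambda>h'. int h - int h') ` {..<H}. f u)"
      by (subst sum.reindex) (auto simp: inj_on_def)
    also have "\<dots> \<le> (\<Sum>u\<in>{- int H<..<int H}. f u)"
      using that assms by (intro sum_mono2) auto
    finally show ?thesis .
  qed
  hence "(\<Sum>h<H. \<Sum>h'<H. f (int h - int h')) \<le> (\<Sum>h<H. \<Sum>u\<in>{- int H<..<int H}. f u)"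
    by (intro sum_mono) auto
  thus ?thesis
    by simp
qed

text \<open>A geometric sum whose squared modulus is an unnormalised Fejer kernel: nonnegative and
  large near 0, it majorises a multiple of the indicator of an interval.\<close>

definition fejer :: "nat \<Rightarrow> nat \<Rightarrow> int \<Rightarrow> complex" where
  "fejer q H n = (\<Sum>h<H. e_mod q (int h * n))"

lemma fejer_cong: "[m = n] (mod int q) \<Longrightarrow> fejer q H m = fejer q H n"
  unfolding fejer_def by (intro sum.cong refl e_mod_cong cong_mult) auto

lemma cnj_e_mod: "cnj (e_mod q n) = e_mod q (- n)"
  by (simp add: e_mod_def cis_cnj)

lemma fejer_square: "of_real (norm (fejer q H n) ^ 2) = (\<Sum>h<H. \<Sum>h'<H. e_mod q ((int h - int h') * n))"
proof -
  have "of_real (norm (fejer q H n) ^ 2) = fejer q H n * cnj (fejer q H n)"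
    by (rule complex_norm_square)
  also have "\<dots> = (\<Sum>h<H. \<Sum>h'<H. e_mod q (int h * n) * e_mod q (- (int h' * n)))"
    by (simp add: fejer_def cnj_sum sum_product cnj_e_mod)
  finally show ?thesis
    by (simp add: e_mod_add[symmetric] left_diff_distrib)
qed

text \<open>All \<open>H\<close> phases are at most \<pi>/4 in absolute value, so every real part is
  at least 1 / sqrt(2).\<close>

lemma fejer_lower:
  assumes "q > 0" "\<bar>n\<bar> * 8 * int H \<le> int q"
  shows "norm (fejer q H n) ^ 2 \<ge> real H ^ 2 / 2"
proof -
  have "sqrt 2 / 2 \<le> Re (e_mod q (int h * n))" if h: "h < H" for h
  proof -
    have "\<bar>real_of_int (int h * n)\<bar> * 8 \<le> real q"
    proof -
      have "int h * \<bar>n\<bar> * 8 \<le> int H * \<bar>n\<bar> * 8"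
        using h by (intro mult_right_mono) auto
      also have "\<dots> \<le> int q"
        using assms(2) by (simp add: mult_ac)
      finally have "real_of_int (int h * \<bar>n\<bar> * 8) \<le> real_of_int (int q)"
        by (simp only: of_int_le_iff)
      thus ?thesis
        by (simp add: abs_mult)
    qed
    hence "\<bar>2 * pi * of_int (int h * n) / of_nat q\<bar> \<le> pi / 4"
      using assms(1) by (simp add: abs_mult field_simps)
    hence "cos (pi / 4) \<le> cos \<bar>2 * pi * of_int (int h * n) / of_nat q\<bar>"
      by (intro cos_monotone_0_pi_le) (use pi_ge_zero in auto)
    thus ?thesis
      by (simp only: e_mod_def cos_45 cos_abs_real cis.sel)
  qed
  hence "(\<Sum>h<H. sqrt 2 / 2) \<le> (\<Sum>h<H. Re (e_mod q (int h * n)))"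
    by (intro sum_mono) auto
  also have "\<dots> \<le> norm (fejer q H n)"
    using complex_Re_le_cmod[of "fejer q H n"] by (simp add: fejer_def)
  finally have "(real H * (sqrt 2 / 2)) ^ 2 \<le> norm (fejer q H n) ^ 2"
    by (intro power_mono) auto
  thus ?thesis
    by (simp add: power_mult_distrib power_divide)
qed

text \<open>Expanding both kernels gives complete sums with frequencies (h - h') l' and (g - g') l.
  As \<open>l\<close> and \<open>l'\<close> are units, the gcds in the bounds are those of the plain
  differences.\<close>

lemma fejer_sum_le:
  assumes q: "q > 0" and H: "H \<ge> 1" "G \<ge> 1" and l: "[l * l' = 1] (mod int q)"
  shows "(\<Sum>(t, s)\<in>inv_pairs q. norm (fejer q H (l' * t ^ 3 - a0)) ^ 2 * norm (fejer q G (l * s ^ 2 - b0)) ^ 2) \<le>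
     real H * real G * weight q * sqrt (real q) * (8 * real H * real G + sqrt (real q))"
proof -
  have cop: "coprime l (int q)" "coprime l' (int q)"
    using l coprime_iff_invertible_int[of l "int q"] coprime_iff_invertible_int[of l' "int q"]
    by (auto simp: mult.commute)
  define c where "c = 75 ^ omega q * sqrt (real q)"
  have c0: "c \<ge> 0"
    by (simp add: c_def)
  have KG: "norm (expo_sum q (u * l') (v * l)) \<le> c * sqrt (real_of_int (gcd (gcd u v) (int q)))" for u v
  proof -
    define D where "D = gcd (gcd (u * l') (v * l)) (int q)"
    have Dq: "D dvd int q" and Du: "D dvd u * l'" and Dv: "D dvd v * l"
      unfolding D_def by (meson dvd_trans gcd_dvd1 gcd_dvd2)+
    have "coprime D l'" "coprime D l"
      using cop Dq by (auto intro: coprime_divisors[of _ "int q" _ l'] coprime_divisors[of _ "int q" _ l] simp: coprime_commute)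
    hence "D dvd u" "D dvd v"
      using Du Dv by (simp_all add: coprime_dvd_mult_left_iff)
    hence "D dvd gcd (gcd u v) (int q)"
      using Dq by simp
    moreover have "gcd (gcd u v) (int q) > 0"
      using q by simp
    ultimately have "D \<le> gcd (gcd u v) (int q)"
      by (rule zdvd_imp_le)
    hence "c * sqrt (real_of_int D) \<le> c * sqrt (real_of_int (gcd (gcd u v) (int q)))"
      using c0 by (intro mult_left_mono real_sqrt_le_mono) auto
    thus ?thesis
      unfolding D_def by (rule order.trans[OF expo_sum_bound[OF q, of "u * l'" "v * l", folded c_def]])
  qed
  let ?S = "\<Sum>(t, s)\<in>inv_pairs q. norm (fejer q H (l' * t ^ 3 - a0)) ^ 2 * norm (fejer q G (l * s ^ 2 - b0)) ^ 2"
  define e where "e h h' g g' = e_mod q (- ((int h - int h') * a0 + (int g - int g') * b0))" for h h' g g' :: nat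
  have "of_real ?S = (\<Sum>(t, s)\<in>inv_pairs q. of_real (norm (fejer q H (l' * t ^ 3 - a0)) ^ 2) *
      of_real (norm (fejer q G (l * s ^ 2 - b0)) ^ 2) :: complex)"
    by (simp add: case_prod_unfold)
  also have "\<dots> = (\<Sum>y\<in>inv_pairs q. \<Sum>h<H. \<Sum>h'<H. \<Sum>g<G. \<Sum>g'<G.
      e h h' g g' * e_mod q ((int h - int h') * l' * fst y ^ 3 + (int g - int g') * l * snd y ^ 2))"
  proof (rule sum.cong[OF refl], unfold case_prod_unfold)
    fix y
    have "e_mod q ((int h - int h') * (l' * fst y ^ 3 - a0)) * e_mod q ((int g - int g') * (l * snd y ^ 2 - b0)) =
      e h h' g g' * e_mod q ((int h - int h') * l' * fst y ^ 3 + (int g - int g') * l * snd y ^ 2)" for h h' g g'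
      unfolding e_def e_mod_add[symmetric] by (rule arg_cong[of _ _ "e_mod q"]) (simp add: algebra_simps)
    thus "of_real (norm (fejer q H (l' * fst y ^ 3 - a0)) ^ 2) * of_real (norm (fejer q G (l * snd y ^ 2 - b0)) ^ 2) =
      (\<Sum>h<H. \<Sum>h'<H. \<Sum>g<G. \<Sum>g'<G.
        e h h' g g' * e_mod q ((int h - int h') * l' * fst y ^ 3 + (int g - int g') * l * snd y ^ 2))"
      unfolding fejer_square sum_distrib_right unfolding sum_distrib_left by simp
  qed
  also have "\<dots> = (\<Sum>h<H. \<Sum>h'<H. \<Sum>g<G. \<Sum>g'<G. \<Sum>y\<in>inv_pairs q.
      e h h' g g' * e_mod q ((int h - int h') * l' * fst y ^ 3 + (int g - int g') * l * snd y ^ 2))"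
    by (simp only: sum.swap[of _ _ "inv_pairs q"])
  also have "\<dots> = (\<Sum>h<H. \<Sum>h'<H. \<Sum>g<G. \<Sum>g'<G. e h h' g g' * expo_sum q ((int h - int h') * l') ((int g - int g') * l))"
    by (simp only: expo_sum_def case_prod_unfold sum_distrib_left)
  finally have eq: "of_real ?S = (\<Sum>h<H. \<Sum>h'<H. \<Sum>g<G. \<Sum>g'<G.
      e h h' g g' * expo_sum q ((int h - int h') * l') ((int g - int g') * l))" .
  have "?S \<le> norm (of_real ?S :: complex)"
    unfolding norm_of_real by (rule abs_ge_self)
  also have "\<dots> \<le> (\<Sum>h<H. \<Sum>h'<H. \<Sum>g<G. \<Sum>g'<G.
      c * sqrt (real_of_int (gcd (gcd (int h - int h') (int g - int g')) (int q))))"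
    unfolding eq
  proof (intro sum_norm_le)
    fix h h' g g' :: nat
    show "norm (e h h' g g' * expo_sum q ((int h - int h') * l') ((int g - int g') * l)) \<le>
       c * sqrt (real_of_int (gcd (gcd (int h - int h') (int g - int g')) (int q)))"
      using KG by (simp add: e_def norm_mult)
  qed
  also have "\<dots> = c * (\<Sum>h<H. \<Sum>h'<H. \<Sum>g<G. \<Sum>g'<G. sqrt (real_of_int (gcd (gcd (int h - int h') (int g - int g')) (int q))))"
    by (simp only: sum_distrib_left)
  also have "\<dots> \<le> c * (\<Sum>h<H. \<Sum>h'<H. real G * (\<Sum>v\<in>{- int G<..<int G}. sqrt (real_of_int (gcd (gcd (int h - int h') v) (int q)))))"
    using c0 by (intro mult_left_mono sum_mono sum_differences_le) auto
  also have "\<dots> \<le> c * (real H * (\<Sum>u\<in>{- int H<..<int H}. real G * (\<Sum>v\<in>{- int G<..<int G}. sqrt (real_of_int (gcd (gcd u v) (int q))))))"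
    using c0 by (intro mult_left_mono sum_differences_le[of "\<lambda>u. real G * (\<Sum>v\<in>{- int G<..<int G}. sqrt (real_of_int (gcd (gcd u v) (int q))))"])
      (auto intro!: mult_nonneg_nonneg sum_nonneg)
  also have "\<dots> = c * (real H * real G * (\<Sum>u\<in>{- int H<..<int H}. \<Sum>v\<in>{- int G<..<int G}. sqrt (real_of_int (gcd (gcd u v) (int q)))))"
    by (simp add: sum_distrib_left mult_ac)
  also have "\<dots> \<le> c * (real H * real G * (real (card {d. d dvd q}) * (8 * real H * real G + sqrt (real q))))"
    using c0 by (intro mult_left_mono sum_sqrt_gcd_le q H) auto
  finally show ?thesis
    by (simp add: c_def weight_def mult_ac)
qed

text \<open>A box meets each residue class at most once, because points within q / 8 of the same
  centre are less than \<open>q\<close> apart.\<close>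

lemma eq_if_cong_close:
  fixes x y z :: int
  assumes q: "q > (0 :: nat)" and cong: "[x = y] (mod int q)"
    and close: "\<bar>x - z\<bar> * 8 * int n \<le> int q" "\<bar>y - z\<bar> * 8 * int n \<le> int q" and n: "n \<ge> 1"
  shows "x = y"
proof (rule ccontr)
  assume "x \<noteq> y"
  have small: "8 * \<bar>w\<bar> \<le> int q" if "\<bar>w\<bar> * 8 * int n \<le> int q" for w
  proof -
    have "\<bar>w\<bar> * 8 * 1 \<le> \<bar>w\<bar> * 8 * int n"
      using n by (intro mult_left_mono) auto
    from order.trans[OF this that] show ?thesis
      by simp
  qed
  have "\<bar>x - y\<bar> < int q"
  proof -
    have "\<bar>x - y\<bar> \<le> \<bar>x - z\<bar> + \<bar>y - z\<bar>" "int q > 0"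
      using abs_triangle_ineq4[of "x - z" "y - z"] q by simp_all
    moreover have "a < int q" if "8 * b \<le> int q" "8 * c \<le> int q" "a \<le> b + c" "int q > 0" for a b c
      using that by linarith
    ultimately show ?thesis
      using small[OF close(1)] small[OF close(2)] by blast
  qed
  moreover have "int q dvd x - y"
    using cong by (simp add: cong_iff_dvd_diff)
  hence "\<bar>int q\<bar> \<le> \<bar>x - y\<bar>"
    using \<open>x \<noteq> y\<close> by (intro dvd_imp_le_int) auto
  ultimately show False
    by simp
qed

lemma sqrt_identity:
  fixes w r h :: real
  assumes "h > 0"
  shows "w * (8 * r * h ^ 2 + r ^ 2 * h) = w * (32 * r + 4 * r ^ 2 / h) * (h ^ 2 / 4)"
proof -
  have "4 * r ^ 2 / h * (h ^ 2 / 4) = r ^ 2 * h"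
    using assms by (simp add: power2_eq_square)
  hence "(32 * r + 4 * r ^ 2 / h) * (h ^ 2 / 4) = 8 * r * h ^ 2 + r ^ 2 * h"
    by (simp only: distrib_right)
  thus ?thesis
    by simp
qed

text \<open>Solutions of \<open>a\<^sup>2 b\<^sup>3 = l\<close> are parametrised by \<open>t = a b\<close>: \<open>a = l\<^sup>-\<^sup>1 t\<^sup>3\<close> and \<open>b = l t\<^sup>-\<^sup>2\<close>.\<close>

lemma box_count_le:
  fixes A B :: "int set"
  assumes q: "q > 0" and l: "coprime l (int q)" and H: "H \<ge> 1" "G \<ge> 1"
    and A: "finite A" "\<And>a. a \<in> A \<Longrightarrow> \<bar>a - a0\<bar> * 8 * int H \<le> int q"
    and B: "finite B" "\<And>b. b \<in> B \<Longrightarrow> \<bar>b - b0\<bar> * 8 * int G \<le> int q"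
  shows "real (card {(a, b) \<in> A \<times> B. [a ^ 2 * b ^ 3 = l] (mod int q)}) \<le>
     weight q * (32 * sqrt (real q) + 4 * real q / (real H * real G))"
proof -
  obtain l' where l': "[l * l' = 1] (mod int q)"
    using cong_solve_coprime_int[OF l] by blast
  define Sol where "Sol = {(a, b) \<in> A \<times> B. [a ^ 2 * b ^ 3 = l] (mod int q)}"
  have finSol: "finite Sol"
    by (rule finite_subset[of _ "A \<times> B"]) (auto simp: Sol_def A B)
  \<comment> \<open>The second component inverts the first: (a b)(a b^2 l') = a^2 b^3 l', which is 1
    modulo \<open>q\<close>.\<close>
  define \<phi> where "\<phi> = (\<lambda>(a, b). ((a * b) mod int q, (a * b ^ 2 * l') mod int q))"
  define w where "w = (\<lambda>(t, s). norm (fejer q H (l' * t ^ 3 - a0)) ^ 2 * norm (fejer q G (l * s ^ 2 - b0)) ^ 2)"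
  have param: "\<phi> (a, b) \<in> inv_pairs q" "[l' * fst (\<phi> (a, b)) ^ 3 = a] (mod int q)" "[l * snd (\<phi> (a, b)) ^ 2 = b] (mod int q)"
    if ab: "(a, b) \<in> Sol" for a b
  proof -
    have c: "[a ^ 2 * b ^ 3 = l] (mod int q)"
      using ab by (simp add: Sol_def)
    have one: "[a ^ 2 * b ^ 3 * l' = 1] (mod int q)"
      using cong_mult[OF c cong_refl[of l']] l' cong_trans by blast
    have "[(a * b) * (a * b ^ 2 * l') = 1] (mod int q)"
      using one by (simp add: power2_eq_square power3_eq_cube mult_ac)
    hence "[((a * b) mod int q) * ((a * b ^ 2 * l') mod int q) = 1] (mod int q)"
      by (simp add: cong_def mod_mult_eq)
    thus "\<phi> (a, b) \<in> inv_pairs q"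
      using q by (simp add: \<phi>_def inv_pairs_def)
    have "[l' * ((a * b) mod int q) ^ 3 = l' * (a * b) ^ 3] (mod int q)"
      by (intro cong_mult cong_pow) auto
    moreover have "l' * (a * b) ^ 3 = (a ^ 2 * b ^ 3 * l') * a"
      by (simp add: power2_eq_square power3_eq_cube mult_ac)
    moreover have "[(a ^ 2 * b ^ 3 * l') * a = 1 * a] (mod int q)"
      by (intro cong_mult one cong_refl)
    ultimately show "[l' * fst (\<phi> (a, b)) ^ 3 = a] (mod int q)"
      by (simp add: \<phi>_def cong_def)
    have "[l * ((a * b ^ 2 * l') mod int q) ^ 2 = l * (a * b ^ 2 * l') ^ 2] (mod int q)"
      by (intro cong_mult cong_pow) auto
    moreover have "l * (a * b ^ 2 * l') ^ 2 = (l * l') * (a ^ 2 * b ^ 3 * l') * b"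
      by (simp add: power2_eq_square power3_eq_cube mult_ac)
    moreover have "[(l * l') * (a ^ 2 * b ^ 3 * l') * b = 1 * 1 * b] (mod int q)"
      by (intro cong_mult one l' cong_refl)
    ultimately show "[l * snd (\<phi> (a, b)) ^ 2 = b] (mod int q)"
      by (simp add: \<phi>_def cong_def)
  qed
  have inj: "inj_on \<phi> Sol"
  proof (rule inj_onI)
    fix x y assume xy: "x \<in> Sol" "y \<in> Sol" "\<phi> x = \<phi> y"
    obtain a b a' b' where eq: "x = (a, b)" "y = (a', b')"
      by (metis surj_pair)
    have Sol: "(a, b) \<in> Sol" "(a', b') \<in> Sol" and \<phi>: "\<phi> (a, b) = \<phi> (a', b')"
      using xy unfolding eq by blast+
    have mem: "a \<in> A" "b \<in> B" "a' \<in> A" "b' \<in> B"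
      using Sol by (simp_all add: Sol_def)
    have "[a = a'] (mod int q)"
      using param(2)[OF Sol(1)] param(2)[OF Sol(2)] unfolding \<phi> by (metis cong_sym cong_trans)
    hence "a = a'"
      using A(2)[OF mem(1)] A(2)[OF mem(3)] H(1) by (rule eq_if_cong_close[OF q])
    moreover have "[b = b'] (mod int q)"
      using param(3)[OF Sol(1)] param(3)[OF Sol(2)] unfolding \<phi> by (metis cong_sym cong_trans)
    hence "b = b'"
      using B(2)[OF mem(2)] B(2)[OF mem(4)] H(2) by (rule eq_if_cong_close[OF q])
    ultimately show "x = y"
      by (simp add: eq)
  qed
  have low: "real H ^ 2 / 2 * (real G ^ 2 / 2) \<le> w (\<phi> x)" if x: "x \<in> Sol" for x
  proof -
    obtain a b where [simp]: "x = (a, b)"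
      by force
    have ab: "(a, b) \<in> Sol" "a \<in> A" "b \<in> B"
      using x by (auto simp: Sol_def)
    have "fejer q H (l' * fst (\<phi> (a, b)) ^ 3 - a0) = fejer q H (a - a0)"
      by (intro fejer_cong cong_diff param ab cong_refl)
    moreover have "fejer q G (l * snd (\<phi> (a, b)) ^ 2 - b0) = fejer q G (b - b0)"
      by (intro fejer_cong cong_diff param ab cong_refl)
    ultimately show ?thesis
      unfolding w_def \<open>x = (a, b)\<close> case_prod_unfold
      using mult_mono[OF fejer_lower[OF q A(2)[OF ab(2)]] fejer_lower[OF q B(2)[OF ab(3)]]] by simp
  qed
  have "real (card Sol) * (real H ^ 2 / 2 * (real G ^ 2 / 2)) = (\<Sum>x\<in>Sol. real H ^ 2 / 2 * (real G ^ 2 / 2))"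
    by simp
  also have "\<dots> \<le> (\<Sum>x\<in>Sol. w (\<phi> x))"
    by (rule sum_mono[OF low])
  also have "\<dots> = (\<Sum>y\<in>\<phi> ` Sol. w y)"
    using inj by (simp add: sum.reindex)
  also have "\<dots> \<le> (\<Sum>y\<in>inv_pairs q. w y)"
    using param(1) by (intro sum_mono2) (auto simp: w_def)
  also have "\<dots> \<le> real H * real G * weight q * sqrt (real q) * (8 * real H * real G + sqrt (real q))"
    unfolding w_def by (rule fejer_sum_le[OF q H l'])
  finally have le: "real (card Sol) * (real H ^ 2 / 2 * (real G ^ 2 / 2)) \<le>
    real H * real G * weight q * sqrt (real q) * (8 * real H * real G + sqrt (real q))" .
  define h where "h = real H * real G"
  have h: "h > 0"
    using H by (simp add: h_def)
  have "real (card Sol) * (h ^ 2 / 4) \<le> h * weight q * sqrt (real q) * (8 * h + sqrt (real q))"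
    using le by (simp add: h_def power_mult_distrib mult_ac)
  also have "\<dots> = weight q * (8 * sqrt (real q) * h ^ 2 + sqrt (real q) ^ 2 * h)"
    by (simp only: power2_eq_square ring_distribs mult_ac)
  also have "\<dots> = weight q * (32 * sqrt (real q) + 4 * real q / h) * (h ^ 2 / 4)"
    using sqrt_identity[OF h, of "weight q" "sqrt (real q)"] by simp
  finally show ?thesis
    unfolding Sol_def h_def[symmetric] by (rule mult_right_le_imp_le) (use h in simp)
qed

lemma real_of_nat_div_le: "real (m div n) \<le> real m / real n"
  using real_of_int_div4[of "int m" "int n"] by (simp flip: zdiv_int)

lemma weight_growth:
  fixes \<epsilon> :: real
  assumes "\<epsilon> > 0"
  obtains A where "A > 0" "\<And>n. n > 0 \<Longrightarrow> weight n \<le> A * real n powr \<epsilon>"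
proof (rule submultiplicative_growth[OF assms, of 75 weight])
  show "weight 1 \<le> 1"
    by (simp add: weight_def omega_def)
  show "weight n \<ge> 0" for n
    by (simp add: weight_def)
  show "weight (p ^ k * m) \<le> 75 * real (Suc k) * weight m"
    if "prime p" "k > 0" "m > 0" "\<not> p dvd m" for p k m
  proof -
    have "card {d. d dvd p ^ k * m} \<le> card {d. d dvd p ^ k} * card {d. d dvd m}"
      using that by (intro card_divisors_mult_le) (auto simp: prime_gt_0_nat)
    also have "\<dots> \<le> Suc k * card {d. d dvd m}"
      by (intro mult_right_mono card_divisors_prime_power that) simp
    finally have "real (card {d. d dvd p ^ k * m}) \<le> real (Suc k * card {d. d dvd m})"
      by (simp only: of_nat_le_iff)
    hence "75 ^ Suc (omega m) * real (card {d. d dvd p ^ k * m}) \<le>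
        75 ^ Suc (omega m) * (real (Suc k) * real (card {d. d dvd m}))"
      unfolding of_nat_mult by (rule mult_left_mono) simp
    thus ?thesis
      unfolding weight_def omega_prime_power_mult[OF that] by (simp only: power_Suc mult_ac)
  qed
qed auto

text \<open>
  For \<open>d = gcd (w - 1) q\<close> the complementary divisor \<open>q / d\<close> divides \<open>w + 1\<close>, which determines \<open>2 w\<close>
  modulo \<open>q\<close>.
\<close>

lemma square_root_of_one_dvd:
  fixes q v w :: int
  assumes q: "q > 0" and v: "q dvd v ^ 2 - 1" and w: "q dvd w ^ 2 - 1" and gcd: "gcd (v - 1) q = gcd (w - 1) q"
  shows "q dvd 2 * (v - w)"
proof -
  define d where "d = gcd (w - 1) q"
  have d: "d > 0" "d dvd q"
    using q by (auto simp: d_def)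
  define e where "e = q div d"
  have qde: "q = d * e"
    using d by (simp add: e_def)
  have e0: "e \<noteq> 0"
    using q qde by auto
  have edvd: "e dvd z + 1" if z: "q dvd z ^ 2 - 1" "gcd (z - 1) q = d" for z
  proof -
    define u where "u = (z - 1) div d"
    have u: "d * u = z - 1"
      using z(2) unfolding u_def by (metis dvd_mult_div_cancel gcd_dvd1)
    have "z ^ 2 - 1 = (z - 1) * (z + 1)"
      by (simp add: power2_eq_square algebra_simps)
    also have "\<dots> = d * (u * (z + 1))"
      by (simp only: u[symmetric] mult.assoc)
    finally have "d * e dvd d * (u * (z + 1))"
      using z(1) unfolding qde by simp
    hence "e dvd u * (z + 1)"
      using d(1) by simp
    moreover have "coprime u e"
      unfolding u_def e_def z(2)[symmetric] using q by (intro div_gcd_coprime) auto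
    ultimately show ?thesis
      by (simp add: coprime_commute coprime_dvd_mult_right_iff)
  qed
  have "d dvd v - 1" "d dvd w - 1"
    unfolding d_def using gcd_dvd1[of "v - 1" q] unfolding gcd by simp_all
  hence "d dvd (v - 1) - (w - 1)"
    by (rule dvd_diff)
  hence "d dvd v - w"
    by simp
  then obtain y where y: "v - w = d * y" ..
  have "e dvd (v + 1) - (w + 1)"
    using edvd[OF v] edvd[OF w] gcd by (intro dvd_diff) (auto simp: d_def)
  hence edy: "e dvd d * y"
    by (simp add: y[symmetric])
  define g where "g = gcd d e"
  have gm: "g dvd w - 1"
    unfolding g_def using \<open>d dvd w - 1\<close> by (meson dvd_trans gcd_dvd1)
  have gp: "g dvd w + 1"
    unfolding g_def using edvd[OF w d_def[symmetric]] by (meson dvd_trans gcd_dvd2)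
  from dvd_diff[OF gp gm] have g2: "g dvd 2"
    by simp
  have "e dvd gcd (y * d) (y * e)"
    using edy by (simp add: mult.commute)
  hence "e dvd y * g"
    by (simp add: gcd_mult_left g_def)
  hence "e dvd y * 2"
    by (rule dvd_trans) (intro mult_dvd_mono dvd_refl g2)
  hence "d * e dvd d * (y * 2)"
    by (intro mult_dvd_mono) auto
  thus ?thesis
    unfolding qde y by (simp add: mult_ac)
qed

text \<open>There is one fibre for each divisor gcd (w - 1) q, and the members of a fibre agree up
  to multiples of q / 2.\<close>

lemma card_square_roots_of_one_le:
  assumes q: "q > 0"
  shows "card {w \<in> {0..<int q}. [w ^ 2 = 1] (mod int q)} \<le> 3 * card {d. d dvd q}"
proof -
  define W where "W = {w \<in> {0..<int q}. [w ^ 2 = 1] (mod int q)}"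
  have finW: "finite W"
    by (rule finite_subset[of _ "{0..<int q}"]) (auto simp: W_def)
  have finD: "finite {d. d dvd q}"
    using q by (simp add: finite_divisors_nat)
  have dvd: "int q dvd w ^ 2 - 1" if "w \<in> W" for w
    using that by (simp add: W_def cong_iff_dvd_diff)
  have fibre: "card {w \<in> W. gcd (w - 1) (int q) = int d} \<le> 3" for d
  proof (cases "{w \<in> W. gcd (w - 1) (int q) = int d} = {}")
    case True
    show ?thesis
      unfolding True by simp
  next
    case False
    then obtain v where v: "v \<in> W" "gcd (v - 1) (int q) = int d"
      by blast
    \<comment> \<open>Since 2 (w - v) = q k and the distance of \<open>w\<close> and
      \<open>v\<close> is below \<open>q\<close>, only k = -1, 0, 1 is possible.\<close>
    have "{w \<in> W. gcd (w - 1) (int q) = int d} \<subseteq> (\<lambda>k. v + int q * k div 2) ` {-1, 0, 1}"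
    proof
      fix w assume "w \<in> {w \<in> W. gcd (w - 1) (int q) = int d}"
      hence w: "w \<in> W" "gcd (w - 1) (int q) = gcd (v - 1) (int q)"
        using v by auto
      have "int q dvd 2 * (w - v)"
        using q by (intro square_root_of_one_dvd dvd w v) auto
      then obtain k where k: "2 * (w - v) = int q * k" ..
      have "\<bar>w - v\<bar> < int q"
        using v w by (auto simp: W_def abs_if)
      moreover have "\<bar>2 * (w - v)\<bar> = \<bar>int q * k\<bar>"
        by (simp only: k)
      hence "2 * \<bar>w - v\<bar> = int q * \<bar>k\<bar>"
        by (simp only: abs_mult abs_of_nat abs_numeral)
      ultimately have "int q * \<bar>k\<bar> < int q * 2"
        unfolding mult.commute[of "int q" 2] by (metis mult_less_cancel_left_pos zero_less_numeral)
      hence "\<bar>k\<bar> < 2"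
        using q by simp
      hence "k \<in> {-1, 0, 1}"
        by auto
      moreover have "w = v + int q * k div 2"
        by (simp add: k[symmetric])
      ultimately show "w \<in> (\<lambda>k. v + int q * k div 2) ` {-1, 0, 1}"
        by blast
    qed
    hence "card {w \<in> W. gcd (w - 1) (int q) = int d} \<le> card ((\<lambda>k. v + int q * k div 2) ` {-1, 0, 1})"
      by (intro card_mono) auto
    also have "\<dots> \<le> card {-1, 0, 1 :: int}"
      by (rule card_image_le) simp
    finally show ?thesis
      by simp
  qed
  have "W \<subseteq> (\<Union>d\<in>{d. d dvd q}. {w \<in> W. gcd (w - 1) (int q) = int d})"
  proof
    fix w assume "w \<in> W"
    moreover have "int (nat (gcd (w - 1) (int q))) = gcd (w - 1) (int q)"
      by simp
    moreover from this have "nat (gcd (w - 1) (int q)) dvd q"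
      by (metis gcd_dvd2 int_dvd_int_iff)
    ultimately show "w \<in> (\<Union>d\<in>{d. d dvd q}. {w \<in> W. gcd (w - 1) (int q) = int d})"
      by auto
  qed
  hence "card W \<le> card (\<Union>d\<in>{d. d dvd q}. {w \<in> W. gcd (w - 1) (int q) = int d})"
    using finD finW by (intro card_mono) auto
  also have "\<dots> \<le> (\<Sum>d\<in>{d. d dvd q}. card {w \<in> W. gcd (w - 1) (int q) = int d})"
    by (rule card_UN_le[OF finD])
  also have "\<dots> \<le> (\<Sum>d\<in>{d. d dvd q}. 3)"
    by (rule sum_mono[OF fibre])
  finally show ?thesis
    by (simp add: W_def mult.commute)
qed

text \<open>Relative to one solution \<open>a0\<close>, every other solution is \<open>a0\<close>
  times a square root of 1 modulo \<open>q\<close>. That root and the quotient of \<open>a\<close>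
  by \<open>q\<close> determine \<open>a\<close>.\<close>

lemma card_fixed_b_le:
  fixes A :: nat
  assumes q: "q > 0" and l: "coprime l (int q)"
  shows "real (card {a \<in> {1..int A}. [a ^ 2 * b ^ 3 = l] (mod int q)}) \<le>
    3 * real (card {d. d dvd q}) * (real A / real q + 1)"
proof -
  define S where "S = {a \<in> {1..int A}. [a ^ 2 * b ^ 3 = l] (mod int q)}"
  define W where "W = {w \<in> {0..<int q}. [w ^ 2 = 1] (mod int q)}"
  show ?thesis
  proof (cases "S = {}")
    case True
    show ?thesis
      unfolding S_def[symmetric] True by simp
  next
    case False
    then obtain a0 where a0: "a0 \<in> S"
      by blast
    have cong: "[a ^ 2 * b ^ 3 = l] (mod int q)" if "a \<in> S" for a
      using that by (simp add: S_def)
    have "coprime (a0 ^ 2 * b ^ 3) (int q)"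
      using cong[OF a0] l by (metis cong_imp_coprime cong_sym)
    hence cop: "coprime a0 (int q)" "coprime (b ^ 3) (int q)"
      by simp_all
    obtain c where c: "[a0 * c = 1] (mod int q)"
      using cong_solve_coprime_int[OF cop(1)] by blast
    define \<phi> where "\<phi> a = ((a * c) mod int q, a div int q)" for a
    have maps: "\<phi> ` S \<subseteq> W \<times> {0..int (A div q)}"
    proof
      fix y assume "y \<in> \<phi> ` S"
      then obtain a where a: "a \<in> S" "y = \<phi> a"
        by blast
      have "[a ^ 2 * b ^ 3 = a0 ^ 2 * b ^ 3] (mod int q)"
        using cong[OF a(1)] cong[OF a0] by (metis cong_sym cong_trans)
      hence sq: "[a ^ 2 = a0 ^ 2] (mod int q)"
        using cop(2) by (simp add: cong_mult_rcancel)
      have "[((a * c) mod int q) ^ 2 = (a * c) ^ 2] (mod int q)"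
        by (intro cong_pow) simp
      also have "(a * c) ^ 2 = a ^ 2 * c ^ 2"
        by (rule power_mult_distrib)
      also have "[a ^ 2 * c ^ 2 = a0 ^ 2 * c ^ 2] (mod int q)"
        by (intro cong_mult sq cong_refl)
      also have "a0 ^ 2 * c ^ 2 = (a0 * c) ^ 2"
        by (simp add: power_mult_distrib)
      also have "[(a0 * c) ^ 2 = 1 ^ 2] (mod int q)"
        by (rule cong_pow[OF c])
      finally have "(a * c) mod int q \<in> W"
        using q by (simp add: W_def)
      moreover have "a div int q \<in> {0..int (A div q)}"
        using a(1) q zdiv_mono1[of a "int A" "int q"] by (auto simp: S_def zdiv_int pos_imp_zdiv_nonneg_iff)
      ultimately show "y \<in> W \<times> {0..int (A div q)}"
        by (simp add: a(2) \<phi>_def)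
    qed
    have inj: "inj_on \<phi> S"
    proof (rule inj_onI)
      fix a a' assume eq: "\<phi> a = \<phi> a'"
      hence "[a * c = a' * c] (mod int q)"
        by (simp add: \<phi>_def cong_def)
      hence *: "[(a * c) * a0 = (a' * c) * a0] (mod int q)"
        by (rule cong_mult) (rule cong_refl)
      have inv: "[(z * c) * a0 = z] (mod int q)" for z
      proof -
        have "(z * c) * a0 = z * (a0 * c)"
          by simp
        thus ?thesis
          using cong_mult[OF cong_refl c, of z] by (simp only: mult_1_right)
      qed
      have "[a = a'] (mod int q)"
        using cong_trans[OF cong_trans[OF cong_sym[OF inv] *] inv] .
      moreover have "a div int q = a' div int q"
        using eq by (simp add: \<phi>_def)
      ultimately show "a = a'"
        unfolding cong_def by (metis div_mult_mod_eq)
    qed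
    have finW: "finite W"
      by (rule finite_subset[of _ "{0..<int q}"]) (auto simp: W_def)
    have "card S \<le> card (W \<times> {0..int (A div q)})"
      using maps inj finW by (metis card_inj_on_le finite_SigmaI finite_atLeastAtMost_int)
    also have "\<dots> = card W * Suc (A div q)"
      by (simp add: card_cartesian_product nat_add_distrib)
    also have "\<dots> \<le> (3 * card {d. d dvd q}) * Suc (A div q)"
      unfolding W_def by (intro mult_right_mono card_square_roots_of_one_le q) simp
    finally have "real (card S) \<le> real ((3 * card {d. d dvd q}) * Suc (A div q))"
      by (simp only: of_nat_le_iff)
    also have "\<dots> = 3 * real (card {d. d dvd q}) * (real (A div q) + 1)"
      by (simp add: algebra_simps)
    also have "\<dots> \<le> 3 * real (card {d. d dvd q}) * (real A / real q + 1)"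
      by (intro mult_left_mono add_right_mono real_of_nat_div_le) auto
    finally show ?thesis
      by (simp add: S_def)
  qed
qed

section \<open>Squarefull numbers\<close>

text \<open>An even exponent of a prime goes entirely into the square. An odd one is at least 3 and
  first gives one factor \<open>p\<close> to \<open>b\<close>.\<close>

lemma squarefull_imp_square_times_cube:
  assumes "squarefull n"
  shows "\<exists>a b. a > 0 \<and> b > 0 \<and> n = a ^ 2 * b ^ 3"
proof -
  have "n > 0"
    using assms by (simp add: squarefull_def)
  thus ?thesis
    using assms
  proof (induction n rule: prime_power_induct)
    case one
    show ?case
      by (intro exI[of _ 1]) simp
  next
    case (step p k m)
    have "squarefull m"
      unfolding squarefull_def
    proof (intro conjI allI impI)
      fix r assume r: "prime r" "r dvd m"
      hence "r \<noteq> p"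
        using step.hyps by auto
      hence "coprime (r ^ 2) (p ^ k)"
        using r step.hyps by (simp add: primes_coprime)
      moreover have "r ^ 2 dvd p ^ k * m"
        using step.prems r by (simp add: squarefull_def)
      ultimately show "r ^ 2 dvd m"
        by (simp add: coprime_dvd_mult_right_iff)
    qed (use step.hyps in simp)
    then obtain a b where ab: "a > 0" "b > 0" "m = a ^ 2 * b ^ 3"
      using step.IH by blast
    have p: "p > 0"
      using step.hyps by (simp add: prime_gt_0_nat)
    have "p dvd p ^ k * m"
      using step.hyps by (simp add: dvd_power)
    hence "p ^ 2 dvd p ^ k * m"
      using step.prems step.hyps(1) by (simp add: squarefull_def)
    hence "k \<noteq> 1"
      using step.hyps p by (auto simp: power2_eq_square)
    show ?case
    proof (cases "even k")
      case True
      then obtain i where "k = 2 * i" ..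
      thus ?thesis
        using ab p by (intro exI[of _ "p ^ i * a"] exI[of _ b])
          (auto simp: power_mult_distrib power_mult[symmetric] mult_ac)
    next
      case False
      then obtain i where i: "k = 2 * i + 1" ..
      then obtain j where j: "i = Suc j"
        using \<open>k \<noteq> 1\<close> by (cases i) auto
      have "p ^ k = (p ^ j) ^ 2 * p ^ 3"
        unfolding i j power_mult[symmetric] power_add[symmetric] by (rule arg_cong[of _ _ "\<lambda>i. p ^ i"]) simp
      thus ?thesis
        using ab p by (intro exI[of _ "p ^ j * a"] exI[of _ "p * b"])
          (auto simp: power_mult_distrib mult_ac)
    qed
  qed
qed

text \<open>A short interval is covered by a single box, with \<open>H\<close> as large as the width
  allows; a long one by boxes of length about q / 8 with H = 1. The number of boxes controls the
  error term in the counts, the weighted number \<open>card Z * q / H\<close> the main term.\<close>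

lemma interval_cover:
  fixes N q :: nat
  assumes N: "N \<ge> 1" and q: "q \<ge> 1"
  obtains H :: nat and Z :: "int set" where "H \<ge> 1" "finite Z"
    "real (card Z) \<le> 1 + 16 * real N / real q" "real (card Z) * real q / real H \<le> 16 * real N"
    "\<And>a. a \<in> {1..int N} \<Longrightarrow> \<exists>z\<in>Z. \<bar>a - z\<bar> * 8 * int H \<le> int q"
proof (cases "8 * N \<le> q")
  case True
  define H where "H = q div (8 * N)"
  have H1: "H \<ge> 1"
    unfolding H_def using True N by (simp add: Suc_le_eq div_greater_zero_iff)
  have "q < 8 * N * Suc H"
    unfolding H_def using N dividend_less_times_div[of "8 * N" q] by simp
  also have "\<dots> \<le> 8 * N * (2 * H)"
    using H1 by (intro mult_left_mono) auto
  finally have "real q < real (8 * N * (2 * H))"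
    by (simp only: of_nat_less_iff)
  hence "real q \<le> 16 * real N * real H"
    by simp
  hence c: "real q / real H \<le> 16 * real N"
    using H1 by (simp add: divide_le_eq)
  have "8 * N * H \<le> q"
    unfolding H_def by (rule times_div_less_eq_dividend)
  hence "int (8 * N * H) \<le> int q"
    by (simp only: of_nat_le_iff)
  hence "int N * 8 * int H \<le> int q"
    by (simp add: mult_ac)
  moreover have "\<bar>a - 0\<bar> * 8 * int H \<le> int N * 8 * int H" if "a \<in> {1..int N}" for a
    using that by (intro mult_right_mono) auto
  ultimately have "\<exists>z\<in>{0}. \<bar>a - z\<bar> * 8 * int H \<le> int q" if "a \<in> {1..int N}" for a
    using that by (meson insertI1 order.trans)
  thus ?thesis
    using that[of H "{0}"] H1 c by simp
next
  case False
  define s where "s = q div 8 + 1"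
  define Z where "Z = (\<lambda>j. int (s * j)) ` {..N div s}"
  have "q \<le> 8 * s"
    unfolding s_def by presburger
  hence "real q \<le> real (8 * s)"
    by (simp only: of_nat_le_iff)
  hence "real q \<le> 8 * real s"
    by simp
  hence "real N * real q \<le> real N * (8 * real s)"
    by (rule mult_left_mono) simp
  hence "real N / real s \<le> 8 * real N / real q"
    using q by (simp add: s_def field_simps)
  moreover have "card Z \<le> Suc (N div s)"
    unfolding Z_def using card_image_le[of "{..N div s}"] by simp
  hence "real (card Z) \<le> 1 + real (N div s)"
    by simp
  moreover have "real (N div s) \<le> real N / real s"
    by (rule real_of_nat_div_le)
  ultimately have card: "real (card Z) \<le> 1 + 8 * real N / real q"
    by linarith
  hence "real (card Z) * real q \<le> (1 + 8 * real N / real q) * real q"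
    by (rule mult_right_mono) simp
  also have "\<dots> = real q + 8 * real N"
    using q by (simp add: distrib_right)
  finally have card2: "real (card Z) * real q \<le> 16 * real N"
    using False by linarith
  have cover: "\<exists>z\<in>Z. \<bar>a - z\<bar> * 8 * int 1 \<le> int q" if a: "a \<in> {1..int N}" for a
  proof -
    obtain n where n: "a = int n" "n \<le> N"
      using a by (metis atLeastAtMost_iff nat_le_iff nonneg_int_cases order.trans zero_le_one of_nat_le_iff)
    have "n div s \<in> {..N div s}"
      using n by (simp add: div_le_mono)
    hence "int (s * (n div s)) \<in> Z"
      unfolding Z_def by blast
    moreover have "a - int (s * (n div s)) = int (n mod s)"
      unfolding n by (simp add: minus_mult_div_eq_mod[symmetric] of_nat_diff)
    moreover have "n mod s * 8 \<le> q"
    proof -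
      have "n mod s < s"
        by (simp add: s_def)
      thus ?thesis
        unfolding s_def by linarith
    qed
    ultimately show ?thesis
      by (intro bexI[of _ "int (s * (n div s))"]) auto
  qed
  have "8 * real N / real q \<le> 16 * real N / real q"
    by (intro divide_right_mono) auto
  thus ?thesis
    using that[of 1 Z] card card2 cover by (simp add: Z_def)
qed

definition dyadic_pairs :: "nat \<Rightarrow> real \<Rightarrow> int \<Rightarrow> nat \<Rightarrow> (int \<times> int) set" where
  "dyadic_pairs q x l j = {(a, b). a \<ge> 1 \<and> b \<ge> 1 \<and> real_of_int (a ^ 2 * b ^ 3) \<le> x \<and>
     [a ^ 2 * b ^ 3 = l] (mod int q) \<and> b \<in> {2 ^ j..<2 ^ Suc j}}"

text \<open>\<open>box_count_le\<close> is summed over a grid of boxes. The weighted counts keep the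
  main term proportional to A B / q even when one box covers everything.\<close>

lemma rectangle_count_le:
  fixes A B :: nat
  assumes q: "q \<ge> 1" and l: "coprime l (int q)" and A: "A \<ge> 1" and B: "B \<ge> 1"
  shows "real (card {(a, b) \<in> {1..int A} \<times> {1..int B}. [a ^ 2 * b ^ 3 = l] (mod int q)}) \<le>
    weight q * (32 * sqrt (real q) * (1 + 16 * real A / real q) * (1 + 16 * real B / real q) +
      1024 * real A * real B / real q)"
proof -
  define S where "S = {(a, b). [a ^ 2 * b ^ 3 = l] (mod int q)}"
  obtain H Z where Z: "H \<ge> 1" "finite Z"
    "real (card Z) \<le> 1 + 16 * real A / real q" "real (card Z) * real q / real H \<le> 16 * real A"
    "\<And>a. a \<in> {1..int A} \<Longrightarrow> \<exists>z\<in>Z. \<bar>a - z\<bar> * 8 * int H \<le> int q"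
    using interval_cover[OF A q] by metis
  obtain G Y where Y: "G \<ge> 1" "finite Y"
    "real (card Y) \<le> 1 + 16 * real B / real q" "real (card Y) * real q / real G \<le> 16 * real B"
    "\<And>b. b \<in> {1..int B} \<Longrightarrow> \<exists>z\<in>Y. \<bar>b - z\<bar> * 8 * int G \<le> int q"
    using interval_cover[OF B q] by metis
  define box where "box = (\<lambda>(z, y). {(a, b) \<in> {a \<in> {1..int A}. \<bar>a - z\<bar> * 8 * int H \<le> int q} \<times>
    {b \<in> {1..int B}. \<bar>b - y\<bar> * 8 * int G \<le> int q}. [a ^ 2 * b ^ 3 = l] (mod int q)})"
  have finbox: "finite (box zy)" for zy
    by (rule finite_subset[of _ "{1..int A} \<times> {1..int B}"]) (auto simp: box_def split: prod.splits)
  have card_box: "real (card (box zy)) \<le> weight q * (32 * sqrt (real q) + 4 * real q / (real H * real G))" for zy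
  proof (cases zy)
    case (Pair z y)
    show ?thesis
      unfolding Pair box_def case_prod_conv
      by (rule box_count_le[OF _ l Z(1) Y(1), where ?a0.0 = z and ?b0.0 = y])
        (use q in \<open>auto intro: finite_subset[of _ "{1..int A}"] finite_subset[of _ "{1..int B}"]\<close>)
  qed
  have "{(a, b) \<in> {1..int A} \<times> {1..int B}. [a ^ 2 * b ^ 3 = l] (mod int q)} \<subseteq> (\<Union>zy\<in>Z \<times> Y. box zy)"
    using Z(5) Y(5) by (fastforce simp: box_def)
  hence "card {(a, b) \<in> {1..int A} \<times> {1..int B}. [a ^ 2 * b ^ 3 = l] (mod int q)} \<le> card (\<Union>zy\<in>Z \<times> Y. box zy)"
    using Z(2) Y(2) finbox by (intro card_mono) auto
  also have "\<dots> \<le> (\<Sum>zy\<in>Z \<times> Y. card (box zy))"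
    using Z(2) Y(2) by (intro card_UN_le) simp
  finally have "real (card {(a, b) \<in> {1..int A} \<times> {1..int B}. [a ^ 2 * b ^ 3 = l] (mod int q)}) \<le>
      (\<Sum>zy\<in>Z \<times> Y. real (card (box zy)))"
    by (simp only: of_nat_le_iff of_nat_sum[symmetric])
  also have "\<dots> \<le> (\<Sum>zy\<in>Z \<times> Y. weight q * (32 * sqrt (real q) + 4 * real q / (real H * real G)))"
    by (rule sum_mono[OF card_box])
  also have "\<dots> = real (card Z) * real (card Y) * (weight q * (32 * sqrt (real q) + 4 * real q / (real H * real G)))"
    by (simp add: card_cartesian_product)
  also have "\<dots> = weight q * (32 * sqrt (real q) * real (card Z) * real (card Y) +
      4 / real q * ((real (card Z) * real q / real H) * (real (card Y) * real q / real G)))"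
    using q by (simp add: field_simps)
  also have "\<dots> \<le> weight q * (32 * sqrt (real q) * (1 + 16 * real A / real q) * (1 + 16 * real B / real q) +
      4 / real q * ((16 * real A) * (16 * real B)))"
    using weight_ge_card_divisors[of q]
    by (intro mult_left_mono add_mono mult_mono Z(3,4) Y(3,4)) (auto intro: order.trans[rotated])
  also have "4 / real q * ((16 * real A) * (16 * real B)) = 1024 * real A * real B / real q"
    by simp
  finally show ?thesis .
qed

text \<open>Every term is compared with R = sqrt(x) / q through the criterion y^2 q^2 \<le> x. A
  nonempty range supplies the extra information A \<ge> 1 and M^3 \<le> x.\<close>

lemma card_dyadic_pairs_le:
  assumes q: "q \<ge> 1" and qx: "real q ^ 3 \<le> x" and l: "coprime l (int q)"
  shows "real (card (dyadic_pairs q x l j)) \<le> 20000 * weight q * (sqrt x / real q)"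
proof (cases "dyadic_pairs q x l j = {}")
  case True
  have "0 \<le> real q ^ 3"
    by simp
  hence "x \<ge> 0"
    using qx by (rule order.trans)
  thus ?thesis
    unfolding True by (simp add: weight_def)
next
  case False
  define M :: nat where "M = 2 ^ j"
  have M1: "M \<ge> 1"
    by (simp add: M_def)
  define A where "A = nat \<lfloor>sqrt (x / real M ^ 3)\<rfloor>"
  define R where "R = sqrt x / real q"
  have x0: "x > 0"
    using q qx by (auto intro: less_le_trans[of _ "real q ^ 3"])
  have mem: "b \<in> {int M..<2 * int M}" "a \<in> {1..int A}" "real M ^ 3 \<le> x" if ab: "(a, b) \<in> dyadic_pairs q x l j" for a b
  proof -
    have a: "a \<ge> 1" and le: "real_of_int (a ^ 2 * b ^ 3) \<le> x" and b: "int M \<le> b" "b < 2 * int M"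
      using ab by (simp_all add: dyadic_pairs_def M_def)
    show "b \<in> {int M..<2 * int M}"
      using b by simp
    have "int M ^ 3 \<le> b ^ 3"
      using b by (intro power_mono) auto
    hence "a ^ 2 * int M ^ 3 \<le> a ^ 2 * b ^ 3"
      by (rule mult_left_mono) simp
    hence "real_of_int (a ^ 2 * int M ^ 3) \<le> x"
      using le by (meson of_int_le_iff order.trans)
    hence axM: "real_of_int a ^ 2 * real M ^ 3 \<le> x"
      by simp
    hence "real_of_int a ^ 2 \<le> x / real M ^ 3"
      using M1 by (simp add: pos_le_divide_eq)
    hence "real_of_int a \<le> sqrt (x / real M ^ 3)"
      by (rule real_le_rsqrt)
    hence "a \<le> \<lfloor>sqrt (x / real M ^ 3)\<rfloor>"
      by (simp add: le_floor_iff)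
    thus "a \<in> {1..int A}"
      using a x0 by (simp add: A_def)
    have "1 * real M ^ 3 \<le> real_of_int a ^ 2 * real M ^ 3"
      using a by (intro mult_right_mono) auto
    thus "real M ^ 3 \<le> x"
      using axM by simp
  qed
  obtain a0 b0 where ab0: "(a0, b0) \<in> dyadic_pairs q x l j"
    using False by auto
  have A1: "A \<ge> 1"
    using mem(2)[OF ab0] by simp
  have M3: "real M ^ 3 \<le> x"
    by (rule mem(3)[OF ab0])
  have "real A \<le> sqrt (x / real M ^ 3)"
    unfolding A_def using x0 by (simp add: of_nat_floor)
  hence "real A ^ 2 \<le> sqrt (x / real M ^ 3) ^ 2"
    by (rule power_mono) simp
  hence "real A ^ 2 \<le> x / real M ^ 3"
    using x0 by simp
  hence AM: "real A ^ 2 * real M ^ 3 \<le> x"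
    using M1 by (simp add: pos_le_divide_eq)
  have R: "y \<le> R" if "y ^ 2 * real q ^ 2 \<le> x" for y :: real
  proof -
    have "y * real q \<le> sqrt x"
      using that by (intro real_le_rsqrt) (simp add: power_mult_distrib)
    thus ?thesis
      using q by (simp add: R_def pos_le_divide_eq)
  qed
  have R0: "R \<ge> 0"
    using x0 by (simp add: R_def)
  have AMR: "real A * real M / real q \<le> R"
  proof (rule R)
    have "real A ^ 2 * real M ^ 2 \<le> real A ^ 2 * real M ^ 3"
      using M1 by (intro mult_left_mono power_increasing) auto
    thus "(real A * real M / real q) ^ 2 * real q ^ 2 \<le> x"
      using AM q by (simp add: power_divide power_mult_distrib)
  qed
  show ?thesis
  proof (cases "M ^ 3 < q")
    case True
    have "M ^ 2 \<le> M ^ 3"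
      using M1 by (intro power_increasing) auto
    hence "M ^ 2 \<le> q"
      using True by linarith
    hence "real M ^ 2 \<le> real q"
      by (metis of_nat_le_iff of_nat_power)
    hence "real M ^ 2 * real q ^ 2 \<le> real q * real q ^ 2"
      by (rule mult_right_mono) simp
    hence MR: "real M \<le> R"
      using qx by (intro R) (simp add: power2_eq_square power3_eq_cube)
    have "dyadic_pairs q x l j \<subseteq>
      (\<Union>b\<in>{int M..<2 * int M}. (\<lambda>a. (a, b)) ` {a \<in> {1..int A}. [a ^ 2 * b ^ 3 = l] (mod int q)})"
    proof
      fix ab assume ab: "ab \<in> dyadic_pairs q x l j"
      obtain a b where [simp]: "ab = (a, b)"
        by force
      have "[a ^ 2 * b ^ 3 = l] (mod int q)"
        using ab by (simp add: dyadic_pairs_def)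
      thus "ab \<in> (\<Union>b\<in>{int M..<2 * int M}. (\<lambda>a. (a, b)) ` {a \<in> {1..int A}. [a ^ 2 * b ^ 3 = l] (mod int q)})"
        using mem(1,2)[of a b] ab by auto
    qed
    moreover have "finite ((\<lambda>a. (a, b)) ` {a \<in> {1..int A}. [a ^ 2 * b ^ 3 = l] (mod int q)})" for b
      by (rule finite_imageI, rule finite_subset[of _ "{1..int A}"]) auto
    hence "finite (\<Union>b\<in>{int M..<2 * int M}. (\<lambda>a. (a, b)) ` {a \<in> {1..int A}. [a ^ 2 * b ^ 3 = l] (mod int q)})"
      by (intro finite_UN_I) simp_all
    ultimately have "card (dyadic_pairs q x l j) \<le>
      card (\<Union>b\<in>{int M..<2 * int M}. (\<lambda>a. (a, b)) ` {a \<in> {1..int A}. [a ^ 2 * b ^ 3 = l] (mod int q)})"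
      by (rule card_mono[rotated])
    also have "\<dots> \<le> (\<Sum>b\<in>{int M..<2 * int M}. card ((\<lambda>a. (a, b)) ` {a \<in> {1..int A}. [a ^ 2 * b ^ 3 = l] (mod int q)}))"
      by (intro card_UN_le) simp
    finally have "real (card (dyadic_pairs q x l j)) \<le>
      (\<Sum>b\<in>{int M..<2 * int M}. real (card ((\<lambda>a. (a, b)) ` {a \<in> {1..int A}. [a ^ 2 * b ^ 3 = l] (mod int q)})))"
      by (simp only: of_nat_le_iff of_nat_sum[symmetric])
    also have "\<dots> \<le> (\<Sum>b\<in>{int M..<2 * int M}. 3 * real (card {d. d dvd q}) * (real A / real q + 1))"
    proof (rule sum_mono)
      fix b
      have "card ((\<lambda>a. (a, b)) ` {a \<in> {1..int A}. [a ^ 2 * b ^ 3 = l] (mod int q)}) =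
        card {a \<in> {1..int A}. [a ^ 2 * b ^ 3 = l] (mod int q)}"
        by (rule card_image) (simp add: inj_on_def)
      thus "real (card ((\<lambda>a. (a, b)) ` {a \<in> {1..int A}. [a ^ 2 * b ^ 3 = l] (mod int q)})) \<le>
        3 * real (card {d. d dvd q}) * (real A / real q + 1)"
        using card_fixed_b_le[OF _ l, of A b] q by simp
    qed
    also have "\<dots> = 3 * real (card {d. d dvd q}) * (real A * real M / real q + real M)"
      by (simp add: algebra_simps)
    also have "\<dots> \<le> 3 * weight q * (R + R)"
      using weight_ge_card_divisors[of q] AMR MR by (intro mult_mono add_mono) (auto simp: weight_def)
    also have "\<dots> = 6 * (weight q * R)"
      by simp
    also have "\<dots> \<le> 20000 * (weight q * R)"
      using R0 by (intro mult_right_mono) (auto simp: weight_def)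
    finally show ?thesis
      by (simp add: R_def)
  next
    case False
    define r where "r = sqrt (real q)"
    have r: "r > 0" "r ^ 2 = real q"
      using q by (auto simp: r_def)
    have qM: "real q \<le> real M ^ 3"
      using False by (metis not_less of_nat_le_iff of_nat_power)
    have 1: "r \<le> R"
      by (rule R) (use qx in \<open>simp only: r(2), simp add: power2_eq_square power3_eq_cube mult_ac\<close>)
    have 2: "r * (real A / real q) \<le> R"
    proof (rule R)
      have "(r * (real A / real q)) ^ 2 * real q ^ 2 = real A ^ 2 * real q"
        using q by (simp add: power_divide power_mult_distrib r(2))
      also have "\<dots> \<le> real A ^ 2 * real M ^ 3"
        by (intro mult_left_mono qM) simp
      finally show "(r * (real A / real q)) ^ 2 * real q ^ 2 \<le> x"
        using AM by linarith
    qed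
    have 3: "r * (real M / real q) \<le> R"
    proof (rule R)
      \<comment> \<open>M^3 \<le> x and q^3 \<le> x combine to M^6 q^3 \<le> x^3, and a cube root
        gives M^2 q \<le> x.\<close>
      have "(real M ^ 2 * real q) ^ 3 = (real M ^ 3) ^ 2 * real q ^ 3"
        by (simp add: power_mult_distrib power_mult[symmetric])
      also have "\<dots> \<le> x ^ 2 * x"
        using M3 qx x0 by (intro mult_mono power_mono) auto
      also have "\<dots> = x ^ 3"
        by (simp add: power2_eq_square power3_eq_cube)
      finally have "real M ^ 2 * real q \<le> x"
        using x0 by (simp add: power_mono_iff)
      thus "(r * (real M / real q)) ^ 2 * real q ^ 2 \<le> x"
        using q by (simp add: power_divide power_mult_distrib r(2) mult.commute)
    qed
    have 4: "r * (real A / real q) * (real M / real q) \<le> R"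
    proof -
      have "1 \<le> real q"
        using q by simp
      hence "r * 1 \<le> r * r"
        using r by (intro mult_left_mono) (auto simp: r_def)
      hence "r \<le> real q"
        using r(2) by (simp add: power2_eq_square)
      hence "r / real q \<le> 1"
        using q by simp
      hence "(r / real q) * (real A * real M / real q) \<le> 1 * (real A * real M / real q)"
        by (rule mult_right_mono) simp
      thus ?thesis
        using AMR by (simp add: mult_ac)
    qed
    have "dyadic_pairs q x l j \<subseteq> {(a, b) \<in> {1..int A} \<times> {1..int (2 * M)}. [a ^ 2 * b ^ 3 = l] (mod int q)}"
    proof
      fix ab assume ab: "ab \<in> dyadic_pairs q x l j"
      obtain a b where [simp]: "ab = (a, b)"
        by force
      have "[a ^ 2 * b ^ 3 = l] (mod int q)"
        using ab by (simp add: dyadic_pairs_def)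
      thus "ab \<in> {(a, b) \<in> {1..int A} \<times> {1..int (2 * M)}. [a ^ 2 * b ^ 3 = l] (mod int q)}"
        using mem(1,2)[of a b] ab M1 by auto
    qed
    moreover have "finite {(a, b) \<in> {1..int A} \<times> {1..int (2 * M)}. [a ^ 2 * b ^ 3 = l] (mod int q)}"
      by (rule finite_subset[of _ "{1..int A} \<times> {1..int (2 * M)}"]) auto
    ultimately have "real (card (dyadic_pairs q x l j)) \<le>
      real (card {(a, b) \<in> {1..int A} \<times> {1..int (2 * M)}. [a ^ 2 * b ^ 3 = l] (mod int q)})"
      by (simp only: of_nat_le_iff card_mono)
    also have "\<dots> \<le> weight q * (32 * r * (1 + 16 * real A / real q) * (1 + 16 * real (2 * M) / real q) +
      1024 * real A * real (2 * M) / real q)"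
      unfolding r_def using M1 by (intro rectangle_count_le q l A1) simp
    also have "\<dots> = weight q * (32 * r + 512 * (r * (real A / real q)) + 1024 * (r * (real M / real q)) +
      16384 * (r * (real A / real q) * (real M / real q)) + 2048 * (real A * real M / real q))"
      by (simp add: ring_distribs add_divide_distrib mult_ac)
    \<comment> \<open>The constant 20000 is the sum of these five coefficients.\<close>
    also have "\<dots> \<le> weight q * (32 * R + 512 * R + 1024 * R + 16384 * R + 2048 * R)"
      by (intro mult_left_mono add_mono 1 2 3 4 AMR) (auto simp: weight_def)
    also have "\<dots> = 20000 * weight q * R"
      by simp
    finally show ?thesis
      by (simp add: R_def)
  qed
qed

text \<open>Each squarefull number comes from at least one pair, and b \<le> n \<le> x < 2^(k+1)
  confines the dyadic index to j \<le> k.\<close>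

lemma squarefull_count_le:
  assumes q: "q \<ge> 1" and qx: "real q ^ 3 \<le> x" and l: "coprime l (int q)" and k: "x < 2 ^ Suc k"
  shows "real (squarefull_count q x l) \<le> real (Suc k) * (20000 * weight q * (sqrt x / real q))"
proof -
  let ?P = "\<Union>j\<in>{..k}. dyadic_pairs q x l j"
  have fin: "finite (dyadic_pairs q x l j)" for j
  proof (rule finite_subset)
    show "dyadic_pairs q x l j \<subseteq> {1..\<lfloor>x\<rfloor>} \<times> {1..2 ^ Suc j}"
    proof clarify
      fix a b assume ab: "(a, b) \<in> dyadic_pairs q x l j"
      hence 1: "a \<ge> 1" "b \<ge> 1"
        by (simp_all add: dyadic_pairs_def)
      have "a * 1 \<le> a * (a * b ^ 3)"
        using 1 by (intro mult_left_mono) (auto simp: int_one_le_iff_zero_less)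
      hence "a \<le> a ^ 2 * b ^ 3"
        by (simp add: power2_eq_square mult.assoc)
      hence "real_of_int a \<le> real_of_int (a ^ 2 * b ^ 3)"
        by (simp only: of_int_le_iff)
      also have "\<dots> \<le> x"
        using ab by (simp add: dyadic_pairs_def)
      finally have "a \<le> \<lfloor>x\<rfloor>"
        by (simp add: le_floor_iff)
      thus "a \<in> {1..\<lfloor>x\<rfloor>} \<and> b \<in> {1..2 ^ Suc j}"
        using ab 1 by (simp add: dyadic_pairs_def)
    qed
  qed simp
  have "{n. real n \<le> x \<and> squarefull n \<and> [int n = l] (mod int q)} \<subseteq> (\<lambda>(a, b). nat (a ^ 2 * b ^ 3)) ` ?P"
  proof
    fix n assume n: "n \<in> {n. real n \<le> x \<and> squarefull n \<and> [int n = l] (mod int q)}"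
    then obtain a b where ab: "a > 0" "b > 0" "n = a ^ 2 * b ^ 3"
      using squarefull_imp_square_times_cube by blast
    obtain j where j: "2 ^ j \<le> b" "b < 2 ^ (j + 1)"
      using ex_power_ivl1[of 2 b] ab by auto
    have "b * 1 \<le> b * (a ^ 2 * b ^ 2)"
      using ab by (intro mult_left_mono) auto
    hence "b \<le> n"
      by (simp add: ab power2_eq_square power3_eq_cube mult_ac)
    hence "real b < 2 ^ Suc k"
      using n k by auto
    hence "b < 2 ^ Suc k"
      by (metis of_nat_less_iff of_nat_numeral of_nat_power)
    hence "(2 :: nat) ^ j < 2 ^ Suc k"
      using j(1) by linarith
    hence "j < Suc k"
      by (rule power_less_imp_less_exp[rotated]) simp
    moreover have "(int a, int b) \<in> dyadic_pairs q x l j"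
    proof -
      have "int (2 ^ j) \<le> int b" "int b < int (2 ^ (j + 1))"
        using j by (simp_all only: of_nat_le_iff of_nat_less_iff)
      hence "(2 :: int) ^ j \<le> int b" "int b < 2 ^ Suc j"
        by simp_all
      thus ?thesis
        using n ab by (simp add: dyadic_pairs_def)
    qed
    ultimately have "(int a, int b) \<in> ?P"
      by auto
    moreover have "n = nat (int a ^ 2 * int b ^ 3)"
      by (simp add: ab nat_mult_distrib nat_power_eq)
    ultimately show "n \<in> (\<lambda>(a, b). nat (a ^ 2 * b ^ 3)) ` ?P"
      by (intro image_eqI[of _ _ "(int a, int b)"]) auto
  qed
  hence "squarefull_count q x l \<le> card ((\<lambda>(a, b). nat (a ^ 2 * b ^ 3)) ` ?P)"
    unfolding squarefull_count_def using fin by (intro card_mono) auto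
  also have "\<dots> \<le> card ?P"
    using fin by (intro card_image_le) auto
  also have "\<dots> \<le> (\<Sum>j\<in>{..k}. card (dyadic_pairs q x l j))"
    by (intro card_UN_le) simp
  finally have "real (squarefull_count q x l) \<le> (\<Sum>j\<in>{..k}. real (card (dyadic_pairs q x l j)))"
    by (simp only: of_nat_le_iff of_nat_sum[symmetric])
  also have "\<dots> \<le> (\<Sum>j\<in>{..k}. 20000 * weight q * (sqrt x / real q))"
    by (intro sum_mono card_dyadic_pairs_le q qx l)
  finally show ?thesis
    by simp
qed

theorem corollary1:
  fixes \<epsilon> :: real
  assumes "\<epsilon> > 0"
  shows "\<exists>C>0. \<forall>(x::real) (q::nat) (l::int).
           x > 0 \<longrightarrow> q \<ge> 1 \<longrightarrow> real q \<le> x powr (1/3) \<longrightarrow> coprime l (int q) \<longrightarrow>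
           real (squarefull_count q x l) \<le> C * (x powr (1/2 + \<epsilon>) / real q)"
proof -
  \<comment> \<open>One half of \<epsilon> pays for the k + 1 dyadic ranges, the other half for the
    weight.\<close>
  have \<epsilon>: "\<epsilon> / 2 > 0"
    using assms by simp
  obtain A where A: "A > 0" "\<And>n. n > 0 \<Longrightarrow> weight n \<le> A * real n powr (\<epsilon> / 2)"
    using weight_growth[OF \<epsilon>] by blast
  obtain D where D: "D \<ge> 1" "\<And>k :: nat. real (Suc k) \<le> D * 2 powr (\<epsilon> / 2 * real k)"
    using linear_le_exponential[OF \<epsilon>] by blast
  have "real (squarefull_count q x l) \<le> 20000 * A * D * (x powr (1/2 + \<epsilon>) / real q)"
    if x: "x > 0" and q: "q \<ge> 1" and qx: "real q \<le> x powr (1/3)" and l: "coprime l (int q)" for x q l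
  proof -
    have "real q ^ 3 \<le> (x powr (1/3)) ^ 3"
      using qx by (rule power_mono) simp
    also have "\<dots> = x"
      using x by (simp add: powr_power)
    finally have q3: "real q ^ 3 \<le> x" .
    have "real q ^ 1 \<le> real q ^ 3"
      using q by (intro power_increasing) auto
    also note q3
    finally have qlex: "real q \<le> x"
      by simp
    hence x1: "x \<ge> 1"
      using q by linarith
    have "1 \<le> nat \<lfloor>x\<rfloor>"
      using x1 by (simp add: le_nat_iff le_floor_iff)
    then obtain k where k: "2 ^ k \<le> nat \<lfloor>x\<rfloor>" "nat \<lfloor>x\<rfloor> < 2 ^ (k + 1)"
      using ex_power_ivl1[of 2 "nat \<lfloor>x\<rfloor>"] by auto
    have "real (2 ^ k) \<le> real (nat \<lfloor>x\<rfloor>)"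
      using k(1) by (simp only: of_nat_le_iff)
    also have "\<dots> \<le> x"
      using x1 by (simp add: of_nat_floor)
    finally have kx: "2 ^ k \<le> x"
      by simp
    have "Suc (nat \<lfloor>x\<rfloor>) \<le> 2 ^ Suc k"
      using k(2) by simp
    hence "real (Suc (nat \<lfloor>x\<rfloor>)) \<le> real (2 ^ Suc k)"
      by (simp only: of_nat_le_iff)
    moreover have "x < real (Suc (nat \<lfloor>x\<rfloor>))"
      using x1 by (simp add: add.commute) linarith
    ultimately have xk: "x < 2 ^ Suc k"
      by simp
    have "real (Suc k) \<le> D * 2 powr (\<epsilon> / 2 * real k)"
      by (rule D(2))
    also have "2 powr (\<epsilon> / 2 * real k) = (2 ^ k) powr (\<epsilon> / 2)"
      by (simp add: powr_powr powr_realpow[symmetric] mult.commute)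
    also have "\<dots> \<le> x powr (\<epsilon> / 2)"
      using kx assms by (intro powr_mono2) auto
    finally have Dk: "real (Suc k) \<le> D * x powr (\<epsilon> / 2)"
      using D(1) by simp
    have "weight q \<le> A * real q powr (\<epsilon> / 2)"
      using A(2) q by simp
    also have "\<dots> \<le> A * x powr (\<epsilon> / 2)"
      using A(1) qlex assms by (intro mult_left_mono powr_mono2) auto
    finally have Aw: "weight q \<le> A * x powr (\<epsilon> / 2)" .
    have w0: "weight q \<ge> 0"
      by (simp add: weight_def)
    have "real (squarefull_count q x l) \<le> real (Suc k) * (20000 * weight q * (sqrt x / real q))"
      by (rule squarefull_count_le[OF q q3 l xk])
    also have "\<dots> \<le> (D * x powr (\<epsilon> / 2)) * (20000 * (A * x powr (\<epsilon> / 2)) * (sqrt x / real q))"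
      using Dk Aw D(1) x w0 by (intro mult_mono) auto
    also have "\<dots> = 20000 * A * D * ((x powr (1/2) * (x powr (\<epsilon> / 2) * x powr (\<epsilon> / 2))) / real q)"
      using x by (simp add: powr_half_sqrt mult_ac)
    also have "x powr (1/2) * (x powr (\<epsilon> / 2) * x powr (\<epsilon> / 2)) = x powr (1/2 + \<epsilon>)"
      by (simp add: powr_add[symmetric])
    finally show ?thesis .
  qed
  moreover have "20000 * A * D > 0"
    using A(1) D(1) by simp
  ultimately show ?thesis
    by blast
qed

end
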